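(* Let $a_1,b_1,a_2,b_2$ be integers with $a_1>0$, $a_2>0$, and $D:=a_1b_2-a_2b_1\neq 0$. Call a positive integer $n$ of $\varphi$-exceptional form if there exist positive integers $m_1,m_2,k_1,k_2,l$ with $k_1\neq k_2$ such that $m_1=\frac{k_2D}{a_2(k_1-k_2)}$, $m_2=\frac{k_1D}{a_1(k_1-k_2)}$, $k_1\varphi(m_1)=k_2\varphi(m_2)$, both $q_1=k_1l+1$ and $q_2=k_2l+1$ are prime, and $n=\frac{m_1q_1-b_1}{a_1}$. Call a positive integer $n$ of $\sigma$-exceptional form if there exist positive integers $m_1,m_2,k_1,k_2,l$ with $k_1\neq k_2$ such that $m_1=\frac{k_2D}{a_2(k_2-k_1)}$, $m_2=\frac{k_1D}{a_1(k_2-k_1)}$, $k_1\sigma(m_1)=k_2\sigma(m_2)$, both $q_1=k_1l-1$ and $q_2=k_2l-1$ are prime, and $n=\frac{m_1q_1-b_1}{a_1}$. Let $N(x)$ be the number of positive integers $n\le x$ with $a_1n+b_1>0$, $a_2n+b_2>0$, $\varphi(a_1n+b_1)=\varphi(a_2n+b_2)$, and $n$ not of $\varphi$-exceptional form. Let $M(x)$ be the number of positive integers $n\le x$ with $a_1n+b_1>0$, $a_2n+b_2>0$, $\sigma(a_1n+b_1)=\sigma(a_2n+b_2)$, and $n$ not of $\sigma$-exceptional form. Then for all sufficiently large $x$, $$N(x)\ll x\exp\!\left(-2^{-1/2}(\log x\,\log\log\log x)^{1/2}\right),\qquad M(x)\ll x\exp\!\left(-2^{-1/2}(\log x\,\log\log\log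 x)^{1/2}\right),$$ where the implied constants may depend on $a_1,b_1,a_2,b_2$.
   Context: $\sigma(m)$ denotes the sum of the positive divisors of $m$ and $\varphi$ is Euler's totient function. *)

theory Defs
  imports "HOL-Number_Theory.Number_Theory"
begin

definition divsum :: "nat \<Rightarrow> nat" where
  "divsum m = (\<Sum>d \<in> {d. d dvd m}. d)"

text \<open>n of phi-exceptional form (with D = a1 b2 - a2 b1). Fractional equalities
  m1 = k2 D / (a2 (k1 - k2)) etc. are written multiplied out (denominators are nonzero).\<close>
definition phi_exceptional :: "int \<Rightarrow> int \<Rightarrow> int \<Rightarrow> int \<Rightarrow> nat \<Rightarrow> bool" where
  "phi_exceptional a1 b1 a2 b2 n \<longleftrightarrow>
     (\<exists>m1 m2 k1 k2 l :: nat. m1 > 0 \<and> m2 > 0 \<and> k1 > 0 \<and> k2 > 0 \<and> l > 0 \<and> k1 \<noteq> k2 \<and>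
        int m1 * (a2 * (int k1 - int k2)) = int k2 * (a1 * b2 - a2 * b1) \<and>
        int m2 * (a1 * (int k1 - int k2)) = int k1 * (a1 * b2 - a2 * b1) \<and>
        k1 * totient m1 = k2 * totient m2 \<and>
        prime (k1 * l + 1) \<and> prime (k2 * l + 1) \<and>
        a1 * int n = int m1 * int (k1 * l + 1) - b1)"

definition sigma_exceptional :: "int \<Rightarrow> int \<Rightarrow> int \<Rightarrow> int \<Rightarrow> nat \<Rightarrow> bool" where
  "sigma_exceptional a1 b1 a2 b2 n \<longleftrightarrow>
     (\<exists>m1 m2 k1 k2 l :: nat. m1 > 0 \<and> m2 > 0 \<and> k1 > 0 \<and> k2 > 0 \<and> l > 0 \<and> k1 \<noteq> k2 \<and>
        int m1 * (a2 * (int k2 - int k1)) = int k2 * (a1 * b2 - a2 * b1) \<and>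
        int m2 * (a1 * (int k2 - int k1)) = int k1 * (a1 * b2 - a2 * b1) \<and>
        k1 * divsum m1 = k2 * divsum m2 \<and>
        prime (int k1 * int l - 1) \<and> prime (int k2 * int l - 1) \<and>
        a1 * int n = int m1 * (int k1 * int l - 1) - b1)"

definition Ncount :: "int \<Rightarrow> int \<Rightarrow> int \<Rightarrow> int \<Rightarrow> real \<Rightarrow> nat" where
  "Ncount a1 b1 a2 b2 x = card {n :: nat. 0 < n \<and> real n \<le> x \<and>
      a1 * int n + b1 > 0 \<and> a2 * int n + b2 > 0 \<and>
      totient (nat (a1 * int n + b1)) = totient (nat (a2 * int n + b2)) \<and>
      \<not> phi_exceptional a1 b1 a2 b2 n}"

definition Mcount :: "int \<Rightarrow> int \<Rightarrow> int \<Rightarrow> int \<Rightarrow> real \<Rightarrow> nat" where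
  "Mcount a1 b1 a2 b2 x = card {n :: nat. 0 < n \<and> real n \<le> x \<and>
      a1 * int n + b1 > 0 \<and> a2 * int n + b2 > 0 \<and>
      divsum (nat (a1 * int n + b1)) = divsum (nat (a2 * int n + b2)) \<and>
      \<not> sigma_exceptional a1 b1 a2 b2 n}"

end

theory Submission
  imports Defs "HOL-Real_Asymp.Real_Asymp" "HOL-Analysis.Harmonic_Numbers"
begin

text \<open>
  Let \<open>f\<close> be the totient (\<open>\<epsilon> = 1\<close>) or the divisor sum (\<open>\<epsilon> = -1\<close>), so \<open>f q = q - \<epsilon>\<close> for primes \<open>q\<close>,
  and let \<open>n1 = a1 * n + b1\<close>, \<open>n2 = a2 * n + b2\<close> with \<open>f n1 = f n2\<close>. Choose \<open>y\<close> such that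
  \<open>sqrt y\<close> is roughly the saving to be proved.
  If all primes \<open>q\<close> dividing \<open>n1\<close> have a \<open>y\<close>-smooth shift \<open>q - \<epsilon>\<close>, then \<open>n1\<close> lies in a set that is sparse
  by Rankin's method; a sieve bound for primes with smooth shifts is needed to get the constant
  \<open>1 / sqrt 2\<close> without an error term in the exponent.
  Otherwise some prime \<open>p > y\<close> divides \<open>f n1 = f n2\<close>, and outside a negligible set
  there are primes \<open>q1\<close>, \<open>q2\<close>, congruent to \<open>\<epsilon>\<close> modulo \<open>p\<close>, that divide \<open>n1\<close> and \<open>n2\<close> exactly once.
  If \<open>q1 * q2 \<le> x * sqrt y\<close>, one sums the number of \<open>n\<close> in a residue class modulo \<open>q1 * q2\<close>.
  If \<open>q1 * q2 > x * sqrt y\<close>, the cofactors \<open>m1 = n1 / q1\<close>, \<open>m2 = n2 / q2\<close> have a product of order at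
  most \<open>x / sqrt y\<close>, and \<open>(q1, q2)\<close> solves two linear equations with coefficients depending on
  \<open>(m1, m2)\<close>: either these determine \<open>n\<close>, or they are singular and \<open>n\<close> is of exceptional form.
\<close>

subsection \<open>Sums over primes\<close>

text \<open>The constant comes from a balance. Write \<open>L = ln x\<close>,
  \<open>Y = ln y\<close>. The prime pairs and the cofactors save \<open>exp (Y / 2)\<close> up to
  logarithms, while Rankin's method with exponent \<open>1 - w / Y\<close> saves
  \<open>exp (w * L / Y)\<close>. The weight \<open>exp w\<close> enters the sums over primes, so
  \<open>w\<close> is taken only slightly larger than \<open>ln (ln L)\<close>; equating the savings
  gives \<open>Y\<close> near \<open>sqrt (2 * L * ln (ln L))\<close>. The choice
  \<open>w = ln (ln L) + 2\<close> leaves a surplus of order \<open>sqrt (L / ln (ln L))\<close> in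
  the exponent to pay for the Euler product over the primes \<open>q\<close> with smooth shift. The
  obstacle: treating \<open>q - \<epsilon>\<close> as an arbitrary \<open>y\<close>-smooth integer
  bounds the sum of \<open>q powr -(1 - w / Y)\<close> only by \<open>Y\<close> times a small power
  of \<open>L\<close>, which exceeds that surplus. Using that \<open>q\<close> itself is prime when
  \<open>q - \<epsilon> = d * k\<close> with a large prime \<open>k\<close>, the sieve gains a power
  of \<open>Y\<close> and brings the sum below \<open>L powr 0.45\<close>. All this needs only upper
  bounds up to constants, so Chebyshev, Mertens and Brun's pure sieve suffice.\<close>

lemma euler_product_upper:
  fixes P S :: "nat set" and s :: real
  assumes "finite P" "\<And>p. p \<in> P \<Longrightarrow> prime p" "s > 0"
    and "finite S" "\<And>n. n \<in> S \<Longrightarrow> n > 0" "\<And>n p. n \<in> S \<Longrightarrow> prime p \<Longrightarrow> p dvd n \<Longrightarrow> p \<in> P"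
  shows "(\<Sum>n\<in>S. real n powr -s) \<le> (\<Prod>p\<in>P. 1 / (1 - real p powr -s))"
  using assms(1,2,4-6)
proof (induction P arbitrary: S rule: finite_induct)
  case empty
  have "n = 1" if "n \<in> S" for n
    using empty.prems(4)[OF that] empty.prems(3)[OF that] by (metis empty_iff prime_factor_nat)
  hence "S \<subseteq> {1}" by auto
  hence "(\<Sum>n\<in>S. real n powr -s) \<le> (\<Sum>n\<in>{1::nat}. real n powr -s)"
    by (intro sum_mono2) auto
  thus ?case by simp
next
  case (insert p P)
  have p: "prime p" using insert.prems(1) by blast
  \<comment> \<open>\<open>g\<close> separates the exact power of \<open>p\<close> from the
    cofactor. Its injectivity and the box \<open>{..A} \<times> S'\<close> turn the sum over
    \<open>S\<close> into a geometric series times a sum over integers composed of the remaining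
    primes.\<close>
  define g where "g = (\<lambda>n. (multiplicity p n, n div p ^ multiplicity p n))"
  have dec: "n = p ^ fst (g n) * snd (g n)" "\<not> p dvd snd (g n)" "snd (g n) > 0" if "n \<in> S" for n
  proof -
    have n: "n > 0" using insert.prems(3) that by blast
    show 1: "n = p ^ fst (g n) * snd (g n)"
      unfolding g_def by (simp add: multiplicity_dvd)
    show "\<not> p dvd snd (g n)"
      unfolding g_def using n p by (simp add: multiplicity_decompose prime_nat_iff)
    show "snd (g n) > 0" using 1 n by (metis gr0I mult_is_0)
  qed
  have inj: "inj_on g S" by (rule inj_onI) (metis dec(1))
  define A where "A = Max (insert 0 (fst ` g ` S))"
  define S' where "S' = snd ` g ` S"
  have finS': "finite S'" unfolding S'_def using insert.prems(2) by blast
  have sub: "g ` S \<subseteq> {..A} \<times> S'"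
  proof
    fix u assume u: "u \<in> g ` S"
    have "fst u \<le> A" unfolding A_def using u insert.prems(2) by (intro Max_ge) auto
    thus "u \<in> {..A} \<times> S'" using u unfolding S'_def by (simp add: mem_Times_iff)
  qed
  have IH: "(\<Sum>n\<in>S'. real n powr -s) \<le> (\<Prod>p\<in>P. 1 / (1 - real p powr -s))"
  proof (rule insert.IH)
    show "finite S'" by fact
    show "\<And>q. q \<in> P \<Longrightarrow> prime q" using insert.prems(1) by blast
    show "\<And>n. n \<in> S' \<Longrightarrow> 0 < n" unfolding S'_def using dec(3) by auto
    fix n q assume n: "n \<in> S'" and q: "prime q" "q dvd n"
    obtain m where m: "m \<in> S" "n = snd (g m)" using n unfolding S'_def by auto
    have "q dvd m" using dec(1)[OF m(1)] m(2) q(2) by (metis dvd_mult)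
    moreover have "q \<noteq> p" using dec(2)[OF m(1)] m(2) q(2) by auto
    ultimately show "q \<in> P" using insert.prems(4)[OF m(1) q(1)] by blast
  qed
  define t where "t = real p powr -s"
  have p1: "real p > 1" using p prime_gt_1_nat by auto
  have t: "0 < t" "t < 1" unfolding t_def using p1 assms(3)
    by (auto intro: powr_less_one)
  have "(\<Sum>n\<in>S. real n powr -s) = (\<Sum>n\<in>S. t ^ fst (g n) * real (snd (g n)) powr -s)"
  proof (rule sum.cong[OF refl])
    fix n assume n: "n \<in> S"
    have "real n = real p ^ fst (g n) * real (snd (g n))"
      using dec(1)[OF n] by (metis of_nat_mult of_nat_power)
    hence "real n powr -s = (real p ^ fst (g n)) powr -s * real (snd (g n)) powr -s"
      by (simp add: powr_mult)
    also have "(real p ^ fst (g n)) powr -s = t ^ fst (g n)"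
      unfolding t_def using p1 by (simp add: powr_powr flip: powr_realpow)
        (simp add: mult.commute)
    finally show "real n powr -s = t ^ fst (g n) * real (snd (g n)) powr -s" .
  qed
  also have "\<dots> = (\<Sum>u\<in>g ` S. t ^ fst u * real (snd u) powr -s)"
    using inj by (simp add: sum.reindex)
  also have "\<dots> \<le> (\<Sum>u\<in>{..A} \<times> S'. t ^ fst u * real (snd u) powr -s)"
    using sub finS' t by (intro sum_mono2) auto
  also have "\<dots> = (\<Sum>a\<le>A. t ^ a) * (\<Sum>n\<in>S'. real n powr -s)"
    by (simp add: sum_product sum.cartesian_product case_prod_beta)
  also have "\<dots> \<le> (1 / (1 - t)) * (\<Prod>p\<in>P. 1 / (1 - real p powr -s))"
  proof (intro mult_mono IH)
    have "(\<Sum>a\<le>A. t ^ a) = (1 - t ^ Suc A) / (1 - t)"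
      using t sum_gp_basic[of t A] by (simp add: field_simps)
    thus "(\<Sum>a\<le>A. t ^ a) \<le> 1 / (1 - t)" using t by (simp add: divide_simps)
  qed (use t in \<open>auto intro: sum_nonneg\<close>)
  also have "\<dots> = (\<Prod>p\<in>insert p P. 1 / (1 - real p powr -s))"
    unfolding t_def using insert.hyps by simp
  finally show ?case .
qed

section \<open>Chebyshev bounds on dyadic blocks\<close>

lemma prod_prime_set_dvd:
  fixes n :: nat
  assumes "finite P" "\<And>p. p \<in> P \<Longrightarrow> prime p" "\<And>p. p \<in> P \<Longrightarrow> p dvd n"
  shows "\<Prod>P dvd n"
  using assms
proof (induction P rule: finite_induct)
  case (insert p P)
  have "coprime p (\<Prod>P)"
    using insert by (intro prod_coprime_right) (metis insertCI primes_coprime)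
  thus ?case using insert by (auto intro: divides_mult)
qed simp

text \<open>All primes in \<open>(n, 2 * n]\<close> divide the central binomial coefficient, which
  is at most \<open>4 ^ n\<close>.\<close>

lemma chebyshev_block:
  fixes n :: nat
  assumes "n > 0"
  shows "(\<Sum>p | prime p \<and> n < p \<and> p \<le> 2 * n. ln (real p)) \<le> real n * ln 4"
proof -
  let ?P = "{p. prime p \<and> n < p \<and> p \<le> 2 * n}"
  have fin: "finite ?P" by (rule finite_subset[of _ "{..2*n}"]) auto
  have eq: "(fact (2 * n) :: nat) = (2 * n choose n) * fact n * fact n"
    using binomial_fact_lemma[of n "2 * n"] by (simp add: mult_ac)
  have "\<Prod>?P dvd (2 * n choose n)"
  proof (rule prod_prime_set_dvd[OF fin])
    fix p assume p: "p \<in> ?P"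
    have "p dvd (2 * n choose n) * fact n * fact n"
      unfolding eq[symmetric] using p by (auto simp: prime_dvd_fact_iff)
    moreover have "\<not> p dvd fact n" using p by (auto simp: prime_dvd_fact_iff)
    ultimately show "p dvd (2 * n choose n)" using p by (auto simp: prime_dvd_mult_iff)
  qed auto
  hence "\<Prod>?P \<le> (2 * n choose n)" by (intro dvd_imp_le) auto
  also have "\<dots> \<le> 2 ^ (2 * n)" by (rule binomial_le_pow2)
  also have "\<dots> = 4 ^ n" by (simp add: power_mult)
  finally have "real (\<Prod>?P) \<le> 4 ^ n" by (metis of_nat_le_iff of_nat_numeral of_nat_power)
  moreover have pos: "real (\<Prod>?P) > 0" using fin prime_gt_0_nat by (auto intro!: prod_pos)
  ultimately have "ln (real (\<Prod>?P)) \<le> ln (4 ^ n)" by simp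
  moreover have "ln (real (\<Prod>?P)) = (\<Sum>p\<in>?P. ln (real p))"
    unfolding of_nat_prod using fin prime_gt_0_nat by (subst ln_prod) auto
  ultimately show ?thesis by (simp add: ln_realpow)
qed

lemma sum_inverse_primes_block:
  fixes n :: nat
  assumes "n > 1"
  shows "(\<Sum>p | prime p \<and> n < p \<and> p \<le> 2 * n. 1 / real p) \<le> 2 / ln n"
proof -
  let ?P = "{p. prime p \<and> n < p \<and> p \<le> 2 * n}"
  have "(\<Sum>p\<in>?P. 1 / real p) \<le> (\<Sum>p\<in>?P. ln (real p) / (n * ln n))"
  proof (rule sum_mono)
    fix p assume p: "p \<in> ?P"
    have "1 / real p \<le> 1 / real n" using p assms by (auto simp: field_simps)
    also have "\<dots> = ln n / (n * ln n)" using assms by simp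
    also have "\<dots> \<le> ln (real p) / (n * ln n)" using p assms by (intro divide_right_mono) auto
    finally show "1 / real p \<le> ln (real p) / (n * ln n)" .
  qed
  also have "\<dots> = (\<Sum>p\<in>?P. ln (real p)) / (n * ln n)" by (simp add: sum_divide_distrib)
  also have "\<dots> \<le> (real n * ln 4) / (n * ln n)"
    using chebyshev_block[of n] assms by (intro divide_right_mono) auto
  also have "\<dots> = ln 4 / ln n" using assms by simp
  also have "\<dots> \<le> 2 / ln n"
  proof -
    have "ln 4 = 2 * ln (2::real)" using ln_realpow[of "2::real" 2] by simp
    hence "ln 4 \<le> (2::real)" using ln2_le_25_over_36 by linarith
    thus ?thesis using assms by (intro divide_right_mono) auto
  qed
  finally show ?thesis .
qed

lemma sum_log_primes_block:
  fixes n :: nat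
  assumes "n > 0"
  shows "(\<Sum>p | prime p \<and> n < p \<and> p \<le> 2 * n. ln (real p) / real p) \<le> 2"
proof -
  let ?P = "{p. prime p \<and> n < p \<and> p \<le> 2 * n}"
  have "(\<Sum>p\<in>?P. ln (real p) / real p) \<le> (\<Sum>p\<in>?P. ln (real p) / real n)"
    using assms by (intro sum_mono divide_left_mono) auto
  also have "\<dots> = (\<Sum>p\<in>?P. ln (real p)) / real n" by (simp add: sum_divide_distrib)
  also have "\<dots> \<le> (real n * ln 4) / real n"
    using chebyshev_block[of n] assms by (intro divide_right_mono) auto
  also have "\<dots> = ln 4" using assms by simp
  also have "\<dots> \<le> 2"
  proof -
    have "ln 4 = 2 * ln (2::real)" using ln_realpow[of "2::real" 2] by simp
    thus ?thesis using ln2_le_25_over_36 by linarith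
  qed
  finally show ?thesis .
qed

definition primes_upto :: "real \<Rightarrow> nat set" where
  "primes_upto y = {p. prime p \<and> real p \<le> y}"

lemma finite_primes_upto [simp]: "finite (primes_upto y)"
proof (rule finite_subset)
  show "primes_upto y \<subseteq> {..nat \<lfloor>y\<rfloor>}"
    unfolding primes_upto_def by (auto simp: le_nat_floor)
qed simp

lemma primes_upto_mono: "a \<le> b \<Longrightarrow> primes_upto a \<subseteq> primes_upto b"
  unfolding primes_upto_def by auto

lemma sum_primes_blocks:
  fixes f :: "nat \<Rightarrow> real"
  assumes "\<And>j. (\<Sum>p | prime p \<and> n * 2 ^ j < p \<and> p \<le> 2 * (n * 2 ^ j). f p) \<le> c"
  shows "(\<Sum>p | prime p \<and> n < p \<and> p \<le> n * 2 ^ J. f p) \<le> real J * c"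
proof (induction J)
  case 0
  have "{p. prime p \<and> n < p \<and> p \<le> n * 2 ^ 0} = {}" by auto
  thus ?case by (simp only: sum.empty of_nat_0 mult_zero_left)
next
  case (Suc J)
  let ?A = "{p. prime p \<and> n < p \<and> p \<le> n * 2 ^ J}"
  let ?B = "{p. prime p \<and> n * 2 ^ J < p \<and> p \<le> 2 * (n * 2 ^ J)}"
  have "n \<le> n * 2 ^ J" by simp
  moreover have "n * 2 ^ Suc J = 2 * (n * 2 ^ J)" by simp
  ultimately have "{p. prime p \<and> n < p \<and> p \<le> n * 2 ^ Suc J} = ?A \<union> ?B"
    by (simp only: set_eq_iff Un_iff mem_Collect_eq) linarith
  moreover have "finite ?A" "finite ?B"
    by (auto intro: finite_subset[of _ "{..n * 2 ^ J}"] finite_subset[of _ "{..2 * (n * 2 ^ J)}"])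
  moreover have "?A \<inter> ?B = {}" by auto
  ultimately have "(\<Sum>p | prime p \<and> n < p \<and> p \<le> n * 2 ^ Suc J. f p) = sum f ?A + sum f ?B"
    by (simp add: sum.union_disjoint)
  also have "\<dots> \<le> real J * c + c" by (intro add_mono Suc assms)
  finally show ?case by (simp add: algebra_simps)
qed

lemma ex_dyadic_exponent:
  fixes b :: real and n :: nat
  assumes "n > 0" "b > 0"
  obtains J where "b \<le> real (n * 2 ^ J)" "real J \<le> max 0 (ln (b / n) / ln 2) + 1"
proof
  let ?t = "ln (b / n) / ln 2"
  define J where "J = nat \<lceil>?t\<rceil>"
  have "?t \<le> real J" unfolding J_def by linarith
  hence "ln (b / n) \<le> real J * ln 2" by (simp add: field_simps)
  hence "ln (b / n) \<le> ln (2 ^ J)" by (simp add: ln_realpow)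
  hence "b / n \<le> 2 ^ J" using assms by (subst (asm) ln_le_cancel_iff) auto
  thus "b \<le> real (n * 2 ^ J)" using assms by (simp add: field_simps)
  show "real J \<le> max 0 ?t + 1" unfolding J_def by linarith
qed

lemma inverse_ln_2_le: "1 / ln (2::real) \<le> 3 / 2"
  using ln2_ge_two_thirds by (simp add: field_simps)

text \<open>About \<open>ln (b / a) + 1\<close> dyadic blocks contribute \<open>O(1 / ln a)\<close>
  each. The constant is lossy, but the shape is what matters: for
  \<open>b / a = y powr \<tau>\<close> and \<open>a \<ge> sqrt y\<close> the result is
  \<open>O(\<tau> + 1 / ln y)\<close>.\<close>

lemma sum_inverse_primes_Ioc:
  fixes a b :: real
  assumes "4 \<le> a" "a \<le> b"
  shows "(\<Sum>p | prime p \<and> a < real p \<and> real p \<le> b. 1 / real p) \<le> 12 * (ln (b / a) + 1) / ln a"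
proof -
  define n where "n = nat \<lfloor>a\<rfloor>"
  have n: "real n \<le> a" "a < real n + 1" "n > 1" unfolding n_def using assms by linarith+
  obtain J where J: "b \<le> real (n * 2 ^ J)" "real J \<le> max 0 (ln (b / n) / ln 2) + 1"
    using ex_dyadic_exponent[of n b] n assms by auto
  have half: "a / 2 \<le> real n" using n assms by linarith
  \<comment> \<open>Passing from \<open>a\<close> to its integer part costs at most a factor 2 in
    the logarithm, because \<open>a \<le> (a / 2) ^ 2\<close> for \<open>4 \<le> a\<close>.\<close>
  have sqrt: "ln a \<le> 2 * ln (real n)"
  proof -
    have "ln a \<le> ln (real n ^ 2)"
    proof (subst ln_le_cancel_iff)
      have "a \<le> (a / 2) ^ 2" using assms by (simp add: power2_eq_square)
      also have "\<dots> \<le> real n ^ 2" using half assms by (intro power_mono) auto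
      finally show "a \<le> real n ^ 2" .
    qed (use assms n in auto)
    thus ?thesis using n by (simp add: ln_realpow)
  qed
  have lna: "ln a > 0" using assms by simp
  have "(\<Sum>p | prime p \<and> a < real p \<and> real p \<le> b. 1 / real p)
      \<le> (\<Sum>p | prime p \<and> n < p \<and> p \<le> n * 2 ^ J. 1 / real p)"
  proof (rule sum_mono2)
    show "finite {p. prime p \<and> n < p \<and> p \<le> n * 2 ^ J}"
      by (rule finite_subset[of _ "{..n * 2 ^ J}"]) auto
    show "{p. prime p \<and> a < real p \<and> real p \<le> b} \<subseteq> {p. prime p \<and> n < p \<and> p \<le> n * 2 ^ J}"
    proof
      fix p assume "p \<in> {p. prime p \<and> a < real p \<and> real p \<le> b}"
      hence p: "prime p" "a < real p" "real p \<le> b" by auto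
      have "real n < real p" using p n by linarith
      moreover have "real p \<le> real (n * 2 ^ J)" using p J by linarith
      ultimately show "p \<in> {p. prime p \<and> n < p \<and> p \<le> n * 2 ^ J}"
        using p by (simp only: of_nat_less_iff of_nat_le_iff mem_Collect_eq)
    qed
  qed auto
  also have "\<dots> \<le> real J * (4 / ln a)"
  proof (rule sum_primes_blocks)
    fix j
    have n2: "real n \<le> real (n * 2 ^ j)" by (subst of_nat_le_iff) simp
    have "(\<Sum>p | prime p \<and> n * 2 ^ j < p \<and> p \<le> 2 * (n * 2 ^ j). 1 / real p) \<le> 2 / ln (real (n * 2 ^ j))"
      using n n2 by (intro sum_inverse_primes_block) linarith
    also have "\<dots> \<le> 2 / ln (real n)"
    proof (rule divide_left_mono)
      have "ln (real n) > 0" using n by simp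
      moreover show "ln (real n) \<le> ln (real (n * 2 ^ j))" using n n2 by (subst ln_le_cancel_iff) linarith+
      ultimately show "0 < ln (real (n * 2 ^ j)) * ln (real n)" by simp
    qed simp
    also have "\<dots> \<le> 4 / ln a" using sqrt lna n by (simp add: field_simps)
    finally show "(\<Sum>p | prime p \<and> n * 2 ^ j < p \<and> p \<le> 2 * (n * 2 ^ j). 1 / real p) \<le> 4 / ln a" .
  qed
  also have "\<dots> \<le> (3 * (ln (b / a) + 1)) * (4 / ln a)"
  proof (rule mult_right_mono)
    have "b / n \<le> b / (a / 2)" using half assms by (intro divide_left_mono) auto
    hence "ln (b / n) \<le> ln (2 * (b / a))" using assms n by (subst ln_le_cancel_iff) (auto simp: field_simps)
    also have "\<dots> = ln 2 + ln (b / a)" using assms by (subst ln_mult) auto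
    finally have "ln (b / n) / ln 2 \<le> (ln 2 + ln (b / a)) / ln 2" by (intro divide_right_mono) auto
    also have "\<dots> = 1 + (1 / ln 2) * ln (b / a)" by (simp add: field_simps)
    also have "\<dots> \<le> 1 + 3 / 2 * ln (b / a)"
      using assms by (intro add_left_mono mult_right_mono inverse_ln_2_le) auto
    finally have "ln (b / n) / ln 2 \<le> 1 + 3 / 2 * ln (b / a)" .
    moreover have "ln (b / a) \<ge> 0" using assms by auto
    ultimately show "real J \<le> 3 * (ln (b / a) + 1)" using J(2) by auto
  qed (use lna in auto)
  finally show ?thesis by (simp add: field_simps)
qed

lemma sum_log_primes_le:
  fixes b :: real
  assumes "1 \<le> b"
  shows "(\<Sum>p\<in>primes_upto b. ln (real p) / real p) \<le> 3 * ln b + 2"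
proof -
  obtain J where J: "b \<le> real (1 * 2 ^ J)" "real J \<le> max 0 (ln (b / real 1) / ln 2) + 1"
    using ex_dyadic_exponent[of 1 b] assms by auto
  have "(\<Sum>p\<in>primes_upto b. ln (real p) / real p)
      \<le> (\<Sum>p | prime p \<and> 1 < p \<and> p \<le> 1 * 2 ^ J. ln (real p) / real p)"
  proof (rule sum_mono2)
    show "finite {p::nat. prime p \<and> 1 < p \<and> p \<le> 1 * 2 ^ J}"
      by (rule finite_subset[of _ "{..2 ^ J}"]) auto
    show "primes_upto b \<subseteq> {p. prime p \<and> 1 < p \<and> p \<le> 1 * 2 ^ J}"
    proof
      fix p assume "p \<in> primes_upto b"
      hence p: "prime p" "real p \<le> b" unfolding primes_upto_def by auto
      have "real p \<le> real (1 * 2 ^ J)" using p J by linarith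
      hence "p \<le> 1 * 2 ^ J" by (simp only: of_nat_le_iff)
      thus "p \<in> {p. prime p \<and> 1 < p \<and> p \<le> 1 * 2 ^ J}" using p prime_gt_1_nat by auto
    qed
    fix p :: nat assume "p \<in> {p. prime p \<and> 1 < p \<and> p \<le> 1 * 2 ^ J} - primes_upto b"
    thus "0 \<le> ln (real p) / real p" by (intro divide_nonneg_nonneg ln_ge_zero) auto
  qed
  also have "\<dots> \<le> real J * 2"
    by (rule sum_primes_blocks) (rule sum_log_primes_block, simp)
  also have "\<dots> \<le> (3 / 2 * ln b + 1) * 2"
  proof (rule mult_right_mono)
    have "ln b / ln 2 \<le> 3 / 2 * ln b"
      using mult_right_mono[OF inverse_ln_2_le, of "ln b"] assms by simp
    moreover have "0 \<le> ln b / ln 2" using assms by simp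
    ultimately show "real J \<le> 3 / 2 * ln b + 1" using J(2) by (simp only: of_nat_1 div_by_1 max_absorb2)
  qed auto
  finally show ?thesis by (simp add: algebra_simps)
qed

section \<open>Mertens' estimates and Euler products near exponent 1\<close>

lemma sum_powr_le:
  fixes d :: real
  assumes "d > 0"
  shows "(\<Sum>n=1..N. real n powr -(1 + d)) \<le> 1 + 1 / d"
proof (cases "N = 0")
  case False
  hence "N \<ge> 1" by simp
  hence "(\<Sum>n=1..N. real n powr -(1 + d)) \<le> 1 + (1 - real N powr -d) / d"
  proof (induction N rule: dec_induct)
    case (step N)
    have N: "real N \<ge> 1" using step by simp
    define u where "u = real (Suc N) powr -d"
    \<comment> \<open>This inequality lets the differences of \<open>real N powr -d / d\<close>
      dominate the terms, a discrete version of comparing with the integral.\<close>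
    have "1 / real (Suc N) \<le> - ln (1 - 1 / real (Suc N))"
      using ln_le_minus_one[of "1 - 1 / real (Suc N)"] N by (simp add: field_simps)
    also have "\<dots> = ln (real (Suc N)) - ln (real N)"
    proof -
      have "1 - 1 / real (Suc N) = real N / real (Suc N)" by (simp add: field_simps)
      thus ?thesis using N by (simp only: ln_div) (simp add: ln_div)
    qed
    finally have l: "1 / real (Suc N) \<le> ln (real (Suc N)) - ln (real N)" .
    have "u * (1 + d / real (Suc N)) \<le> u * (1 + d * (ln (real (Suc N)) - ln (real N)))"
      using mult_left_mono[OF l, of d] assms unfolding u_def by (intro mult_left_mono) auto
    also have "\<dots> \<le> u * exp (d * (ln (real (Suc N)) - ln (real N)))"
      unfolding u_def by (intro mult_left_mono exp_ge_add_one_self) auto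
    also have "\<dots> = real N powr -d"
      unfolding u_def using N by (simp add: powr_def algebra_simps flip: exp_add)
    finally have "u * d / real (Suc N) \<le> real N powr -d - u" by (simp add: algebra_simps)
    hence "u / real (Suc N) \<le> (real N powr -d - u) / d"
      using assms by (simp add: field_simps)
    moreover have "real (Suc N) powr -(1 + d) = u / real (Suc N)"
    proof -
      have e: "-(1 + d) = -d - 1" by simp
      show ?thesis unfolding u_def e using powr_diff[of "real (Suc N)" "-d" 1] by simp
    qed
    ultimately have "real (Suc N) powr -(1 + d) \<le> (real N powr -d - u) / d" by simp
    thus ?case using step.IH step.hyps unfolding u_def by (simp add: diff_divide_distrib)
  qed simp
  also have "\<dots> \<le> 1 + 1 / d" using assms by (simp add: divide_simps)
  finally show ?thesis .
qed (use assms in auto)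

lemma sum_powr_le_subset:
  fixes d :: real and A :: "nat set"
  assumes "d > 0" "finite A" "0 \<notin> A"
  shows "(\<Sum>n\<in>A. real n powr -(1 + d)) \<le> 1 + 1 / d"
proof -
  have "(\<Sum>n\<in>A. real n powr -(1 + d)) \<le> (\<Sum>n=1..Max (insert 0 A). real n powr -(1 + d))"
  proof (rule sum_mono2)
    show "A \<subseteq> {1..Max (insert 0 A)}"
    proof
      fix n assume n: "n \<in> A"
      have "n \<le> Max (insert 0 A)" using assms n by (intro Max_ge) auto
      moreover have "n \<noteq> 0" using n assms by metis
      ultimately show "n \<in> {1..Max (insert 0 A)}" by simp
    qed
  qed auto
  also have "\<dots> \<le> 1 + 1 / d" by (rule sum_powr_le[OF assms(1)])
  finally show ?thesis .
qed

lemma inj_on_prod_primes: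
  fixes P :: "nat set"
  assumes "finite P" "\<And>p. p \<in> P \<Longrightarrow> prime p"
  shows "inj_on Prod (Pow P)"
proof (rule inj_onI)
  have *: "X = {p. prime p \<and> p dvd \<Prod>X}" if "X \<in> Pow P" for X
  proof -
    have X: "finite X" "\<And>p. p \<in> X \<Longrightarrow> prime p"
      using that assms finite_subset by auto
    show ?thesis
    proof (intro equalityI subsetI)
      fix p assume "p \<in> X"
      thus "p \<in> {p. prime p \<and> p dvd \<Prod>X}" using X dvd_prodI[OF X(1), of p "\<lambda>x. x"] by auto
    next
      fix p assume "p \<in> {p. prime p \<and> p dvd \<Prod>X}"
      then obtain q where q: "prime p" "q \<in> X" "p dvd q"
        using prime_dvd_prod_iff[OF X(1), of p "\<lambda>x. x"] by auto
      thus "p \<in> X" using X(2) primes_dvd_imp_eq by blast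
    qed
  qed
  fix X Y assume "X \<in> Pow P" "Y \<in> Pow P" "\<Prod>X = \<Prod>Y"
  thus "X = Y" using *[of X] *[of Y] by simp
qed

text \<open>Expanding the product gives one term for each squarefree integer composed of primes in
  \<open>P\<close>, without repetition by \<open>inj_on_prod_primes\<close>; these form part of the
  series with exponent \<open>1 + d\<close>.\<close>

lemma euler_product_lower:
  fixes P :: "nat set" and d :: real
  assumes "finite P" "\<And>p. p \<in> P \<Longrightarrow> prime p" "d > 0"
  shows "(\<Prod>p\<in>P. 1 + real p powr -(1 + d)) \<le> 1 + 1 / d"
proof -
  have "(\<Prod>p\<in>P. 1 + real p powr -(1 + d)) = (\<Prod>p\<in>P. real p powr -(1 + d) + 1)"
    by (simp add: add.commute)
  also have "\<dots> = (\<Sum>X\<in>Pow P. \<Prod>p\<in>X. real p powr -(1 + d))"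
    by (subst prod_add[OF assms(1)]) simp
  also have "\<dots> = (\<Sum>X\<in>Pow P. real (\<Prod>X) powr -(1 + d))"
    by (intro sum.cong refl) (simp add: prod_powr_distrib)
  also have "\<dots> = (\<Sum>n\<in>Prod ` Pow P. real n powr -(1 + d))"
    by (subst sum.reindex[OF inj_on_prod_primes]) (use assms in auto)
  also have "\<dots> \<le> 1 + 1 / d"
  proof (rule sum_powr_le_subset[OF assms(3)])
    show "0 \<notin> Prod ` Pow P"
    proof
      assume "0 \<in> Prod ` Pow P"
      then obtain X where X: "X \<subseteq> P" "\<Prod>X = 0" by auto
      hence "0 \<in> X" using assms(1) finite_subset[OF X(1)] by (simp add: prod_zero_iff)
      hence "prime (0::nat)" using X assms(2) by blast
      thus False by simp
    qed
  qed (use assms in auto)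
  finally show ?thesis .
qed

lemma sum_powr_primes_three_halves:
  "(\<Sum>p\<in>primes_upto y. real p powr -(3/2)) \<le> 3"
proof -
  have "0 \<notin> primes_upto y" unfolding primes_upto_def by simp
  thus ?thesis using sum_powr_le_subset[of "1/2" "primes_upto y"] by simp
qed

text \<open>Comparing with the exponent \<open>1 + 1 / ln y\<close>, where the Euler product is at most
  \<open>1 + ln y\<close>, costs only a bounded amount by Chebyshev and yields the leading constant 1.\<close>

lemma mertens_upper:
  fixes y :: real
  assumes "exp 1 \<le> y"
  shows "(\<Sum>p\<in>primes_upto y. 1 / real p) \<le> ln (ln y) + 10"
proof -
  let ?P = "primes_upto y"
  have y: "y > 0" "ln y \<ge> 1"
  proof -
    show "y > 0" using assms by (rule less_le_trans[OF exp_gt_zero])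
    hence "ln (exp 1) \<le> ln y" using assms by (subst ln_le_cancel_iff) auto
    thus "ln y \<ge> 1" by simp
  qed
  define d where "d = 1 / ln y"
  have d: "d > 0" unfolding d_def using y(2) by (intro divide_pos_pos) linarith+
  have p: "real p \<ge> 2" if "p \<in> ?P" for p
    using that prime_ge_2_nat unfolding primes_upto_def by force
  have 1: "(\<Sum>p\<in>?P. real p powr -(1 + d)) \<le> ln (ln y) + 4"
  proof -
    \<comment> \<open>The second order terms in \<open>ln (1 + t) \<ge> t - t ^ 2\<close> cost at
      most 3 in total, by \<open>sum_powr_primes_three_halves\<close>. Together with
      \<open>ln 2 \<le> 1\<close>, from \<open>1 + ln y \<le> 2 * ln y\<close>, this makes the
      constant 4.\<close>
    have "(\<Sum>p\<in>?P. real p powr -(1 + d) - real p powr -(3/2)) \<le> (\<Sum>p\<in>?P. ln (1 + real p powr -(1 + d)))"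
    proof (rule sum_mono)
      fix q assume q: "q \<in> ?P"
      define t where "t = real q powr -(1 + d)"
      have t: "0 \<le> t" "t \<le> 1"
        using p[OF q] d powr_mono[of "-(1 + d)" 0 "real q"] unfolding t_def by auto
      have "t - t\<^sup>2 \<le> ln (1 + t)" using ln_one_plus_pos_lower_bound t by blast
      moreover have "t\<^sup>2 \<le> real q powr -(3/2)"
      proof -
        have "t\<^sup>2 = real q powr (-2 * (1 + d))"
          unfolding t_def using p[OF q] by (subst powr_power) (auto simp: algebra_simps)
        also have "\<dots> \<le> real q powr -(3/2)" using p[OF q] d by (intro powr_mono) auto
        finally show ?thesis .
      qed
      ultimately show "real q powr -(1 + d) - real q powr -(3/2) \<le> ln (1 + real q powr -(1 + d))"
        unfolding t_def by linarith
    qed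
    also have "\<dots> = ln (\<Prod>p\<in>?P. 1 + real p powr -(1 + d))"
    proof (subst ln_prod)
      fix i :: nat
      have "1 + real i powr -(1 + d) > 0" by (rule add_pos_nonneg) auto
      thus "1 + real i powr -(1 + d) \<noteq> 0" by linarith
    qed auto
    also have "\<dots> \<le> ln (1 + ln y)"
    proof (subst ln_le_cancel_iff)
      show "(\<Prod>p\<in>?P. 1 + real p powr -(1 + d)) \<le> 1 + ln y"
      proof -
        have "\<And>p. p \<in> ?P \<Longrightarrow> prime p" unfolding primes_upto_def by simp
        from euler_product_lower[OF finite_primes_upto this d]
        have "(\<Prod>p\<in>?P. 1 + real p powr -(1 + d)) \<le> 1 + 1 / d" by blast
        thus ?thesis by (simp add: d_def)
      qed
      show "(\<Prod>p\<in>?P. 1 + real p powr -(1 + d)) > 0"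
        by (intro prod_pos ballI add_pos_nonneg) simp_all
    qed (use y in linarith)
    also have "\<dots> \<le> ln (2 * ln y)" using y(2) by (subst ln_le_cancel_iff) linarith+
    also have "\<dots> = ln 2 + ln (ln y)" using y(2) by (subst ln_mult) auto
    finally show ?thesis using sum_powr_primes_three_halves[of y] ln2_le_25_over_36
      by (simp add: sum_subtractf)
  qed
  have "(\<Sum>p\<in>?P. 1 / real p) \<le> (\<Sum>p\<in>?P. real p powr -(1 + d) + d * (ln (real p) / real p))"
  proof (rule sum_mono)
    fix q assume q: "q \<in> ?P"
    have "real q powr -(1 + d) = (1 / real q) * exp (- (d * ln (real q)))"
    proof -
      have "real q powr -(1 + d) = exp (- ln (real q)) * exp (- (d * ln (real q)))"
        using p[OF q] unfolding powr_def exp_add[symmetric] by (simp add: algebra_simps)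
      thus ?thesis using p[OF q] by (simp add: exp_minus inverse_eq_divide)
    qed
    moreover have "1 - d * ln (real q) \<le> exp (- (d * ln (real q)))"
      using exp_ge_add_one_self[of "- (d * ln (real q))"] by simp
    hence "(1 / real q) * (1 - d * ln (real q)) \<le> (1 / real q) * exp (- (d * ln (real q)))"
      by (rule mult_left_mono) simp
    ultimately show "1 / real q \<le> real q powr -(1 + d) + d * (ln (real q) / real q)"
      by (simp add: algebra_simps)
  qed
  also have "\<dots> = (\<Sum>p\<in>?P. real p powr -(1 + d)) + d * (\<Sum>p\<in>?P. ln (real p) / real p)"
    by (simp add: sum.distrib sum_distrib_left)
  also have "\<dots> \<le> (ln (ln y) + 4) + d * (3 * ln y + 2)"
    using 1 d y(2) ln_ge_zero_iff[OF y(1)] by (intro add_mono mult_left_mono sum_log_primes_le) linarith+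
  also have "d * (3 * ln y + 2) \<le> 5"
  proof -
    have "1 / L * (3 * L + 2) \<le> 5" if "L \<ge> 1" for L :: real using that by (simp add: field_simps)
    thus ?thesis unfolding d_def using y(2) .
  qed
  finally show ?thesis by simp
qed

lemma neg_ln_one_minus_le:
  fixes t :: real
  assumes "0 \<le> t" "t \<le> 3/4"
  shows "- ln (1 - t) \<le> t + 4 * t\<^sup>2"
proof -
  have "- ln (1 - t) = ln (1 / (1 - t))" using assms by (simp add: ln_div)
  also have "\<dots> \<le> 1 / (1 - t) - 1" using assms by (intro ln_le_minus_one) auto
  also have "\<dots> = t + t\<^sup>2 / (1 - t)" using assms by (simp add: field_simps power2_eq_square)
  also have "t\<^sup>2 / (1 - t) \<le> t\<^sup>2 / (1/4)" using assms by (intro divide_left_mono) auto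
  finally show ?thesis by simp
qed

text \<open>The extreme case is \<open>p = 2\<close>, \<open>\<eta> = 1/4\<close>, where the fourth
  power is \<open>1/8\<close>. A bound away from 1 keeps \<open>1 / (1 - t)\<close> at most 4 in
  every Euler factor, including the one at 2.\<close>

lemma prime_powr_le_three_quarters:
  fixes \<eta> :: real
  assumes "prime p" "\<eta> \<le> 1/4"
  shows "real p powr -(1 - \<eta>) \<le> 3/4"
proof -
  have p2: "real p \<ge> 2" using assms(1) prime_ge_2_nat by force
  have "real p powr -(1 - \<eta>) \<le> real p powr -(3/4)" using p2 assms by (intro powr_mono) auto
  also have "\<dots> \<le> 2 powr -(3/4)" using p2 by (intro powr_mono2') auto
  also have "\<dots> \<le> 3/4"
  proof (rule power_le_imp_le_base[of _ 3])
    have "(2 powr -(3/4)) ^ Suc 3 = (2 powr (-3) :: real)"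
      by (subst powr_power) auto
    also have "\<dots> = 1/8" by (simp add: powr_minus)
    finally have "(2 powr -(3/4)) ^ Suc 3 = (1/8::real)" .
    thus "(2 powr -(3/4)) ^ Suc 3 \<le> (3/4::real) ^ Suc 3" by (simp add: power_divide)
  qed simp
  finally show ?thesis .
qed

text \<open>The logarithm of a factor is its first order term plus at most \<open>4 * t ^ 2\<close>.
  Since \<open>\<eta> \<le> 1/4\<close>, \<open>t ^ 2\<close> is dominated by
  \<open>p powr -(3/2)\<close>, whose sum over primes is at most 3; hence the constant 12.\<close>

lemma euler_product_le_exp:
  fixes y \<eta> :: real
  assumes "0 \<le> \<eta>" "\<eta> \<le> 1/4"
  shows "(\<Prod>p\<in>primes_upto y. 1 / (1 - real p powr -(1 - \<eta>)))
         \<le> exp ((\<Sum>p\<in>primes_upto y. real p powr -(1 - \<eta>)) + 12)"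
proof -
  let ?P = "primes_upto y"
  have 1: "1 / (1 - real p powr -(1 - \<eta>)) \<le> exp (real p powr -(1 - \<eta>) + 4 * real p powr -(3/2))"
    and 2: "1 / (1 - real p powr -(1 - \<eta>)) \<ge> 0" if p: "p \<in> ?P" for p
  proof -
    define t where "t = real p powr -(1 - \<eta>)"
    have p2: "real p \<ge> 2" using p prime_ge_2_nat unfolding primes_upto_def by force
    have "t \<le> 3/4"
      unfolding t_def using p assms by (intro prime_powr_le_three_quarters) (auto simp: primes_upto_def)
    hence t: "0 \<le> t" "t \<le> 3/4" unfolding t_def by auto
    have "t\<^sup>2 = real p powr (-2 * (1 - \<eta>))"
      unfolding t_def using p2 by (subst powr_power) (auto simp: algebra_simps)
    also have "\<dots> \<le> real p powr -(3/2)" using p2 assms by (intro powr_mono) auto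
    finally have "- ln (1 - t) \<le> t + 4 * real p powr -(3/2)"
      using neg_ln_one_minus_le[OF t] by linarith
    hence "exp (- ln (1 - t)) \<le> exp (t + 4 * real p powr -(3/2))" by simp
    thus "1 / (1 - real p powr -(1 - \<eta>)) \<le> exp (real p powr -(1 - \<eta>) + 4 * real p powr -(3/2))"
      using t unfolding t_def[symmetric] by (simp add: exp_minus field_simps)
    show "1 / (1 - real p powr -(1 - \<eta>)) \<ge> 0" using t unfolding t_def[symmetric] by simp
  qed
  have "(\<Prod>p\<in>?P. 1 / (1 - real p powr -(1 - \<eta>)))
      \<le> (\<Prod>p\<in>?P. exp (real p powr -(1 - \<eta>) + 4 * real p powr -(3/2)))"
    using 1 2 by (intro prod_mono) auto
  also have "\<dots> = exp ((\<Sum>p\<in>?P. real p powr -(1 - \<eta>)) + 4 * (\<Sum>p\<in>?P. real p powr -(3/2)))"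
    by (simp add: exp_sum sum.distrib[symmetric] sum_distrib_left)
  also have "\<dots> \<le> exp ((\<Sum>p\<in>?P. real p powr -(1 - \<eta>)) + 12)"
    using sum_powr_primes_three_halves[of y] by simp
  finally show ?thesis .
qed

text \<open>Every \<open>n \<le> z\<close> has all its prime factors in
  \<open>primes_upto z\<close>, so the harmonic sum, which is at least \<open>ln z\<close>, is
  bounded by the Euler product at exponent 1, the case \<open>\<eta> = 0\<close>.\<close>

lemma mertens_lower:
  fixes z :: real
  assumes "1 < z"
  shows "ln (ln z) - 12 \<le> (\<Sum>p\<in>primes_upto z. 1 / real p)"
proof -
  have "ln z \<le> ln (real (nat \<lfloor>z\<rfloor>) + 1)" using assms by (subst ln_le_cancel_iff) linarith+
  also have "\<dots> \<le> harm (nat \<lfloor>z\<rfloor>)" by (rule ln_le_harm)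
  also have "\<dots> = (\<Sum>n\<in>{1..nat \<lfloor>z\<rfloor>}. real n powr -(1 - 0))"
    unfolding harm_def by (intro sum.cong) (auto simp: powr_minus)
  also have "\<dots> \<le> (\<Prod>p\<in>primes_upto z. 1 / (1 - real p powr -(1 - 0)))"
  proof (rule euler_product_upper)
    fix n p assume n: "n \<in> {1..nat \<lfloor>z\<rfloor>}" and p: "prime p" "p dvd n"
    have "p \<le> n" using p n by (intro dvd_imp_le) auto
    moreover have "real n \<le> z" using n assms by (simp add: le_nat_iff le_floor_iff)
    ultimately show "p \<in> primes_upto z" using p unfolding primes_upto_def by auto
  qed (use finite_primes_upto in \<open>auto simp: primes_upto_def\<close>)
  also have "\<dots> \<le> exp ((\<Sum>p\<in>primes_upto z. real p powr -(1 - 0)) + 12)"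
    by (rule euler_product_le_exp) auto
  also have "(\<Sum>p\<in>primes_upto z. real p powr -(1 - 0)) = (\<Sum>p\<in>primes_upto z. 1 / real p)"
    by (intro sum.cong) (auto simp: powr_minus field_simps)
  finally have "ln (ln z) \<le> ln (exp ((\<Sum>p\<in>primes_upto z. 1 / real p) + 12))"
    using assms by (subst ln_le_cancel_iff) auto
  thus ?thesis by simp
qed

lemma exp_minus_one_le: "exp t - 1 \<le> t * exp (t::real)"
  using exp_ge_add_one_self[of "-t"] by (simp add: exp_minus field_simps)

text \<open>The primes are split at \<open>a = y powr (1 - \<tau>)\<close>. Below \<open>a\<close>,
  \<open>p powr \<eta>\<close> is at most \<open>exp (w - w * \<tau>)\<close>, and Chebyshev handles
  the factor \<open>\<eta> * ln p\<close> left by \<open>exp_minus_one_le\<close>. Above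
  \<open>a\<close>, the bound \<open>exp w\<close> is affordable because the reciprocals of the
  primes there have a small sum. With \<open>\<tau> = 1 / sqrt w\<close> and large \<open>w\<close>
  and \<open>y\<close>, both parts are \<open>o(exp w)\<close>; the trivial bound of order
  \<open>w * exp w\<close> would be too large later.\<close>

lemma sum_primes_powr_diff:
  fixes y \<eta> w \<tau> :: real
  assumes "y > 0" "ln y \<ge> 4" "w > 0" "\<eta> = w / ln y" "0 \<le> \<tau>" "\<tau> \<le> 1/2"
  shows "(\<Sum>p\<in>primes_upto y. real p powr -(1 - \<eta>) - 1 / real p)
         \<le> 5 * w * exp (w - w * \<tau>) + 24 * exp w * (\<tau> + 1 / ln y)"
proof -
  define Y where "Y = ln y"
  have Y: "Y \<ge> 4" using assms unfolding Y_def by simp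
  have y: "y = exp Y" using assms unfolding Y_def by simp
  define a where "a = exp ((1 - \<tau>) * Y)"
  \<comment> \<open>From \<open>\<tau> \<le> 1/2\<close> and \<open>ln y \<ge> 4\<close> one gets
    \<open>ln a \<ge> 2\<close>, which puts \<open>a\<close> in the range of
    \<open>sum_inverse_primes_Ioc\<close>.\<close>
  have ab: "4 \<le> a" "a \<le> y"
  proof -
    have "2 * 1 \<le> (1 - \<tau>) * Y"
    proof -
      have "(1/2) * 4 \<le> (1 - \<tau>) * Y" using assms Y by (intro mult_mono) auto
      thus ?thesis by simp
    qed
    hence "exp 2 \<le> a" unfolding a_def by simp
    moreover have "exp (2::real) = exp 1 * exp 1" by (simp flip: exp_add)
    moreover have "exp 1 * exp 1 \<ge> 2 * (2::real)" using exp_ge_add_one_self[of 1] by (intro mult_mono) auto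
    ultimately show "4 \<le> a" by simp
    show "a \<le> y" unfolding a_def y using assms Y by (simp add: algebra_simps)
  qed
  let ?f = "\<lambda>p. real p powr -(1 - \<eta>) - 1 / real p"
  have \<eta>: "\<eta> > 0" "\<eta> * Y = w" using assms Y unfolding Y_def[symmetric] by auto
  have f: "?f p = (exp (\<eta> * ln (real p)) - 1) / real p" if "prime p" for p
  proof -
    have "real p powr -(1 - \<eta>) = exp (\<eta> * ln (real p)) * exp (- ln (real p))"
      using prime_gt_0_nat[OF that] by (simp add: powr_def algebra_simps flip: exp_add)
    thus ?thesis using prime_gt_0_nat[OF that] by (simp add: exp_minus field_simps)
  qed
  have fnn: "?f p \<ge> 0" if "prime p" for p
    unfolding f[OF that] using \<eta> prime_gt_0_nat[OF that] prime_ge_1_nat[OF that] by auto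
  let ?B = "{p. prime p \<and> a < real p \<and> real p \<le> y}"
  have union: "primes_upto y = primes_upto a \<union> ?B" using ab unfolding primes_upto_def by auto
  have finB: "finite ?B" using union by (metis finite_Un finite_primes_upto)
  have "(\<Sum>p\<in>primes_upto y. ?f p) = (\<Sum>p\<in>primes_upto a. ?f p) + (\<Sum>p\<in>?B. ?f p)"
    unfolding union using finB
    by (intro sum.union_disjoint finite_primes_upto) (auto simp: primes_upto_def)
  also have "\<dots> \<le> (\<Sum>p\<in>primes_upto a. \<eta> * exp (w - w * \<tau>) * (ln (real p) / real p)) + (\<Sum>p\<in>?B. exp w * (1 / real p))"
  proof (intro add_mono sum_mono)
    fix p assume "p \<in> primes_upto a"
    hence p: "prime p" "real p \<le> a" unfolding primes_upto_def by auto
    have p1: "real p \<ge> 1" using p prime_ge_1_nat by force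
    have "ln (real p) \<le> ln a" using p p1 by (subst ln_le_cancel_iff) linarith+
    also have "\<dots> = (1 - \<tau>) * Y" unfolding a_def by simp
    finally have "\<eta> * ln (real p) \<le> \<eta> * ((1 - \<tau>) * Y)" using \<eta> by (intro mult_left_mono) auto
    also have "\<dots> = w - w * \<tau>" using \<eta>(2) by (simp add: algebra_simps)
    finally have le: "\<eta> * ln (real p) \<le> w - w * \<tau>" .
    have "exp (\<eta> * ln (real p)) - 1 \<le> (\<eta> * ln (real p)) * exp (\<eta> * ln (real p))"
      by (rule exp_minus_one_le)
    also have "\<dots> \<le> (\<eta> * ln (real p)) * exp (w - w * \<tau>)"
      using le \<eta> p1 by (intro mult_left_mono) auto
    finally have "?f p \<le> (\<eta> * ln (real p)) * exp (w - w * \<tau>) / real p"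
      unfolding f[OF p(1)] using p1 by (intro divide_right_mono) auto
    thus "?f p \<le> \<eta> * exp (w - w * \<tau>) * (ln (real p) / real p)" by (simp add: mult_ac)
  next
    fix p assume "p \<in> ?B"
    hence p: "prime p" "a < real p" "real p \<le> y" by auto
    have p1: "real p \<ge> 1" using p prime_ge_1_nat by force
    have "ln (real p) \<le> Y" unfolding Y_def using p p1 by (subst ln_le_cancel_iff) linarith+
    hence "\<eta> * ln (real p) \<le> w" using \<eta> mult_left_mono[of "ln (real p)" Y \<eta>] by simp
    hence "exp (\<eta> * ln (real p)) - 1 \<le> exp w" by (smt (verit) exp_le_cancel_iff)
    thus "?f p \<le> exp w * (1 / real p)"
      unfolding f[OF p(1)] using p1 by (simp add: divide_right_mono)
  qed
  also have "\<dots> = \<eta> * exp (w - w * \<tau>) * (\<Sum>p\<in>primes_upto a. ln (real p) / real p) + exp w * (\<Sum>p\<in>?B. 1 / real p)"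
    by (simp add: sum_distrib_left)
  also have "\<dots> \<le> \<eta> * exp (w - w * \<tau>) * (5 * Y) + exp w * (24 * (\<tau> + 1 / Y))"
  proof (intro add_mono mult_left_mono)
    have "(\<Sum>p\<in>primes_upto a. ln (real p) / real p) \<le> 3 * ln a + 2"
      using ab by (intro sum_log_primes_le) auto
    also have "ln a \<le> Y" unfolding a_def using assms Y by (simp add: algebra_simps)
    finally show "(\<Sum>p\<in>primes_upto a. ln (real p) / real p) \<le> 5 * Y" using Y by linarith
    have "(\<Sum>p\<in>?B. 1 / real p) \<le> 12 * (ln (y / a) + 1) / ln a"
      using ab by (rule sum_inverse_primes_Ioc)
    also have "ln (y / a) = \<tau> * Y" unfolding y a_def by (simp add: ln_div algebra_simps)
    also have "12 * (\<tau> * Y + 1) / ln a \<le> 12 * (\<tau> * Y + 1) / (Y / 2)"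
    proof (rule divide_left_mono)
      have "ln a = (1 - \<tau>) * Y" unfolding a_def by simp
      moreover have "(1/2) * Y \<le> (1 - \<tau>) * Y" using assms Y by (intro mult_right_mono) auto
      ultimately show "Y / 2 \<le> ln a" by simp
      thus "0 < ln a * (Y / 2)" using Y by simp
    qed (use assms Y in auto)
    also have "\<dots> = 24 * (\<tau> + 1 / Y)" using Y by (simp add: field_simps)
    finally show "(\<Sum>p\<in>?B. 1 / real p) \<le> 24 * (\<tau> + 1 / Y)" .
  qed (use \<eta> in auto)
  also have "\<eta> * exp (w - w * \<tau>) * (5 * Y) = 5 * (\<eta> * Y) * exp (w - w * \<tau>)" by (simp only: mult_ac)
  finally show ?thesis unfolding \<eta>(2) unfolding Y_def by (simp add: mult_ac)
qed

subsection \<open>Brun's pure sieve\<close>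

lemma ex_residue_in_window:
  fixes a r M :: nat
  assumes "M > 0"
  obtains k where "k \<in> {a..<a + M}" "[k = r] (mod M)"
proof
  define k where "k = a + (r + (M - 1) * a) mod M"
  show "k \<in> {a..<a + M}" unfolding k_def using assms by simp
  have "[k = a + (r + (M - 1) * a)] (mod M)"
    unfolding k_def by (intro cong_add cong_refl cong_mod_leftI cong_refl)
  also have "a + (r + (M - 1) * a) = r + M * a" using assms by (cases M) auto
  also have "[r + M * a = r] (mod M)" unfolding unique_euclidean_semiring_class.cong_def by (rule mod_mult_self2)
  finally show "[k = r] (mod M)" .
qed

lemma residue_window_unique:
  fixes a r M :: nat
  assumes "k \<in> {a..<a + M}" "l \<in> {a..<a + M}" "[k = l] (mod M)"
  shows "k = l"
proof -
  have *: "k = l" if "k \<le> l" "k \<in> {a..<a + M}" "l \<in> {a..<a + M}" "[k = l] (mod M)" for k l :: nat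
  proof -
    have "[l = k] (mod M)" using that(4) by (rule cong_sym)
    hence "M dvd l - k" using that(1) by (simp add: cong_altdef_nat)
    moreover have "l - k < M" using that by auto
    ultimately have "l - k = 0" by (metis dvd_imp_le gr0I leD)
    thus ?thesis using that by simp
  qed
  show ?thesis
    using *[of k l] *[of l k] assms cong_sym by (metis nat_le_linear)
qed

lemma card_residue_interval:
  fixes a r M K :: nat
  assumes "M > 0"
  shows "\<bar>real (card {k \<in> {a..<a + K}. [k = r] (mod M)}) - real K / real M\<bar> \<le> 1"
proof (induction K arbitrary: a rule: less_induct)
  case (less K)
  show ?case
  proof (cases "K < M")
    case True
    have c1: "card {k \<in> {a..<a + K}. [k = r] (mod M)} \<le> 1"
    proof (rule card_le_Suc0_iff_eq[THEN iffD2, folded One_nat_def])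
      show "\<forall>x\<in>{k \<in> {a..<a + K}. [k = r] (mod M)}. \<forall>y\<in>{k \<in> {a..<a + K}. [k = r] (mod M)}. x = y"
      proof (intro ballI)
        fix x y assume xy: "x \<in> {k \<in> {a..<a + K}. [k = r] (mod M)}" "y \<in> {k \<in> {a..<a + K}. [k = r] (mod M)}"
        have "[x = y] (mod M)" using xy by (auto intro: cong_trans cong_sym)
        thus "x = y" using xy True by (intro residue_window_unique[of x a M y]) auto
      qed
    qed auto
    moreover have "real K / real M \<le> 1" using True assms by simp
    moreover have "real K / real M \<ge> 0" by simp
    moreover have "\<bar>u - v\<bar> \<le> 1" if "0 \<le> u" "u \<le> 1" "0 \<le> v" "v \<le> 1" for u v :: real
      using that by linarith
    ultimately show ?thesis using c1 by (simp only: of_nat_le_1_iff of_nat_0_le_iff)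
  next
    case False
    let ?A = "{k \<in> {a..<a + M}. [k = r] (mod M)}"
    let ?B = "{k \<in> {a + M..<a + M + (K - M)}. [k = r] (mod M)}"
    obtain k where k: "k \<in> {a..<a + M}" "[k = r] (mod M)" using ex_residue_in_window[OF assms] .
    have "?A = {k}"
    proof (intro equalityI subsetI)
      fix l assume l: "l \<in> ?A"
      hence "[l = k] (mod M)" using k cong_sym cong_trans by blast
      hence "l = k" using l k by (intro residue_window_unique[of l a M k]) auto
      thus "l \<in> {k}" by simp
    qed (use k in auto)
    hence A: "card ?A = 1" by simp
    have "{k \<in> {a..<a + K}. [k = r] (mod M)} = ?A \<union> ?B" using False by auto
    moreover have "?A \<inter> ?B = {}" by auto
    ultimately have "card {k \<in> {a..<a + K}. [k = r] (mod M)} = 1 + card ?B"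
      using A by (simp add: card_Un_disjoint)
    moreover have "\<bar>real (card ?B) - real (K - M) / real M\<bar> \<le> 1"
      using False assms by (intro less.IH) auto
    moreover have "real (K - M) / real M = real K / real M - 1"
      using False assms by (simp add: of_nat_diff field_simps)
    ultimately show ?thesis by simp
  qed
qed

text \<open>Induction over \<open>T\<close> with arbitrary modulus: the Chinese remainder theorem
  absorbs each prime, with one of its two residues, into \<open>M\<close> and \<open>r\<close>. This
  ends in \<open>2 ^ card T\<close> progressions, each counted with an error of at most 1.\<close>

lemma card_sieve_residues:
  fixes T :: "nat set" and R :: "nat \<Rightarrow> nat set" and a K M r :: nat
  assumes "finite T" "\<And>p. p \<in> T \<Longrightarrow> prime p" "\<And>p. p \<in> T \<Longrightarrow> R p \<subseteq> {..<p} \<and> card (R p) = 2"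
    and "M > 0" "\<And>p. p \<in> T \<Longrightarrow> coprime M p"
  shows "\<bar>real (card {k \<in> {a..<a + K}. [k = r] (mod M) \<and> (\<forall>p\<in>T. k mod p \<in> R p)})
           - real K * 2 ^ card T / (real M * real (\<Prod>T))\<bar> \<le> 2 ^ card T"
  using assms
proof (induction T arbitrary: M r rule: finite_induct)
  case empty
  show ?case using card_residue_interval[OF empty.prems(3), of a K r] by simp
next
  case (insert p T)
  have p: "prime p" "coprime M p" "R p \<subseteq> {..<p}" "card (R p) = 2" using insert.prems by auto
  have p0: "p > 0" using p prime_gt_0_nat by blast
  have finR: "finite (R p)" using p(3) finite_subset by blast
  define N where "N = (\<lambda>\<rho>. {k \<in> {a..<a + K}. ([k = r] (mod M) \<and> [k = \<rho>] (mod p)) \<and> (\<forall>q\<in>T. k mod q \<in> R q)})"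
  define c where "c = real K * 2 ^ card T / (real (M * p) * real (\<Prod>T))"
  have N: "\<bar>real (card (N \<rho>)) - c\<bar> \<le> 2 ^ card T" for \<rho>
  proof -
    obtain r' where r': "[r' = r] (mod M)" "[r' = \<rho>] (mod p)"
      using binary_chinese_remainder_nat[OF p(2)] by blast
    have "([k = r] (mod M) \<and> [k = \<rho>] (mod p)) \<longleftrightarrow> [k = r'] (mod M * p)" for k
      using r' p(2) by (metis cong_sym cong_trans coprime_cong_mult_nat cong_modulus_mult_nat mult.commute)
    hence "N \<rho> = {k \<in> {a..<a + K}. [k = r'] (mod M * p) \<and> (\<forall>q\<in>T. k mod q \<in> R q)}"
      unfolding N_def by simp
    moreover have "coprime (M * p) q" if "q \<in> T" for q
      using that insert.prems insert.hyps(2) p(1) by (metis coprime_mult_left_iff insertCI primes_coprime)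
    ultimately show ?thesis unfolding c_def
      using insert.IH[of "M * p" r'] insert.prems p0 by auto
  qed
  have "{k \<in> {a..<a + K}. [k = r] (mod M) \<and> (\<forall>q\<in>insert p T. k mod q \<in> R q)} = (\<Union>\<rho>\<in>R p. N \<rho>)"
  proof -
    have "k mod p \<in> R p \<longleftrightarrow> (\<exists>\<rho>\<in>R p. [k = \<rho>] (mod p))" for k
    proof
      assume "k mod p \<in> R p"
      moreover have "[k = k mod p] (mod p)" by (simp add: unique_euclidean_semiring_class.cong_def)
      ultimately show "\<exists>\<rho>\<in>R p. [k = \<rho>] (mod p)" by (rule bexI[rotated])
    next
      assume "\<exists>\<rho>\<in>R p. [k = \<rho>] (mod p)"
      then obtain \<rho> where \<rho>: "\<rho> \<in> R p" "k mod p = \<rho> mod p" unfolding unique_euclidean_semiring_class.cong_def by (elim bexE)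
      have "\<rho> < p" using p(3) \<rho>(1) by (meson lessThan_iff subsetD)
      hence "\<rho> mod p = \<rho>" by (rule mod_less)
      thus "k mod p \<in> R p" using \<rho> by argo
    qed
    thus ?thesis unfolding N_def by auto
  qed
  moreover have "card (\<Union>\<rho>\<in>R p. N \<rho>) = (\<Sum>\<rho>\<in>R p. card (N \<rho>))"
  proof (rule card_UN_disjoint[OF finR])
    show "\<forall>i\<in>R p. \<forall>j\<in>R p. i \<noteq> j \<longrightarrow> N i \<inter> N j = {}"
    proof (intro ballI impI)
      fix i j assume ij: "i \<in> R p" "j \<in> R p" "i \<noteq> j"
      have "i < p" "j < p" using ij p(3) by auto
      hence "\<not> [i = j] (mod p)" using ij by (simp add: unique_euclidean_semiring_class.cong_def)
      thus "N i \<inter> N j = {}" unfolding N_def using cong_sym cong_trans by blast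
    qed
  qed (auto simp: N_def)
  ultimately have "\<bar>real (card {k \<in> {a..<a + K}. [k = r] (mod M) \<and> (\<forall>q\<in>insert p T. k mod q \<in> R q)}) - 2 * c\<bar>
      = \<bar>\<Sum>\<rho>\<in>R p. (real (card (N \<rho>)) - c)\<bar>"
    using p(4) by (simp add: sum_subtractf)
  also have "\<dots> \<le> (\<Sum>\<rho>\<in>R p. \<bar>real (card (N \<rho>)) - c\<bar>)" by (rule sum_abs)
  also have "\<dots> \<le> (\<Sum>\<rho>\<in>R p. 2 ^ card T)" by (intro sum_mono N)
  also have "\<dots> = 2 ^ card (insert p T)" using p(4) insert.hyps by simp
  finally show ?case unfolding c_def using insert.hyps by (simp add: mult_ac)
qed

text \<open>For nonempty \<open>A\<close> the truncated alternating sum of binomial coefficients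
  collapses to \<open>(card A - 1) choose (2 * r)\<close>, with positive sign because the truncation
  is even. In the sieve it replaces the indicator of the \<open>k\<close> that survive.\<close>

lemma bonferroni_even:
  fixes A :: "'a set"
  assumes "finite A"
  shows "(if A = {} then 1 else 0) \<le> (\<Sum>T | T \<subseteq> A \<and> card T \<le> 2 * r. (-1) ^ card T :: real)"
proof -
  have "(\<Sum>T | T \<subseteq> A \<and> card T \<le> 2 * r. (-1) ^ card T :: real)
      = (\<Sum>j\<le>2 * r. \<Sum>T | T \<in> {T. T \<subseteq> A \<and> card T \<le> 2 * r} \<and> card T = j. (-1) ^ card T)"
    using assms by (intro sum.group[symmetric]) auto
  also have "\<dots> = (\<Sum>j\<le>2 * r. (of_nat (card A) gchoose j) * (-1) ^ j)"
  proof (rule sum.cong[OF refl])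
    fix j assume j: "j \<in> {..2 * r}"
    have "{T \<in> {T. T \<subseteq> A \<and> card T \<le> 2 * r}. card T = j} = {T. T \<subseteq> A \<and> card T = j}" using j by auto
    moreover have "card {T. T \<subseteq> A \<and> card T = j} = card A choose j" by (rule n_subsets[OF assms])
    ultimately show "(\<Sum>T | T \<in> {T. T \<subseteq> A \<and> card T \<le> 2 * r} \<and> card T = j. (-1) ^ card T :: real)
        = (of_nat (card A) gchoose j) * (-1) ^ j"
      by (simp add: binomial_gbinomial)
  qed
  also have "\<dots> = (-1) ^ (2 * r) * ((of_nat (card A) - 1) gchoose (2 * r))"
    by (rule gbinomial_sum_lower_neg)
  also have "\<dots> = ((of_nat (card A) - 1) gchoose (2 * r))" by simp
  finally have eq: "(\<Sum>T | T \<subseteq> A \<and> card T \<le> 2 * r. (-1) ^ card T :: real) = ((of_nat (card A) - 1) gchoose (2 * r))" .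
  show ?thesis
  proof (cases "A = {}")
    case True
    have "{T. T \<subseteq> {} \<and> card T \<le> 2 * r} = {{} :: 'a set}" by auto
    thus ?thesis unfolding True by (simp only:) simp
  next
    case False
    hence "card A \<ge> 1" using assms by (simp add: Suc_leI card_gt_0_iff)
    hence "(of_nat (card A) - 1 :: real) = of_nat (card A - 1)" by simp
    hence "((of_nat (card A) - 1 :: real) gchoose (2 * r)) = of_nat ((card A - 1) choose (2 * r))"
      by (simp only: binomial_gbinomial)
    thus ?thesis unfolding eq using False by simp
  qed
qed

lemma prod_add_one_Pow:
  fixes f :: "'a \<Rightarrow> 'b :: comm_semiring_1"
  assumes "finite P"
  shows "(\<Prod>p\<in>P. 1 + f p) = (\<Sum>T\<in>Pow P. \<Prod>p\<in>T. f p)"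
  using prod_add[OF assms, of f "\<lambda>_. 1"] by (simp add: add.commute)

lemma prod_one_plus_le_exp:
  fixes f :: "'a \<Rightarrow> real"
  assumes "\<And>p. p \<in> P \<Longrightarrow> 1 + f p \<ge> 0"
  shows "(\<Prod>p\<in>P. 1 + f p) \<le> exp (\<Sum>p\<in>P. f p)"
proof (cases "finite P")
  case True
  have "(\<Prod>p\<in>P. 1 + f p) \<le> (\<Prod>p\<in>P. exp (f p))"
    using assms by (intro prod_mono) auto
  thus ?thesis using True by (simp add: exp_sum)
qed simp

text \<open>The truncation errors of the inclusion-exclusion sum are estimated by Rankin's trick with
  weights \<open>exp (card T - 2 * r)\<close> (long sets) and \<open>Z ^ (2 * r - card T)\<close> (short sets).\<close>

lemma brun_sieve:
  fixes P :: "nat set" and R :: "nat \<Rightarrow> nat set" and a K r :: nat and Z :: real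
  assumes "finite P" "\<And>p. p \<in> P \<Longrightarrow> prime p" "\<And>p. p \<in> P \<Longrightarrow> R p \<subseteq> {..<p} \<and> card (R p) = 2"
    and "Z \<ge> 1" "real (card P) \<le> Z"
  defines "S \<equiv> (\<Sum>p\<in>P. 2 / real p)"
  shows "real (card {k \<in> {a..<a + K}. \<forall>p\<in>P. k mod p \<notin> R p})
           \<le> real K * (exp (-S) + exp (exp 1 * S - 2 * real r)) + exp 2 * Z ^ (2 * r)"
proof -
  define I where "I = {a..<a + K}"
  define A where "A = (\<lambda>k. {p \<in> P. k mod p \<in> R p})"
  define N where "N = (\<lambda>T. {k \<in> I. \<forall>p\<in>T. k mod p \<in> R p})"
  define g where "g = (\<lambda>T. \<Prod>p\<in>T. 2 / real p)"
  define Q where "Q = {T. T \<subseteq> P \<and> card T \<le> 2 * r}"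
  have finQ: "finite Q" unfolding Q_def by (rule finite_subset[of _ "Pow P"]) (use assms(1) in auto)
  have finI: "finite I" unfolding I_def by simp
  have QP: "Q \<subseteq> Pow P" unfolding Q_def by auto
  have p2: "real p \<ge> 2" if "p \<in> P" for p using assms(2)[OF that] prime_ge_2_nat by force
  have gnn: "g T \<ge> 0" for T unfolding g_def by (intro prod_nonneg) auto
  have N: "\<bar>real (card (N T)) - real K * g T\<bar> \<le> 2 ^ card T" if T: "T \<subseteq> P" for T
  proof -
    have fT: "finite T" using T assms(1) finite_subset by blast
    have "\<bar>real (card {k \<in> {a..<a + K}. [k = 0] (mod 1) \<and> (\<forall>p\<in>T. k mod p \<in> R p)})
           - real K * 2 ^ card T / (real 1 * real (\<Prod>T))\<bar> \<le> 2 ^ card T"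
      using T assms by (intro card_sieve_residues fT) auto
    moreover have "g T = 2 ^ card T / real (\<Prod>T)"
      unfolding g_def by (simp add: prod_dividef)
    ultimately show ?thesis unfolding N_def I_def by simp
  qed
  have "real (card {k \<in> I. \<forall>p\<in>P. k mod p \<notin> R p}) = (\<Sum>k\<in>I. if A k = {} then 1 else 0)"
    unfolding A_def using finI by (simp add: sum.If_cases) (intro arg_cong[where f = card], auto)
  also have "\<dots> \<le> (\<Sum>k\<in>I. \<Sum>T | T \<subseteq> A k \<and> card T \<le> 2 * r. (-1) ^ card T)"
    using assms(1) unfolding A_def by (intro sum_mono bonferroni_even) auto
  also have "\<dots> = (\<Sum>k\<in>I. \<Sum>T\<in>Q. if k \<in> N T then (-1) ^ card T else 0)"
  proof (rule sum.cong[OF refl])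
    fix k assume k: "k \<in> I"
    have "{T. T \<subseteq> A k \<and> card T \<le> 2 * r} = {T \<in> Q. k \<in> N T}"
      unfolding A_def Q_def N_def using k by auto
    thus "(\<Sum>T | T \<subseteq> A k \<and> card T \<le> 2 * r. (-1) ^ card T) = (\<Sum>T\<in>Q. if k \<in> N T then (-1) ^ card T else (0::real))"
      using finQ by (simp add: sum.inter_filter)
  qed
  also have "\<dots> = (\<Sum>T\<in>Q. \<Sum>k\<in>I. if k \<in> N T then (-1) ^ card T else 0)" by (rule sum.swap)
  also have "\<dots> = (\<Sum>T\<in>Q. (-1) ^ card T * real (card (N T)))"
  proof (rule sum.cong[OF refl])
    fix T assume "T \<in> Q"
    have "N T \<subseteq> I" unfolding N_def by auto
    hence "I \<inter> N T = N T" by auto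
    thus "(\<Sum>k\<in>I. if k \<in> N T then (-1) ^ card T else 0) = (-1) ^ card T * real (card (N T))"
      using finI by (simp add: sum.If_cases Int_def[symmetric])
  qed
  also have "\<dots> \<le> (\<Sum>T\<in>Q. real K * ((-1) ^ card T * g T) + 2 ^ card T)"
  proof (rule sum_mono)
    fix T assume "T \<in> Q"
    hence "\<bar>real (card (N T)) - real K * g T\<bar> \<le> 2 ^ card T" using QP by (intro N) auto
    thus "(-1) ^ card T * real (card (N T)) \<le> real K * ((-1) ^ card T * g T) + 2 ^ card T"
      by (cases "even (card T)") (auto simp: abs_le_iff)
  qed
  also have "\<dots> = real K * (\<Sum>T\<in>Q. (-1) ^ card T * g T) + (\<Sum>T\<in>Q. 2 ^ card T)"
    by (simp add: sum.distrib sum_distrib_left)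
  also have "(\<Sum>T\<in>Q. (-1) ^ card T * g T) \<le> exp (-S) + exp (exp 1 * S - 2 * real r)"
  proof -
    have "(\<Sum>T\<in>Pow P. (-1) ^ card T * g T) = (\<Prod>p\<in>P. 1 + (- (2 / real p)))"
      unfolding prod_add_one_Pow[OF assms(1)] g_def
    proof (rule sum.cong[OF refl])
      fix T assume "T \<in> Pow P"
      have "(\<Prod>p\<in>T. - (2 / real p)) = (\<Prod>p\<in>T. (-1) * (2 / real p))" by simp
      also have "\<dots> = (-1) ^ card T * (\<Prod>p\<in>T. 2 / real p)" unfolding prod.distrib by simp
      finally show "(-1) ^ card T * (\<Prod>p\<in>T. 2 / real p) = (\<Prod>p\<in>T. - (2 / real p))" by simp
    qed
    also have "\<dots> \<le> exp (\<Sum>p\<in>P. - (2 / real p))"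
    proof (rule prod_one_plus_le_exp)
      fix p assume "p \<in> P"
      thus "0 \<le> 1 + - (2 / real p)" using p2[of p] by (simp add: field_simps)
    qed
    also have "\<dots> = exp (-S)" unfolding S_def by (simp add: sum_negf)
    finally have full: "(\<Sum>T\<in>Pow P. (-1) ^ card T * g T) \<le> exp (-S)" .
    have "(\<Sum>T\<in>Pow P - Q. - ((-1) ^ card T * g T)) \<le> (\<Sum>T\<in>Pow P - Q. exp (real (card T) - 2 * real r) * g T)"
    proof (rule sum_mono)
      fix T assume "T \<in> Pow P - Q"
      hence "card T > 2 * r" unfolding Q_def by auto
      hence "exp (real (card T) - 2 * real r) \<ge> 1" by simp
      hence "1 * g T \<le> exp (real (card T) - 2 * real r) * g T" by (intro mult_right_mono gnn)
      moreover have "- ((-1) ^ card T * g T) \<le> g T" using gnn[of T] by (cases "even (card T)") auto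
      ultimately show "- ((-1) ^ card T * g T) \<le> exp (real (card T) - 2 * real r) * g T" by linarith
    qed
    also have "\<dots> \<le> (\<Sum>T\<in>Pow P. exp (real (card T) - 2 * real r) * g T)"
      using assms(1) gnn by (intro sum_mono2) auto
    also have "\<dots> = exp (- 2 * real r) * (\<Sum>T\<in>Pow P. \<Prod>p\<in>T. exp 1 * (2 / real p))"
      unfolding sum_distrib_left
    proof (rule sum.cong[OF refl])
      fix T assume "T \<in> Pow P"
      have "exp (real (card T)) = exp 1 ^ card T" by (simp flip: exp_of_nat_mult)
      thus "exp (real (card T) - 2 * real r) * g T = exp (- 2 * real r) * (\<Prod>p\<in>T. exp 1 * (2 / real p))"
        unfolding g_def prod.distrib by (simp add: exp_diff exp_minus field_simps)
    qed
    also have "(\<Sum>T\<in>Pow P. \<Prod>p\<in>T. exp 1 * (2 / real p)) = (\<Prod>p\<in>P. 1 + exp 1 * (2 / real p))"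
      by (rule prod_add_one_Pow[OF assms(1), symmetric])
    also have "\<dots> \<le> exp (\<Sum>p\<in>P. exp 1 * (2 / real p))"
      by (intro prod_one_plus_le_exp add_nonneg_nonneg) auto
    also have "\<dots> = exp (exp 1 * S)" unfolding S_def by (simp add: sum_distrib_left)
    finally have "(\<Sum>T\<in>Pow P - Q. - ((-1) ^ card T * g T)) \<le> exp (- 2 * real r) * exp (exp 1 * S)"
      by simp
    hence tail: "(\<Sum>T\<in>Pow P - Q. - ((-1) ^ card T * g T)) \<le> exp (exp 1 * S - 2 * real r)"
      by (simp flip: exp_add)
    have "(\<Sum>T\<in>Pow P. (-1) ^ card T * g T) = (\<Sum>T\<in>Pow P - Q. (-1) ^ card T * g T) + (\<Sum>T\<in>Q. (-1) ^ card T * g T)"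
      using QP assms(1) by (intro sum.subset_diff) auto
    thus ?thesis using full tail by (simp add: sum_negf)
  qed
  also have "(\<Sum>T\<in>Q. 2 ^ card T) \<le> exp 2 * Z ^ (2 * r)"
  proof -
    have "(\<Sum>T\<in>Q. 2 ^ card T) \<le> (\<Sum>T\<in>Q. Z ^ (2 * r) * (\<Prod>p\<in>T. 2 / Z))"
    proof (rule sum_mono)
      fix T assume "T \<in> Q"
      hence "card T \<le> 2 * r" unfolding Q_def by auto
      hence "Z ^ card T \<le> Z ^ (2 * r)" using assms(4) by (intro power_increasing) auto
      hence "2 ^ card T * Z ^ card T \<le> 2 ^ card T * Z ^ (2 * r)" by (intro mult_left_mono) auto
      thus "2 ^ card T \<le> Z ^ (2 * r) * (\<Prod>p\<in>T. 2 / Z)"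
        using assms(4) by (simp add: power_divide field_simps)
    qed
    also have "\<dots> \<le> (\<Sum>T\<in>Pow P. Z ^ (2 * r) * (\<Prod>p\<in>T. 2 / Z))"
      using QP assms(1,4) by (intro sum_mono2) auto
    also have "\<dots> = Z ^ (2 * r) * (\<Prod>p\<in>P. 1 + 2 / Z)"
      unfolding prod_add_one_Pow[OF assms(1)] by (simp add: sum_distrib_left)
    also have "\<dots> \<le> Z ^ (2 * r) * exp (\<Sum>p\<in>P. 2 / Z)"
      using assms(4) by (intro mult_left_mono prod_one_plus_le_exp) auto
    \<comment> \<open>\<open>card P \<le> Z\<close> keeps the sum of the \<open>2 / Z\<close> at
      most 2.\<close>
    also have "\<dots> \<le> Z ^ (2 * r) * exp 2"
      using assms(4,5) by (intro mult_left_mono) (auto simp: field_simps)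
    finally show ?thesis by (simp add: mult.commute)
  qed
  finally show ?thesis unfolding I_def by (simp add: mult_left_mono)
qed

lemma sum_Un_le:
  fixes f :: "'a \<Rightarrow> real"
  assumes "finite A" "finite B" "\<And>x. x \<in> A \<inter> B \<Longrightarrow> f x \<ge> 0"
  shows "sum f (A \<union> B) \<le> sum f A + sum f B"
proof -
  have "sum f (A \<inter> B) \<ge> 0" using assms(3) by (rule sum_nonneg)
  thus ?thesis using sum.union_inter[OF assms(1,2), of f] by linarith
qed

text \<open>Each prime counted exceeds \<open>exp 1\<close> and their product divides
  \<open>d\<close>, so \<open>exp\<close> of their number is at most \<open>d\<close>. This controls
  the primes that are left out of the sieve because they divide the coefficient
  \<open>d\<close>.\<close>

lemma card_prime_divisors_le_ln:
  fixes d :: nat and w :: real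
  assumes "d > 0" "w \<ge> exp 1"
  shows "real (card {p. prime p \<and> w < real p \<and> p dvd d}) \<le> ln (real d)"
proof -
  let ?A = "{p. prime p \<and> w < real p \<and> p dvd d}"
  have fin: "finite ?A" using assms by (intro finite_subset[OF _ finite_divisors_nat[of d]]) auto
  have "\<Prod>?A dvd d" using fin by (intro prod_prime_set_dvd) auto
  hence "real (\<Prod>?A) \<le> real d" using assms dvd_imp_le[of "\<Prod>?A" d] by (subst of_nat_le_iff) auto
  moreover have "exp (real (card ?A)) \<le> real (\<Prod>?A)"
  proof -
    have "exp (real (card ?A)) = (\<Prod>p\<in>?A. exp 1)" by (simp flip: exp_of_nat_mult)
    also have "\<dots> \<le> (\<Prod>p\<in>?A. real p)" using assms by (intro prod_mono) auto
    finally show ?thesis by simp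
  qed
  ultimately have "exp (real (card ?A)) \<le> real d" by linarith
  hence "ln (exp (real (card ?A))) \<le> ln (real d)" using assms(1) by (subst ln_le_cancel_iff) auto
  thus ?thesis by simp
qed

text \<open>Primes dividing \<open>d\<close> are dropped, since modulo them \<open>d * k + c\<close>
  has no root in \<open>k\<close>. To make the loss uniform in \<open>d\<close>, sieving starts
  above some \<open>w \<ge> ln d\<close>: at most \<open>w\<close> primes are dropped, each with
  reciprocal below \<open>1 / w\<close>. The constant 23 consists of 10 from Mertens up to
  \<open>w\<close>, 12 from Mertens up to \<open>z\<close>, and 1 for the dropped primes.\<close>

lemma sifting_sum_bounds:
  fixes d :: nat and w z :: real
  assumes "d > 0" "exp 1 \<le> w" "w \<le> z" "ln (real d) \<le> w"
  defines "P \<equiv> {p. prime p \<and> w < real p \<and> real p \<le> z \<and> \<not> p dvd d}"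
  shows "ln (ln z) - ln (ln w) - 23 \<le> (\<Sum>p\<in>P. 1 / real p)" "(\<Sum>p\<in>P. 1 / real p) \<le> ln (ln z) + 10"
proof -
  have w0: "w > 1" using assms(2) exp_ge_add_one_self[of 1] by linarith
  let ?B = "{p. prime p \<and> w < real p \<and> p dvd d}"
  have finB: "finite ?B" using assms by (intro finite_subset[OF _ finite_divisors_nat[of d]]) auto
  have PU: "P \<subseteq> primes_upto z" unfolding P_def primes_upto_def by auto
  hence finP: "finite P" using finite_primes_upto finite_subset by blast
  have "(\<Sum>p\<in>P. 1 / real p) \<le> (\<Sum>p\<in>primes_upto z. 1 / real p)" using PU by (intro sum_mono2) auto
  thus "(\<Sum>p\<in>P. 1 / real p) \<le> ln (ln z) + 10" using mertens_upper[of z] assms by linarith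
  have "(\<Sum>p\<in>primes_upto z. 1 / real p) \<le> (\<Sum>p\<in>primes_upto w \<union> (?B \<union> P). 1 / real p)"
    using finB finP by (intro sum_mono2 finite_UnI finite_primes_upto) (auto simp: P_def primes_upto_def)
  also have "\<dots> \<le> (\<Sum>p\<in>primes_upto w. 1 / real p) + (\<Sum>p\<in>?B \<union> P. 1 / real p)"
    using finB finP by (intro sum_Un_le) auto
  also have "(\<Sum>p\<in>?B \<union> P. 1 / real p) \<le> (\<Sum>p\<in>?B. 1 / real p) + (\<Sum>p\<in>P. 1 / real p)"
    using finB finP by (intro sum_Un_le) auto
  also have "(\<Sum>p\<in>?B. 1 / real p) \<le> (\<Sum>p\<in>?B. 1 / w)"
    using w0 by (intro sum_mono divide_left_mono) auto
  also have "\<dots> = real (card ?B) / w" by simp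
  also have "\<dots> \<le> 1"
    using card_prime_divisors_le_ln[OF assms(1,2)] assms(4) w0 by (simp add: field_simps)
  also have "(\<Sum>p\<in>primes_upto w. 1 / real p) \<le> ln (ln w) + 10" by (rule mertens_upper[OF assms(2)])
  finally show "ln (ln z) - ln (ln w) - 23 \<le> (\<Sum>p\<in>P. 1 / real p)"
    using mertens_lower[of z] assms w0 by linarith
qed

text \<open>For each sieving prime two classes are removed: 0 and the root of
  \<open>d * k + c\<close>, which is not 0 since \<open>c\<close> is 1 or -1. This is legitimate
  because \<open>k > z + 1\<close> makes both \<open>k\<close> and \<open>d * k + c\<close> larger
  than the prime. Two classes per prime yield the square of \<open>ln z\<close> in the denominator;
  the last summand is the accumulated rounding error.\<close>

lemma card_prime_pairs_le:
  fixes d K :: nat and c :: int and w z :: real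
  assumes "d > 0" "exp 1 \<le> w" "w \<le> z" "ln (real d) \<le> w" "c = 1 \<or> c = -1" "real K > z + 1"
  shows "real (card {k \<in> {K..<K + K}. prime k \<and> prime (int d * int k + c)})
    \<le> real K * ((exp 46 * (ln w)\<^sup>2 + 1) / (ln z)\<^sup>2) + exp 2 * exp (ln z * (8 * ln (ln z) + 62))"
proof -
  define P where "P = {p. prime p \<and> w < real p \<and> real p \<le> z \<and> \<not> p dvd d}"
  define S where "S = (\<Sum>p\<in>P. 2 / real p)"
  have w0: "w > 1" "ln w \<ge> 1"
    using assms(2) exp_ge_add_one_self[of 1] ln_mono[of "exp 1" w] by auto
  have z0: "z > 1" "ln z \<ge> ln w" "ln z \<ge> 1"
  proof -
    show "z > 1" using assms(3) w0 by linarith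
    show "ln z \<ge> ln w" using assms(3) w0 by (subst ln_le_cancel_iff) linarith+
    thus "ln z \<ge> 1" using w0 by linarith
  qed
  have PU: "P \<subseteq> primes_upto z" unfolding P_def primes_upto_def by auto
  have finP: "finite P" using PU finite_primes_upto finite_subset by blast
  have Pp: "prime p" "w < real p" "real p \<le> z" "\<not> p dvd d" "p > 2" if "p \<in> P" for p
  proof -
    show "prime p" "w < real p" "real p \<le> z" "\<not> p dvd d" using that unfolding P_def by auto
    thus "p > 2" using assms(2) exp_ge_add_one_self[of 1] by linarith
  qed
  have "\<exists>\<rho>. \<rho> < p \<and> 0 < \<rho> \<and> [int d * int \<rho> + c = 0] (mod int p)" if p: "p \<in> P" for p
  proof -
    have cop: "coprime (int d) (int p)"
      using Pp[OF p] by (metis coprime_commute coprime_int_iff prime_imp_coprime)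
    obtain x where x: "[int d * x = 1] (mod int p)" using cong_solve_coprime_int[OF cop] by blast
    define \<rho> where "\<rho> = nat ((- c * x) mod int p)"
    have p0: "int p > 0" using Pp(5)[OF p] by simp
    have \<rho>: "int \<rho> = (- c * x) mod int p" unfolding \<rho>_def using p0 by simp
    have "[int d * int \<rho> + c = int d * (- c * x) + c] (mod int p)"
      unfolding \<rho> by (intro cong_add cong_mult cong_refl cong_mod_leftI cong_refl)
    also have "int d * (- c * x) + c = - c * (int d * x) + c" by (simp add: algebra_simps)
    also have "[- c * (int d * x) + c = - c * 1 + c] (mod int p)"
      by (intro cong_add cong_mult cong_refl x)
    finally have 1: "[int d * int \<rho> + c = 0] (mod int p)" by simp
    have "\<rho> \<noteq> 0"
    proof
      assume "\<rho> = 0"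
      hence "int p dvd c" using 1 by (simp add: cong_0_iff)
      thus False using assms(5) Pp(5)[OF p] by auto
    qed
    moreover have "int \<rho> < int p" unfolding \<rho> using p0 by simp
    ultimately show ?thesis using 1 by auto
  qed
  then obtain \<rho> where \<rho>: "\<And>p. p \<in> P \<Longrightarrow> \<rho> p < p \<and> 0 < \<rho> p \<and> [int d * int (\<rho> p) + c = 0] (mod int p)"
    by metis
  define R where "R = (\<lambda>p. {0, \<rho> p})"
  \<comment> \<open>The level makes the tail as small as the main term: \<open>exp 1 * S\<close> is
    at most \<open>11/2 * (ln (ln z) + 10)\<close>, while \<open>2 * r\<close> is at least
    \<open>8 * ln (ln z) + 60\<close>, so the difference is below
    \<open>- 2 * ln (ln z)\<close>.\<close>
  define r where "r = nat \<lceil>4 * ln (ln z) + 30\<rceil>"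
  have lnlnz: "ln (ln z) \<ge> 0" using z0(3) by (rule ln_ge_zero)
  have r: "4 * ln (ln z) + 30 \<le> real r" "real r \<le> 4 * ln (ln z) + 31"
    unfolding r_def using lnlnz by linarith+
  have S: "2 * (ln (ln z) - ln (ln w) - 23) \<le> S" "S \<le> 2 * (ln (ln z) + 10)"
  proof -
    have "S = 2 * (\<Sum>p\<in>P. 1 / real p)" unfolding S_def by (simp add: sum_distrib_left)
    thus "2 * (ln (ln z) - ln (ln w) - 23) \<le> S" "S \<le> 2 * (ln (ln z) + 10)"
      using sifting_sum_bounds[OF assms(1-4)] unfolding P_def by auto
  qed
  have "real (card {k \<in> {K..<K + K}. prime k \<and> prime (int d * int k + c)})
      \<le> real (card {k \<in> {K..<K + K}. \<forall>p\<in>P. k mod p \<notin> R p})"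
  proof (intro of_nat_mono card_mono subsetI)
    fix k assume k: "k \<in> {k \<in> {K..<K + K}. prime k \<and> prime (int d * int k + c)}"
    have kz: "real k > z + 1" using k assms(6) by auto
    have "k mod p \<notin> R p" if p: "p \<in> P" for p
    proof
      assume "k mod p \<in> R p"
      then consider "k mod p = 0" | "k mod p = \<rho> p" unfolding R_def by auto
      thus False
      proof cases
        case 1
        hence "p dvd k" by auto
        hence "p = k" using k Pp[OF p] by (metis (no_types, lifting) mem_Collect_eq primes_dvd_imp_eq)
        thus False using kz Pp(3)[OF p] by simp
      next
        case 2
        have "[int k = int (\<rho> p)] (mod int p)"
          using 2 \<rho>[OF p] by (simp add: unique_euclidean_semiring_class.cong_def flip: of_nat_mod)
        hence "[int d * int k + c = int d * int (\<rho> p) + c] (mod int p)"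
          by (intro cong_add cong_mult cong_refl)
        hence "[int d * int k + c = 0] (mod int p)" using \<rho>[OF p] cong_trans by blast
        hence "int p dvd int d * int k + c" by (simp add: cong_0_iff)
        hence "int p = int d * int k + c"
          using k Pp(1)[OF p] by (intro primes_dvd_imp_eq) auto
        moreover have "int d * int k \<ge> 1 * int k" using assms(1) by (intro mult_right_mono) auto
        ultimately have "int k - 1 \<le> int p" using assms(5) by auto
        thus False using kz Pp(3)[OF p] by linarith
      qed
    qed
    thus "k \<in> {k \<in> {K..<K + K}. \<forall>p\<in>P. k mod p \<notin> R p}" using k by auto
  qed auto
  also have "\<dots> \<le> real K * (exp (-S) + exp (exp 1 * S - 2 * real r)) + exp 2 * z ^ (2 * r)"
    unfolding S_def
  proof (rule brun_sieve[OF finP])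
    show "z \<ge> 1" using z0 by simp
    have "P \<subseteq> {1..nat \<lfloor>z\<rfloor>}" using Pp by (force simp: le_nat_floor)
    hence "card P \<le> card {1..nat \<lfloor>z\<rfloor>}" by (intro card_mono) auto
    hence "card P \<le> nat \<lfloor>z\<rfloor>" by simp
    thus "real (card P) \<le> z" using z0 by linarith
    show "\<And>p. p \<in> P \<Longrightarrow> prime p" using Pp by blast
    show "R p \<subseteq> {..<p} \<and> card (R p) = 2" if "p \<in> P" for p
      unfolding R_def using \<rho>[OF that] by auto
  qed
  also have "\<dots> \<le> real K * ((exp 46 * (ln w)\<^sup>2 + 1) / (ln z)\<^sup>2) + exp 2 * exp (ln z * (8 * ln (ln z) + 62))"
  proof (intro add_mono mult_left_mono)
    have sq: "exp (2 * ln u) = u\<^sup>2" if "u > 0" for u :: real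
    proof -
      have "exp (2 * ln u) = exp (ln u + ln u)" by (simp only: mult_2)
      also have "\<dots> = u * u" unfolding exp_add using that by simp
      finally show ?thesis by (simp only: power2_eq_square)
    qed
    have "exp (-S) \<le> exp (46 + 2 * ln (ln w) - 2 * ln (ln z))" using S by simp
    also have "\<dots> = exp 46 * (ln w)\<^sup>2 / (ln z)\<^sup>2"
      using w0 z0 by (simp add: exp_add exp_diff sq)
    finally have 1: "exp (-S) \<le> exp 46 * (ln w)\<^sup>2 / (ln z)\<^sup>2" .
    have e: "exp 1 \<le> (11/4 :: real)" using e_less_272 by simp
    have "exp 1 * S \<le> (11/4) * (2 * (ln (ln z) + 10))"
      using S e lnlnz w0 by (intro mult_mono') (auto simp: S_def intro!: sum_nonneg)
    hence "exp (exp 1 * S - 2 * real r) \<le> exp (- (2 * ln (ln z)))"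
      using r lnlnz by simp
    also have "\<dots> = 1 / (ln z)\<^sup>2" using z0 w0 by (simp add: exp_minus sq field_simps)
    finally have 2: "exp (exp 1 * S - 2 * real r) \<le> 1 / (ln z)\<^sup>2" .
    show "exp (-S) + exp (exp 1 * S - 2 * real r) \<le> (exp 46 * (ln w)\<^sup>2 + 1) / (ln z)\<^sup>2"
      using 1 2 by (simp add: add_divide_distrib)
    have "z ^ (2 * r) = z powr real (2 * r)" using z0(1) by (subst powr_realpow) linarith+
    also have "\<dots> = exp (ln z * real (2 * r))" using z0(1) unfolding powr_def by (simp only: mult.commute) simp
    also have "\<dots> \<le> exp (ln z * (8 * ln (ln z) + 62))"
      using r z0 w0 by (simp add: mult_left_mono)
    finally show "z ^ (2 * r) \<le> exp (ln z * (8 * ln (ln z) + 62))" .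
  qed auto
  finally show ?thesis .
qed

subsection \<open>Integers whose prime factors have smooth shifts\<close>

text \<open>Each \<open>n \<le> X\<close> receives the weight
  \<open>(X / n) powr (1 - \<eta>) \<ge> 1\<close>, and the sum is extended to an Euler product over
  \<open>Q\<close>. The factor 4 in the exponent comes from \<open>t + 4 * t ^ 2 \<le> 4 * t\<close>
  for \<open>t \<le> 3/4\<close>; it is harmless because the sum over \<open>Q\<close> will be of
  lower order than the gain from \<open>\<eta>\<close>.\<close>

lemma rankin_bound:
  fixes S Q :: "nat set" and X \<eta> :: real
  assumes "finite Q" "\<And>q. q \<in> Q \<Longrightarrow> prime q" "0 \<le> \<eta>" "\<eta> \<le> 1/4"
    and "\<And>n. n \<in> S \<Longrightarrow> n > 0 \<and> real n \<le> X" "\<And>n q. n \<in> S \<Longrightarrow> prime q \<Longrightarrow> q dvd n \<Longrightarrow> q \<in> Q"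
  shows "real (card S) \<le> X powr (1 - \<eta>) * exp (4 * (\<Sum>q\<in>Q. real q powr -(1 - \<eta>)))"
proof -
  have finS: "finite S" using assms(5) by (intro finite_subset[of S "{..nat \<lfloor>X\<rfloor>}"]) (auto simp: le_nat_floor)
  have "real (card S) = (\<Sum>n\<in>S. 1)" by simp
  also have "\<dots> \<le> (\<Sum>n\<in>S. X powr (1 - \<eta>) * real n powr -(1 - \<eta>))"
  proof (rule sum_mono)
    fix n assume "n \<in> S"
    hence n: "real n > 0" "real n \<le> X" using assms(5) by auto
    have "1 = real n powr (1 - \<eta>) * real n powr -(1 - \<eta>)" using n by (simp flip: powr_add)
    also have "\<dots> \<le> X powr (1 - \<eta>) * real n powr -(1 - \<eta>)"
      using n assms(4) by (intro mult_right_mono powr_mono2) auto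
    finally show "1 \<le> X powr (1 - \<eta>) * real n powr -(1 - \<eta>)" .
  qed
  also have "\<dots> = X powr (1 - \<eta>) * (\<Sum>n\<in>S. real n powr -(1 - \<eta>))" by (simp add: sum_distrib_left)
  also have "\<dots> \<le> X powr (1 - \<eta>) * (\<Prod>q\<in>Q. 1 / (1 - real q powr -(1 - \<eta>)))"
    using assms finS by (intro mult_left_mono euler_product_upper) auto
  also have "\<dots> \<le> X powr (1 - \<eta>) * (\<Prod>q\<in>Q. exp (4 * real q powr -(1 - \<eta>)))"
  proof (intro mult_left_mono prod_mono conjI)
    fix q assume "q \<in> Q"
    define t where "t = real q powr -(1 - \<eta>)"
    have t: "0 \<le> t" "t \<le> 3/4"
      unfolding t_def using prime_powr_le_three_quarters assms(2,4) \<open>q \<in> Q\<close> by auto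
    have "t\<^sup>2 \<le> 3/4 * t" using t mult_right_mono[of t "3/4" t] by (simp add: power2_eq_square)
    hence "- ln (1 - t) \<le> 4 * t" using neg_ln_one_minus_le[OF t] by linarith
    hence "exp (- ln (1 - t)) \<le> exp (4 * t)" by simp
    thus "1 / (1 - real q powr -(1 - \<eta>)) \<le> exp (4 * real q powr -(1 - \<eta>))"
      using t unfolding t_def[symmetric] by (simp add: exp_minus field_simps)
    show "0 \<le> 1 / (1 - real q powr -(1 - \<eta>))" using t unfolding t_def[symmetric] by simp
  qed auto
  also have "\<dots> = X powr (1 - \<eta>) * exp (4 * (\<Sum>q\<in>Q. real q powr -(1 - \<eta>)))"
    using assms(1) by (simp add: exp_sum sum_distrib_left)
  finally show ?thesis .
qed

text \<open>The factor \<open>ln y\<close> is the size of the Euler product at exponent 1, and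
  \<open>G\<close> measures the excess caused by \<open>\<eta>\<close>. The constant 22 is 12 from
  \<open>euler_product_le_exp\<close> plus 10 from \<open>mertens_upper\<close>.\<close>

lemma sum_smooth_le:
  fixes D :: "nat set" and y \<eta> G :: real
  assumes "finite D" "\<And>m. m \<in> D \<Longrightarrow> m > 0" "\<And>m p. m \<in> D \<Longrightarrow> prime p \<Longrightarrow> p dvd m \<Longrightarrow> real p \<le> y"
    and "0 \<le> \<eta>" "\<eta> \<le> 1/4" "exp 1 \<le> y"
    and "(\<Sum>p\<in>primes_upto y. real p powr -(1 - \<eta>) - 1 / real p) \<le> G"
  shows "(\<Sum>m\<in>D. real m powr -(1 - \<eta>)) \<le> ln y * exp (G + 22)"
proof -
  have "(\<Sum>m\<in>D. real m powr -(1 - \<eta>)) \<le> (\<Prod>p\<in>primes_upto y. 1 / (1 - real p powr -(1 - \<eta>)))"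
    using assms finite_primes_upto[of y] by (intro euler_product_upper) (auto simp: primes_upto_def)
  also have "\<dots> \<le> exp ((\<Sum>p\<in>primes_upto y. real p powr -(1 - \<eta>)) + 12)"
    using assms by (intro euler_product_le_exp)
  also have "\<dots> \<le> exp (ln (ln y) + (G + 22))"
    using assms(7) mertens_upper[OF assms(6)] by (simp add: sum_subtractf)
  also have "\<dots> = ln y * exp (G + 22)"
  proof -
    have "y > 1" using assms(6) exp_ge_add_one_self[of 1] by linarith
    thus ?thesis by (simp add: exp_add)
  qed
  finally show ?thesis .
qed

text \<open>Bounding \<open>k powr \<eta>\<close> by \<open>y powr \<eta>\<close> leaves
  reciprocals. Every dyadic block contributes at most \<open>\<sigma>\<close> by the sieve
  hypothesis, and at most \<open>3 * ln y\<close> blocks are needed.\<close>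

lemma sum_shifted_prime_cofactor_le:
  fixes y0 y \<eta> \<sigma> :: real and d :: nat and c :: int
  assumes "2 \<le> y0" "y0 \<le> y" "4 \<le> ln y" "0 \<le> \<eta>" "0 \<le> \<sigma>"
    and sieve: "\<And>K. real K \<ge> y0 / 2 \<Longrightarrow>
      real (card {k \<in> {K..<K + K}. prime k \<and> prime (int d * int k + c)}) \<le> real K * \<sigma>"
  shows "(\<Sum>k | prime k \<and> y0 < real k \<and> real k \<le> y \<and> prime (int d * int k + c). real k powr -(1 - \<eta>))
         \<le> y powr \<eta> * (3 * ln y * \<sigma>)"
proof -
  let ?A = "{k. prime k \<and> y0 < real k \<and> real k \<le> y \<and> prime (int d * int k + c)}"
  define n where "n = nat \<lfloor>y0\<rfloor>"
  have n: "real n \<le> y0" "real n \<ge> y0 / 2" "n > 0" unfolding n_def using assms(1) by linarith+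
  \<comment> \<open>Covering up to \<open>2 * y\<close> rather than \<open>y\<close> makes
    \<open>k < n * 2 ^ J\<close> strict, as the half-open blocks require.\<close>
  obtain J where J: "2 * y \<le> real (n * 2 ^ J)" "real J \<le> max 0 (ln (2 * y / n) / ln 2) + 1"
    using ex_dyadic_exponent[of n "2 * y"] n assms by auto
  define B where "B = (\<lambda>j. {k \<in> {n * 2 ^ j..<n * 2 ^ j + n * 2 ^ j}. prime k \<and> prime (int d * int k + c)})"
  have B: "(\<Sum>k\<in>B j. 1 / real k) \<le> \<sigma>" for j
  proof -
    let ?K = "n * 2 ^ j"
    have K: "real ?K \<ge> real n" by (subst of_nat_le_iff) simp
    have K0: "real ?K > 0" using K n by linarith
    have "(\<Sum>k\<in>B j. 1 / real k) \<le> (\<Sum>k\<in>B j. 1 / real ?K)"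
    proof (rule sum_mono)
      fix k assume "k \<in> B j"
      hence "real ?K \<le> real k" unfolding B_def by (subst of_nat_le_iff) simp
      thus "1 / real k \<le> 1 / real ?K" using K0 by (intro divide_left_mono mult_pos_pos) linarith+
    qed
    also have "\<dots> = real (card (B j)) / real ?K" by simp
    also have "\<dots> \<le> (real ?K * \<sigma>) / real ?K"
    proof (rule divide_right_mono)
      show "real (card (B j)) \<le> real ?K * \<sigma>" unfolding B_def using K n by (intro sieve) linarith
    qed simp
    also have "\<dots> = \<sigma>" using n(3) by simp
    finally show ?thesis .
  qed
  have AB: "?A \<subseteq> (\<Union>j<J. B j)"
  proof
    fix k assume k: "k \<in> ?A"
    have "\<exists>j<J. n * 2 ^ j \<le> k \<and> k < n * 2 ^ Suc j"
    proof -
      have "real k < real (n * 2 ^ J)" using k J assms by auto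
      hence kJ: "k < n * 2 ^ J" by (simp only: of_nat_less_iff)
      have "real n \<le> real k" using k n by auto
      hence nk: "n * 2 ^ 0 \<le> k" by simp
      show ?thesis
        using kJ
      proof (induction J)
        case 0
        thus ?case using nk by simp
      next
        case (Suc J)
        show ?case
        proof (cases "k < n * 2 ^ J")
          case True
          thus ?thesis using Suc.IH less_SucI by blast
        next
          case False
          thus ?thesis using Suc.prems by (intro exI[of _ J]) simp
        qed
      qed
    qed
    thus "k \<in> (\<Union>j<J. B j)" using k unfolding B_def by auto
  qed
  have finB: "finite (B j)" for j unfolding B_def by simp
  have "(\<Sum>k\<in>?A. real k powr -(1 - \<eta>)) \<le> (\<Sum>k\<in>?A. y powr \<eta> * (1 / real k))"
  proof (rule sum_mono)
    fix k assume "k \<in> ?A"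
    hence k: "real k > 0" "real k \<le> y" using assms by auto
    have "real k powr -(1 - \<eta>) = real k powr \<eta> * (1 / real k)"
      using k powr_diff[of "real k" \<eta> 1] by simp
    also have "\<dots> \<le> y powr \<eta> * (1 / real k)" using k assms by (intro mult_right_mono powr_mono2) auto
    finally show "real k powr -(1 - \<eta>) \<le> y powr \<eta> * (1 / real k)" .
  qed
  also have "\<dots> = y powr \<eta> * (\<Sum>k\<in>?A. 1 / real k)" by (simp add: sum_distrib_left)
  also have "\<dots> \<le> y powr \<eta> * (3 * ln y * \<sigma>)"
  proof (rule mult_left_mono)
    have "(\<Sum>k\<in>?A. 1 / real k) \<le> (\<Sum>k\<in>(\<Union>j<J. B j). 1 / real k)"
      using AB finB by (intro sum_mono2) auto
    also have "\<dots> \<le> (\<Sum>j<J. \<Sum>k\<in>B j. 1 / real k)"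
    proof (induction J)
      case (Suc J)
      have "(\<Union>j<Suc J. B j) = (\<Union>j<J. B j) \<union> B J" by (auto simp: less_Suc_eq)
      moreover have "(\<Sum>k\<in>(\<Union>j<J. B j) \<union> B J. 1 / real k) \<le> (\<Sum>k\<in>(\<Union>j<J. B j). 1 / real k) + (\<Sum>k\<in>B J. 1 / real k)"
        using finB by (intro sum_Un_le) auto
      ultimately show ?case using Suc by simp
    qed simp
    also have "\<dots> \<le> (\<Sum>j<J. \<sigma>)" by (intro sum_mono B)
    also have "\<dots> = real J * \<sigma>" by simp
    also have "\<dots> \<le> (3 * ln y) * \<sigma>"
    proof (rule mult_right_mono)
      have "2 * y / n \<le> 2 * y" using n assms by (simp add: field_simps)
      hence "ln (2 * y / n) \<le> ln (2 * y)" using n assms by (subst ln_le_cancel_iff) auto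
      also have "\<dots> = ln 2 + ln y" using assms by (subst ln_mult) auto
      finally have "ln (2 * y / n) / ln 2 \<le> (ln 2 + ln y) / ln 2" by (intro divide_right_mono) auto
      also have "\<dots> = 1 + (1 / ln 2) * ln y" by (simp add: field_simps)
      also have "\<dots> \<le> 1 + 3 / 2 * ln y"
        using assms by (intro add_left_mono mult_right_mono inverse_ln_2_le) auto
      finally show "real J \<le> 3 * ln y" using J(2) assms(3) by linarith
    qed (use assms in auto)
    finally show "(\<Sum>k\<in>?A. 1 / real k) \<le> 3 * ln y * \<sigma>" .
  qed auto
  finally show ?thesis .
qed

text \<open>For \<open>y0\<close>-smooth \<open>m = q - \<epsilon>\<close> the Euler product over primes up to \<open>y0\<close> suffices. Any other \<open>m\<close>
  has a prime factor \<open>k > y0\<close>; both \<open>k\<close> and \<open>d * k + \<epsilon>\<close> are prime (\<open>d = m div k\<close>), and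
  the sieve gains two logarithms.\<close>

lemma sum_shifted_smooth_primes_le:
  fixes Q :: "nat set" and X y0 y \<eta> \<sigma> G :: real and \<epsilon> :: int
  assumes \<epsilon>: "\<epsilon> = 1 \<or> \<epsilon> = -1" and "2 \<le> y0" "exp 1 \<le> y0" "y0 \<le> y" "4 \<le> ln y" "0 \<le> \<eta>" "\<eta> \<le> 1/4" "0 \<le> \<sigma>"
    and G: "(\<Sum>p\<in>primes_upto y. real p powr -(1 - \<eta>) - 1 / real p) \<le> G"
    and Q: "\<And>q. q \<in> Q \<Longrightarrow> prime q \<and> real q \<le> X"
    and smooth: "\<And>q p. q \<in> Q \<Longrightarrow> prime p \<Longrightarrow> int p dvd int q - \<epsilon> \<Longrightarrow> real p \<le> y"
    and sieve: "\<And>d K. d > 0 \<Longrightarrow> real d \<le> X + 1 \<Longrightarrow> real K \<ge> y0 / 2 \<Longrightarrow>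
      real (card {k \<in> {K..<K + K}. prime k \<and> prime (int d * int k + \<epsilon>)}) \<le> real K * \<sigma>"
  shows "(\<Sum>q\<in>Q. real q powr -(1 - \<eta>))
         \<le> 2 * (ln y0 * exp (G + 22) + ln y * exp (G + 22) * (y powr \<eta> * (3 * ln y * \<sigma>)))"
proof -
  define f where "f = (\<lambda>q::nat. nat (int q - \<epsilon>))"
  have finQ: "finite Q" using Q by (intro finite_subset[of Q "{..nat \<lfloor>X\<rfloor>}"]) (auto simp: le_nat_floor)
  have f: "int (f q) = int q - \<epsilon>" "f q > 0" "f q \<le> 2 * q" "real (f q) \<le> X + 1" if "q \<in> Q" for q
  proof -
    have "q \<ge> 2" "real q \<le> X" using Q[OF that] prime_ge_2_nat by auto
    thus "int (f q) = int q - \<epsilon>" "f q > 0" "f q \<le> 2 * q" "real (f q) \<le> X + 1" unfolding f_def using \<epsilon> by auto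
  qed
  have inj: "inj_on f Q" by (rule inj_onI) (metis f(1) diff_add_cancel of_nat_eq_iff)
  define M where "M = f ` Q"
  define MA where "MA = {m \<in> M. \<forall>p. prime p \<and> p dvd m \<longrightarrow> real p \<le> y0}"
  define MB where "MB = M - MA"
  have finM: "finite M" unfolding M_def using finQ by simp
  have Mpos: "m > 0" if "m \<in> M" for m using that f(2) unfolding M_def by auto
  have Msmooth: "real p \<le> y" if m: "m \<in> M" "prime p" "p dvd m" for m p
  proof -
    obtain q where q: "q \<in> Q" "m = f q" using m(1) unfolding M_def by blast
    have "int p dvd int q - \<epsilon>" using m q f(1)[OF q(1)] by (metis int_dvd_int_iff)
    thus ?thesis using smooth[OF q(1) m(2)] by simp
  qed
  have "\<exists>k. prime k \<and> k dvd m \<and> y0 < real k" if "m \<in> MB" for m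
    using that unfolding MB_def MA_def by (auto simp: not_le)
  then obtain h where h: "\<And>m. m \<in> MB \<Longrightarrow> prime (h m) \<and> h m dvd m \<and> y0 < real (h m)" by metis
  \<comment> \<open>Recording the quotient together with the chosen prime makes the map injective.
    One prime factor above \<open>y0\<close> is fixed for each \<open>m\<close>; the quotient is
    again \<open>y\<close>-smooth, so its sum is an Euler product.\<close>
  define g where "g = (\<lambda>m. (m div h m, h m))"
  define D where "D = (\<lambda>m. m div h m) ` MB"
  define Kd where "Kd = (\<lambda>d::nat. {k. prime k \<and> y0 < real k \<and> real k \<le> y \<and> prime (int d * int k + \<epsilon>)})"
  have MBM: "MB \<subseteq> M" unfolding MB_def by auto
  have finD: "finite D" unfolding D_def using finM MBM finite_subset by blast
  have finK: "finite (Kd d)" for d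
    unfolding Kd_def by (rule finite_subset[of _ "{..nat \<lfloor>y\<rfloor>}"]) (auto simp: le_nat_floor)
  have dec: "m = (m div h m) * h m" "h m > 0" "m div h m > 0" if "m \<in> MB" for m
  proof -
    show 1: "m = (m div h m) * h m" using h[OF that] by simp
    show "h m > 0" using h[OF that] prime_gt_0_nat by blast
    show "m div h m > 0" using 1 Mpos that MBM by (metis gr0I mult_0 subsetD)
  qed
  have D: "d > 0 \<and> real d \<le> X + 1 \<and> (\<forall>p. prime p \<and> p dvd d \<longrightarrow> real p \<le> y)" if d: "d \<in> D" for d
  proof -
    obtain m where m: "m \<in> MB" "d = m div h m" using d unfolding D_def by auto
    have dm: "d dvd m" using dec(1)[OF m(1)] m(2) by (metis dvd_triv_left)
    hence "d \<le> m" using Mpos m MBM by (intro dvd_imp_le) auto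
    moreover have "real m \<le> X + 1" using m MBM f(4) unfolding M_def by auto
    ultimately have "real d \<le> X + 1" by linarith
    moreover have "\<forall>p. prime p \<and> p dvd d \<longrightarrow> real p \<le> y" using dm m MBM Msmooth dvd_trans by blast
    ultimately show ?thesis using dec(3) m by auto
  qed
  \<comment> \<open>Passing from \<open>q\<close> to its shift \<open>f q \<le> 2 * q\<close> costs
    at most the factor 2.\<close>
  have "(\<Sum>q\<in>Q. real q powr -(1 - \<eta>)) \<le> (\<Sum>q\<in>Q. 2 * real (f q) powr -(1 - \<eta>))"
  proof (rule sum_mono)
    fix q assume q: "q \<in> Q"
    have q0: "real q > 0" using Q[OF q] prime_gt_0_nat by auto
    have "real (f q) \<le> 2 * real q" using f(3)[OF q] by (metis of_nat_le_iff of_nat_mult of_nat_numeral)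
    hence "(2 * real q) powr -(1 - \<eta>) \<le> real (f q) powr -(1 - \<eta>)"
      using f(2)[OF q] assms by (intro powr_mono2') auto
    hence "2 powr (1 - \<eta>) * ((2 * real q) powr -(1 - \<eta>)) \<le> 2 powr (1 - \<eta>) * real (f q) powr -(1 - \<eta>)"
      by (intro mult_left_mono) auto
    moreover have "2 powr (1 - \<eta>) * ((2 * real q) powr -(1 - \<eta>)) = real q powr -(1 - \<eta>)"
      by (simp add: powr_mult mult.assoc[symmetric] flip: powr_add)
    moreover have "2 powr (1 - \<eta>) * real (f q) powr -(1 - \<eta>) \<le> 2 * real (f q) powr -(1 - \<eta>)"
    proof (rule mult_right_mono)
      show "2 powr (1 - \<eta>) \<le> (2::real)" using powr_mono[of "1 - \<eta>" 1 "2::real"] assms by simp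
    qed auto
    ultimately show "real q powr -(1 - \<eta>) \<le> 2 * real (f q) powr -(1 - \<eta>)" by linarith
  qed
  also have "\<dots> = 2 * (\<Sum>m\<in>M. real m powr -(1 - \<eta>))"
    unfolding M_def using inj by (simp add: sum.reindex sum_distrib_left)
  also have "(\<Sum>m\<in>M. real m powr -(1 - \<eta>)) = (\<Sum>m\<in>MB. real m powr -(1 - \<eta>)) + (\<Sum>m\<in>MA. real m powr -(1 - \<eta>))"
    unfolding MB_def using finM by (intro sum.subset_diff) (auto simp: MA_def)
  also have "(\<Sum>m\<in>MA. real m powr -(1 - \<eta>)) \<le> ln y0 * exp (G + 22)"
  proof (rule sum_smooth_le)
    have "primes_upto y0 \<subseteq> primes_upto y" by (rule primes_upto_mono[OF assms(4)])
    hence "(\<Sum>p\<in>primes_upto y0. real p powr -(1 - \<eta>) - 1 / real p) \<le> (\<Sum>p\<in>primes_upto y. real p powr -(1 - \<eta>) - 1 / real p)"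
    proof (intro sum_mono2)
      fix p assume "p \<in> primes_upto y - primes_upto y0"
      hence p: "real p \<ge> 1" using prime_ge_1_nat unfolding primes_upto_def by force
      have "real p powr -1 \<le> real p powr -(1 - \<eta>)" using p assms by (intro powr_mono) auto
      thus "0 \<le> real p powr -(1 - \<eta>) - 1 / real p" using p by (simp add: powr_minus field_simps)
    qed auto
    thus "(\<Sum>p\<in>primes_upto y0. real p powr -(1 - \<eta>) - 1 / real p) \<le> G" using G by linarith
  qed (use assms Mpos finM in \<open>auto simp: MA_def\<close>)
  also have "(\<Sum>m\<in>MB. real m powr -(1 - \<eta>)) \<le> ln y * exp (G + 22) * (y powr \<eta> * (3 * ln y * \<sigma>))"
  proof -
    have injg: "inj_on g MB"
    proof (rule inj_onI)
      fix a b assume "a \<in> MB" "b \<in> MB" "g a = g b"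
      thus "a = b" using dec(1)[of a] dec(1)[of b] unfolding g_def by auto
    qed
    have "(\<Sum>m\<in>MB. real m powr -(1 - \<eta>)) = (\<Sum>m\<in>MB. (\<lambda>(d, k). real d powr -(1 - \<eta>) * real k powr -(1 - \<eta>)) (g m))"
    proof (rule sum.cong[OF refl])
      fix m assume m: "m \<in> MB"
      have "real m = real (m div h m) * real (h m)" using dec(1)[OF m] by (metis of_nat_mult)
      thus "real m powr -(1 - \<eta>) = (\<lambda>(d, k). real d powr -(1 - \<eta>) * real k powr -(1 - \<eta>)) (g m)"
        unfolding g_def by (simp add: powr_mult)
    qed
    also have "\<dots> = (\<Sum>u\<in>g ` MB. (\<lambda>(d, k). real d powr -(1 - \<eta>) * real k powr -(1 - \<eta>)) u)"
      using injg by (simp add: sum.reindex)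
    also have "\<dots> \<le> (\<Sum>u\<in>Sigma D Kd. (\<lambda>(d, k). real d powr -(1 - \<eta>) * real k powr -(1 - \<eta>)) u)"
    proof (rule sum_mono2)
      show "g ` MB \<subseteq> Sigma D Kd"
      proof
        fix u assume "u \<in> g ` MB"
        then obtain m where m: "m \<in> MB" "u = (m div h m, h m)" unfolding g_def by auto
        obtain q where q: "q \<in> Q" "m = f q" using m MBM unfolding M_def by auto
        have "int (m div h m) * int (h m) = int m" using dec(1)[OF m(1)] by (metis of_nat_mult)
        hence "int (m div h m) * int (h m) + \<epsilon> = int q" using f(1)[OF q(1)] q(2) by simp
        hence "prime (int (m div h m) * int (h m) + \<epsilon>)" using Q[OF q(1)] by simp
        moreover have "real (h m) \<le> y" using h m MBM Msmooth by blast
        ultimately show "u \<in> Sigma D Kd" using h[OF m(1)] m unfolding D_def Kd_def by auto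
      qed
    qed (use finD finK in auto)
    also have "\<dots> = (\<Sum>d\<in>D. real d powr -(1 - \<eta>) * (\<Sum>k\<in>Kd d. real k powr -(1 - \<eta>)))"
      using finD finK by (simp add: sum.Sigma[symmetric] sum_distrib_left)
    also have "\<dots> \<le> (\<Sum>d\<in>D. real d powr -(1 - \<eta>) * (y powr \<eta> * (3 * ln y * \<sigma>)))"
      unfolding Kd_def using D assms
      by (intro sum_mono mult_left_mono sum_shifted_prime_cofactor_le sieve) auto
    also have "\<dots> = (\<Sum>d\<in>D. real d powr -(1 - \<eta>)) * (y powr \<eta> * (3 * ln y * \<sigma>))"
      by (simp add: sum_distrib_right)
    also have "\<dots> \<le> ln y * exp (G + 22) * (y powr \<eta> * (3 * ln y * \<sigma>))"
      using D finD assms by (intro mult_right_mono sum_smooth_le mult_nonneg_nonneg) auto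
    finally show ?thesis .
  qed
  finally show ?thesis by simp
qed

text \<open>Logarithm of the smoothness bound \<open>y\<close> in terms of \<open>L = ln x\<close>. It is chosen such that
  \<open>sqrt y\<close> is the claimed saving times \<open>(ln x) ^ 3\<close>; the cube absorbs the
  logarithms from the harmonic sums.\<close>

definition cutoff :: "real \<Rightarrow> real" where
  "cutoff L = sqrt 2 * sqrt (L * ln (ln L)) + 6 * ln L"

text \<open>The left side is the bound of \<open>sum_primes_powr_diff\<close> for
  \<open>w = ln (ln L) + 2\<close>, \<open>\<tau> = 1 / sqrt w\<close> and
  \<open>ln y = cutoff L\<close>. Since \<open>exp w\<close> is a constant times
  \<open>ln L\<close>, it is \<open>o(ln L)\<close>; hence the factor \<open>exp G\<close> in the
  smooth sums is at most \<open>L powr 0.01\<close>.\<close>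

lemma eventually_small_prime_excess:
  "eventually (\<lambda>L. 5 * (ln (ln L) + 2) * exp ((ln (ln L) + 2) - (ln (ln L) + 2) * (1 / sqrt (ln (ln L) + 2)))
     + 24 * exp (ln (ln L) + 2) * (1 / sqrt (ln (ln L) + 2) + 1 / cutoff L) \<le> 0.01 * ln L) at_top"
  unfolding cutoff_def by real_asymp

text \<open>Contribution of the \<open>y0\<close>-smooth shifts, with
  \<open>ln y0 = cutoff L powr 0.8\<close>. As \<open>cutoff L\<close> is \<open>sqrt L\<close> up
  to smaller factors, it is about \<open>L powr 0.41\<close>.\<close>

lemma eventually_smooth_part:
  "eventually (\<lambda>L. 8 * exp 22 * (cutoff L powr 0.8 * L powr 0.01) \<le> L powr 0.45) at_top"
  unfolding cutoff_def by real_asymp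

text \<open>Contribution of the other shifts through the main term of the sieve, with
  \<open>ln z = cutoff L powr 0.7\<close>. The two factors \<open>cutoff L\<close> come from the
  sums over \<open>d\<close> and \<open>k\<close>; dividing by the square of \<open>ln z\<close>
  leaves \<open>cutoff L powr 0.6\<close>, in total about \<open>L powr 0.31\<close>.\<close>

lemma eventually_sieve_main:
  "eventually (\<lambda>L. 24 * exp 22 * (L powr 0.01 * exp (ln (ln L) + 2)) * ((cutoff L)\<^sup>2 *
     ((exp 46 * (ln (2 * L))\<^sup>2 + 1) / (cutoff L powr 0.7)\<^sup>2)) \<le> L powr 0.45) at_top"
  unfolding cutoff_def by real_asymp

text \<open>Rounding error of the sieve relative to a block of length at least
  \<open>y0 / 2\<close>. In the exponent, \<open>cutoff L powr 0.7\<close> times a logarithm loses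
  to \<open>cutoff L powr 0.8\<close>; this is why \<open>y0\<close> is chosen so much larger than
  \<open>z\<close>. The decay is proved in the variable \<open>u = cutoff L\<close> and transferred
  by composition.\<close>

lemma eventually_sieve_error:
  "eventually (\<lambda>L. 24 * exp 22 * (L powr 0.01 * exp (ln (ln L) + 2)) * ((cutoff L)\<^sup>2 *
     (2 * exp 2 * exp (cutoff L powr 0.7 * (8 * ln (cutoff L powr 0.7) + 62)) / exp (cutoff L powr 0.8))) \<le> L powr 0.45) at_top"
proof -
  have 1: "filterlim cutoff at_top at_top" unfolding cutoff_def by real_asymp
  have 2: "eventually (\<lambda>u. u\<^sup>2 * (2 * exp 2 * exp (u powr 0.7 * (8 * ln (u powr 0.7) + 62)) / exp (u powr 0.8)) \<le> (1::real)) at_top"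
    by real_asymp
  have 3: "eventually (\<lambda>L. 24 * exp 22 * (L powr 0.01 * exp (ln (ln L) + 2)) \<le> L powr (0.45::real)) at_top"
    by real_asymp
  from eventually_compose_filterlim[OF 2 1] 3 show ?thesis
  proof eventually_elim
    case (elim L)
    have "24 * exp 22 * (L powr 0.01 * exp (ln (ln L) + 2)) * ((cutoff L)\<^sup>2 *
     (2 * exp 2 * exp (cutoff L powr 0.7 * (8 * ln (cutoff L powr 0.7) + 62)) / exp (cutoff L powr 0.8)))
      \<le> 24 * exp 22 * (L powr 0.01 * exp (ln (ln L) + 2)) * 1"
      using elim(1) by (intro mult_left_mono) auto
    thus ?case using elim(2) by linarith
  qed
qed

text \<open>Here the constant \<open>1 / sqrt 2\<close> is decided. After multiplication by
  \<open>cutoff L\<close> the terms \<open>L * ln (ln L)\<close> cancel. What remains is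
  \<open>2 * L\<close>, from the summand 2 in Rankin's \<open>w\<close>, minus a term of order
  \<open>sqrt (L * ln (ln L)) * ln L\<close> due to the summand \<open>6 * ln L\<close> of the
  cutoff. So the surplus is of order \<open>sqrt (L / ln (ln L))\<close>, enough for the Euler
  product.\<close>

lemma eventually_rankin_gain:
  "eventually (\<lambda>L. 3 * L powr 0.45 \<le> (ln (ln L) + 2) * L / cutoff L - (1 / sqrt 2) * sqrt (L * ln (ln L))) at_top"
proof -
  have 1: "eventually (\<lambda>L. 3 * L powr 0.45 \<le> (2 * L - 3 * sqrt 2 * sqrt (L * ln (ln L)) * ln L) / cutoff L) at_top"
    unfolding cutoff_def by real_asymp
  have 2: "eventually (\<lambda>L. cutoff L > 0) at_top" unfolding cutoff_def by real_asymp
  have 3: "eventually (\<lambda>L. L * ln (ln L) \<ge> (0::real)) at_top" by real_asymp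
  show ?thesis using 1 2 3
  proof eventually_elim
    case (elim L)
    define s where "s = sqrt (L * ln (ln L))"
    have s: "s * s = L * ln (ln L)" unfolding s_def using elim(3) by simp
    have q: "sqrt 2 * sqrt 2 = (2::real)" by simp
    have "(1 / sqrt 2) * s * cutoff L = s * s + 6 * ln L * s / sqrt 2"
      unfolding cutoff_def s_def[symmetric] by (simp add: field_simps)
    also have "6 * ln L * s / sqrt 2 = 3 * sqrt 2 * s * ln L"
      using q by (simp add: divide_simps)
    finally have "(ln (ln L) + 2) * L - (1 / sqrt 2) * s * cutoff L = 2 * L - 3 * sqrt 2 * s * ln L"
      unfolding s by (simp add: algebra_simps)
    moreover have "(ln (ln L) + 2) * L / cutoff L - (1 / sqrt 2) * s
        = ((ln (ln L) + 2) * L - (1 / sqrt 2) * s * cutoff L) / cutoff L"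
      using elim(2) by (simp add: diff_divide_distrib)
    ultimately show ?case using elim(1) unfolding s_def[symmetric] by simp
  qed
qed

text \<open>The order of the scales: sieving starts at \<open>2 * L\<close>, a bound for
  \<open>ln d\<close>, and runs to \<open>z = exp (cutoff L powr 0.7)\<close>; the large prime
  factors of the shifts lie between \<open>y0 = exp (cutoff L powr 0.8)\<close> and
  \<open>y = exp (cutoff L)\<close>.\<close>

lemma eventually_parameters:
  "eventually (\<lambda>L. exp 1 \<le> 2 * L \<and> 2 * L \<le> exp (cutoff L powr 0.7)
    \<and> exp (cutoff L powr 0.7) + 1 < exp (cutoff L powr 0.8) / 2 \<and> 2 \<le> exp (cutoff L powr 0.8)
    \<and> exp 1 \<le> exp (cutoff L powr 0.8) \<and> exp (cutoff L powr 0.8) \<le> exp (cutoff L)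
    \<and> 4 \<le> cutoff L \<and> 4 \<le> ln (ln L) + 2 \<and> (ln (ln L) + 2) / cutoff L \<le> 1/4 \<and> 1 \<le> L) at_top"
  unfolding cutoff_def by (intro eventually_conj; real_asymp)

text \<open>Rankin's exponent is \<open>1 - w / cutoff L\<close> with \<open>w = ln (ln L) + 2\<close>: the main term \<open>ln (ln L)\<close>
  gives exactly the claimed saving, the summand 2 pays for the Euler product.\<close>

lemma card_shifted_smooth_le:
  fixes A :: real and \<epsilon> :: int
  assumes \<epsilon>: "\<epsilon> = 1 \<or> \<epsilon> = -1" and A: "A \<ge> 1"
  shows "eventually (\<lambda>x. real (card {n. n > 0 \<and> real n \<le> A * x \<and>
      (\<forall>q p. prime q \<longrightarrow> q dvd n \<longrightarrow> prime p \<longrightarrow> int p dvd int q - \<epsilon> \<longrightarrow> real p \<le> exp (cutoff (ln x)))})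
      \<le> A * (x * exp (- (1 / sqrt 2) * sqrt (ln x * ln (ln (ln x)))))) at_top"
proof -
  have ln: "filterlim (ln :: real \<Rightarrow> real) at_top at_top" by real_asymp
  have X: "eventually (\<lambda>x. ln (A * x + 1) \<le> 2 * ln x) at_top" using A by real_asymp
  have x1: "eventually (\<lambda>x::real. x > 1) at_top" by real_asymp
  show ?thesis
    using eventually_compose_filterlim[OF eventually_small_prime_excess ln]
      eventually_compose_filterlim[OF eventually_smooth_part ln]
      eventually_compose_filterlim[OF eventually_sieve_main ln]
      eventually_compose_filterlim[OF eventually_sieve_error ln]
      eventually_compose_filterlim[OF eventually_rankin_gain ln]
      eventually_compose_filterlim[OF eventually_parameters ln] X x1
  proof eventually_elim
    case (elim x)
    define L where "L = ln x"
    define Y where "Y = cutoff L"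
    define w where "w = ln (ln L) + 2"
    define \<eta> where "\<eta> = w / Y"
    define G where "G = 5 * w * exp (w - w * (1 / sqrt w)) + 24 * exp w * (1 / sqrt w + 1 / Y)"
    define E where "E = exp 2 * exp (Y powr 0.7 * (8 * ln (Y powr 0.7) + 62))"
    \<comment> \<open>\<open>\<sigma>1\<close> is the density in the main term of
      \<open>card_prime_pairs_le\<close> when sieving from \<open>2 * L\<close> to
      \<open>exp (Y powr 0.7)\<close>. \<open>\<sigma>2\<close> turns the additive error
      \<open>E\<close> into a density, using that \<open>K\<close> is at least
      \<open>exp (Y powr 0.8) / 2\<close>.\<close>
    define \<sigma>1 where "\<sigma>1 = (exp 46 * (ln (2 * L))\<^sup>2 + 1) / (Y powr 0.7)\<^sup>2"
    define \<sigma>2 where "\<sigma>2 = 2 * exp 2 * exp (Y powr 0.7 * (8 * ln (Y powr 0.7) + 62)) / exp (Y powr 0.8)"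
    note elim' = elim[folded L_def, folded Y_def, folded w_def, folded G_def \<eta>_def \<sigma>1_def \<sigma>2_def]
    have par: "exp 1 \<le> 2 * L" "2 * L \<le> exp (Y powr 0.7)" "exp (Y powr 0.7) + 1 < exp (Y powr 0.8) / 2"
      "2 \<le> exp (Y powr 0.8)" "exp 1 \<le> exp (Y powr 0.8)" "exp (Y powr 0.8) \<le> exp Y" "4 \<le> Y" "4 \<le> w" "\<eta> \<le> 1/4" "1 \<le> L"
      using elim'(6) by blast+
    have \<eta>0: "\<eta> \<ge> 0" unfolding \<eta>_def using par by simp
    have \<sigma>nn: "\<sigma>1 \<ge> 0" "\<sigma>2 \<ge> 0" unfolding \<sigma>1_def \<sigma>2_def by auto
    define S where "S = {n. n > 0 \<and> real n \<le> A * x \<and>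
      (\<forall>q p. prime q \<longrightarrow> q dvd n \<longrightarrow> prime p \<longrightarrow> int p dvd int q - \<epsilon> \<longrightarrow> real p \<le> exp Y)}"
    define Q where "Q = {q. prime q \<and> real q \<le> A * x \<and> (\<forall>p. prime p \<longrightarrow> int p dvd int q - \<epsilon> \<longrightarrow> real p \<le> exp Y)}"
    have finQ: "finite Q" unfolding Q_def by (rule finite_subset[of _ "primes_upto (A * x)"]) (auto simp: primes_upto_def[symmetric], auto simp: primes_upto_def)
    have "(\<Sum>q\<in>Q. real q powr -(1 - \<eta>))
         \<le> 2 * (ln (exp (Y powr 0.8)) * exp (G + 22) + ln (exp Y) * exp (G + 22) * (exp Y powr \<eta> * (3 * ln (exp Y) * (\<sigma>1 + \<sigma>2))))"
    proof (rule sum_shifted_smooth_primes_le[OF \<epsilon>, where X = "A * x"])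
      show "(\<Sum>p\<in>primes_upto (exp Y). real p powr -(1 - \<eta>) - 1 / real p) \<le> G"
      proof -
        have "2 \<le> sqrt w" using par(8) real_le_rsqrt[of 2 w] by simp
        hence "1 / sqrt w \<le> 1 / 2" using par(8) by (intro divide_left_mono) auto
        thus ?thesis unfolding G_def
          using sum_primes_powr_diff[of "exp Y" w \<eta> "1 / sqrt w"] par by (simp add: \<eta>_def)
      qed
      fix d K :: nat
      assume dK: "d > 0" "real d \<le> A * x + 1" "real K \<ge> exp (Y powr 0.8) / 2"
      have "ln (real d) \<le> ln (A * x + 1)" using dK by (subst ln_le_cancel_iff) auto
      hence "ln (real d) \<le> 2 * L" using elim'(7) by linarith
      hence "real (card {k \<in> {K..<K + K}. prime k \<and> prime (int d * int k + \<epsilon>)})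
         \<le> real K * ((exp 46 * (ln (2 * L))\<^sup>2 + 1) / (ln (exp (Y powr 0.7)))\<^sup>2)
           + exp 2 * exp (ln (exp (Y powr 0.7)) * (8 * ln (ln (exp (Y powr 0.7))) + 62))"
        using dK par \<epsilon> by (intro card_prime_pairs_le) auto
      also have "\<dots> = real K * \<sigma>1 + E" unfolding \<sigma>1_def E_def by simp
      also have "E = exp (Y powr 0.8) / 2 * \<sigma>2" unfolding \<sigma>2_def E_def by simp
      also have "\<dots> \<le> real K * \<sigma>2" using dK \<sigma>nn by (intro mult_right_mono) auto
      finally show "real (card {k \<in> {K..<K + K}. prime k \<and> prime (int d * int k + \<epsilon>)}) \<le> real K * (\<sigma>1 + \<sigma>2)"
        by (simp add: algebra_simps)
    qed (use par \<eta>0 \<sigma>nn in \<open>auto simp: Q_def\<close>)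
    also have "\<dots> = exp G * exp 22 * (2 * Y powr 0.8 + 6 * exp w * Y\<^sup>2 * (\<sigma>1 + \<sigma>2))"
    proof -
      have "exp Y powr \<eta> = exp w" unfolding \<eta>_def powr_def using par by simp
      thus ?thesis by (simp add: exp_add power2_eq_square algebra_simps)
    qed
    also have "\<dots> \<le> L powr 0.01 * exp 22 * (2 * Y powr 0.8 + 6 * exp w * Y\<^sup>2 * (\<sigma>1 + \<sigma>2))"
    proof (intro mult_right_mono)
      have "exp G \<le> exp (0.01 * ln L)" using elim'(1) by (simp only: exp_le_cancel_iff)
      thus "exp G \<le> L powr 0.01" using par by (simp add: powr_def)
    qed (use \<sigma>nn in auto)
    \<comment> \<open>Regrouped so that the three summands are the quantities of
      \<open>eventually_smooth_part\<close>, \<open>eventually_sieve_main\<close> and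
      \<open>eventually_sieve_error\<close>; the division by 4 compensates the factor 4 in
      \<open>rankin_bound\<close>.\<close>
    also have "\<dots> = (8 * exp 22 * (Y powr 0.8 * L powr 0.01) + 24 * exp 22 * (L powr 0.01 * exp w) * (Y\<^sup>2 * \<sigma>1)
        + 24 * exp 22 * (L powr 0.01 * exp w) * (Y\<^sup>2 * \<sigma>2)) / 4"
      by (simp add: algebra_simps)
    also have "\<dots> \<le> 3 * L powr 0.45 / 4" using elim'(2,3,4) by simp
    finally have sumQ: "4 * (\<Sum>q\<in>Q. real q powr -(1 - \<eta>)) \<le> 3 * L powr 0.45" by simp
    have "real (card S) \<le> (A * x) powr (1 - \<eta>) * exp (4 * (\<Sum>q\<in>Q. real q powr -(1 - \<eta>)))"
    proof (rule rankin_bound[OF finQ _ \<eta>0 par(9)])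
      fix n q assume n: "n \<in> S" "prime q" "q dvd n"
      have "q \<le> n" using n unfolding S_def by (auto intro: dvd_imp_le)
      hence "real q \<le> A * x" using n unfolding S_def by auto
      thus "q \<in> Q" using n unfolding S_def Q_def by blast
    qed (auto simp: S_def Q_def)
    also have "\<dots> \<le> (A * (x * exp (- (\<eta> * L)))) * exp (3 * L powr 0.45)"
    proof (intro mult_mono)
      have "(A * x) powr (1 - \<eta>) = A powr (1 - \<eta>) * x powr (1 - \<eta>)" by (rule powr_mult)
      also have "\<dots> \<le> A powr 1 * x powr (1 - \<eta>)" using A \<eta>0 by (intro mult_right_mono powr_mono) auto
      also have "x powr (1 - \<eta>) = x * exp (- (\<eta> * L))"
        unfolding powr_diff using elim'(8) by (simp add: L_def powr_def exp_minus field_simps)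
      finally show "(A * x) powr (1 - \<eta>) \<le> A * (x * exp (- (\<eta> * L)))" using A by simp
    qed (use sumQ A elim'(8) in auto)
    also have "\<dots> = A * (x * exp (3 * L powr 0.45 - w * L / Y))"
      unfolding \<eta>_def by (simp add: exp_diff exp_minus field_simps)
    also have "\<dots> \<le> A * (x * exp (- (1 / sqrt 2) * sqrt (L * ln (ln L))))"
    proof (intro mult_left_mono)
      have "3 * L powr 0.45 - w * L / Y \<le> - ((1 / sqrt 2) * sqrt (L * ln (ln L)))"
        using elim'(5) by linarith
      thus "exp (3 * L powr 0.45 - w * L / Y) \<le> exp (- (1 / sqrt 2) * sqrt (L * ln (ln L)))" by simp
    qed (use A elim'(8) in auto)
    finally show ?case unfolding S_def Y_def L_def .
  qed
qed

subsection \<open>Counting the remaining solutions\<close>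

lemma sum_inverse_le_ln:
  assumes "N > 0"
  shows "(\<Sum>n=1..N. 1 / real n) \<le> 1 + ln (real N)"
proof -
  obtain M where M: "N = Suc M" using assms by (cases N) auto
  have "harm (Suc M) - ln (real (Suc M)) \<le> harm (Suc 0) - ln (real (Suc 0))"
    using decseq_harm_diff_ln decseqD le0 by blast
  thus ?thesis unfolding M harm_def by (simp add: inverse_eq_divide)
qed

lemma sum_inverse_subset_le_ln:
  fixes B :: "nat set" and X :: real
  assumes "X \<ge> 1" "\<And>n. n \<in> B \<Longrightarrow> n > 0 \<and> real n \<le> X"
  shows "(\<Sum>n\<in>B. 1 / real n) \<le> 1 + ln X"
proof -
  let ?N = "nat \<lfloor>X\<rfloor>"
  have N: "?N > 0" "real ?N \<le> X" using assms(1) by linarith+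
  have "(\<Sum>n\<in>B. 1 / real n) \<le> (\<Sum>n=1..?N. 1 / real n)"
    using assms(2) by (intro sum_mono2) (auto simp: le_nat_floor Suc_le_eq)
  also have "\<dots> \<le> 1 + ln (real ?N)" by (rule sum_inverse_le_ln[OF N(1)])
  also have "\<dots> \<le> 1 + ln X" using N by simp
  finally show ?thesis .
qed

lemma card_multiples_le:
  fixes c :: nat and X :: real
  assumes "c > 0" "X \<ge> 0"
  shows "real (card {m. 0 < m \<and> real m \<le> X \<and> c dvd m}) \<le> X / real c"
proof -
  have "{m. 0 < m \<and> real m \<le> X \<and> c dvd m} \<subseteq> (\<lambda>k. c * k) ` {1..nat \<lfloor>X / c\<rfloor>}"
  proof
    fix m assume "m \<in> {m. 0 < m \<and> real m \<le> X \<and> c dvd m}"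
    then obtain k where k: "m = c * k" "0 < m" "real m \<le> X" by auto
    have "real k \<le> X / c" using k assms by (simp add: field_simps)
    thus "m \<in> (\<lambda>k. c * k) ` {1..nat \<lfloor>X / c\<rfloor>}" using k by (auto simp: le_nat_floor Suc_le_eq)
  qed
  hence "card {m. 0 < m \<and> real m \<le> X \<and> c dvd m} \<le> card {1..nat \<lfloor>X / c\<rfloor>}"
    by (rule surj_card_le[rotated]) simp
  also have "\<dots> = nat \<lfloor>X / c\<rfloor>" by simp
  finally have "real (card {m. 0 < m \<and> real m \<le> X \<and> c dvd m}) \<le> real (nat \<lfloor>X / c\<rfloor>)" by (rule of_nat_mono)
  also have "\<dots> \<le> X / c" using assms by (intro of_nat_floor) auto
  finally show ?thesis .
qed

definition large_proper_power :: "real \<Rightarrow> nat \<Rightarrow> bool" where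
  "large_proper_power t m \<longleftrightarrow> (\<exists>q e. prime q \<and> e \<ge> 2 \<and> q ^ e dvd m \<and> real (q ^ e) > t)"

text \<open>Of the two square roots whose product is \<open>q ^ e\<close>, one is bounded below by
  \<open>sqrt t\<close> and the other is kept for summation. Since \<open>e \<ge> 2\<close>, the
  geometric series in \<open>1 / sqrt q\<close> is at most \<open>4 / q\<close>, so the sum over
  \<open>q\<close> is only logarithmic.\<close>

lemma card_large_proper_power_le:
  fixes X t :: real
  assumes "X \<ge> 1" "t > 0"
  shows "real (card {m. 0 < m \<and> real m \<le> X \<and> large_proper_power t m}) \<le> X / sqrt t * (4 * (1 + ln X))"
proof -
  define N where "N = nat \<lfloor>X\<rfloor>"
  define I where "I = {(q, e). q \<in> {2..N} \<and> e \<in> {2..N} \<and> real (q ^ e) > t}"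
  define M where "M = (\<lambda>c::nat. {m. 0 < m \<and> real m \<le> X \<and> c dvd m})"
  have finM: "finite (M c)" for c
    unfolding M_def by (rule finite_subset[of _ "{..N}"]) (auto simp: N_def le_nat_floor)
  have finI: "finite I" unfolding I_def by (rule finite_subset[of _ "{2..N} \<times> {2..N}"]) auto
  have "{m. 0 < m \<and> real m \<le> X \<and> large_proper_power t m} \<subseteq> (\<Union>(q, e)\<in>I. M (q ^ e))"
  proof
    fix m assume m: "m \<in> {m. 0 < m \<and> real m \<le> X \<and> large_proper_power t m}"
    then obtain q e where q: "prime q" "e \<ge> 2" "q ^ e dvd m" "real (q ^ e) > t"
      unfolding large_proper_power_def by blast
    have "q ^ e \<le> m" using q m by (auto intro: dvd_imp_le)
    moreover have "m \<le> N" using m unfolding N_def by (auto simp: le_nat_floor)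
    moreover have "q \<ge> 2" using q prime_ge_2_nat by blast
    moreover have "q \<le> q ^ e" using q prime_gt_0_nat by (intro self_le_power) (auto simp: Suc_le_eq)
    moreover have "e < q ^ e" using \<open>q \<ge> 2\<close> by (intro power_gt_expt) simp
    ultimately have "(q, e) \<in> I" using q unfolding I_def by auto
    moreover have "m \<in> M (q ^ e)" using m q unfolding M_def by auto
    ultimately show "m \<in> (\<Union>(q, e)\<in>I. M (q ^ e))" by blast
  qed
  hence "card {m. 0 < m \<and> real m \<le> X \<and> large_proper_power t m} \<le> card (\<Union>(q, e)\<in>I. M (q ^ e))"
    using finM finI by (intro card_mono) auto
  also have "\<dots> \<le> (\<Sum>(q, e)\<in>I. card (M (q ^ e)))"
    using card_UN_le[OF finI, of "\<lambda>(q, e). M (q ^ e)"] by (simp add: case_prod_beta)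
  finally have "real (card {m. 0 < m \<and> real m \<le> X \<and> large_proper_power t m}) \<le> real (\<Sum>(q, e)\<in>I. card (M (q ^ e)))"
    by (rule of_nat_mono)
  also have "\<dots> = (\<Sum>(q, e)\<in>I. real (card (M (q ^ e))))" by (simp add: case_prod_beta)
  also have "\<dots> \<le> (\<Sum>(q, e)\<in>I. X / sqrt t * (1 / sqrt (real q)) ^ e)"
  proof (rule sum_mono, clarify)
    fix q e assume "(q, e) \<in> I"
    hence q: "q \<ge> 2" "real (q ^ e) > t" unfolding I_def by auto
    have "real (card (M (q ^ e))) \<le> X / real (q ^ e)"
      unfolding M_def using q assms by (intro card_multiples_le) auto
    also have "\<dots> = X / (sqrt (real (q ^ e)) * sqrt (real (q ^ e)))" by simp
    also have "\<dots> \<le> X / (sqrt t * sqrt (real (q ^ e)))"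
      using q assms by (intro divide_left_mono mult_right_mono mult_pos_pos) (auto simp del: of_nat_power)
    also have "\<dots> = X / sqrt t * (1 / sqrt (real q)) ^ e" by (simp add: real_sqrt_power power_divide)
    finally show "real (card (M (q ^ e))) \<le> X / sqrt t * (1 / sqrt (real q)) ^ e" .
  qed
  also have "\<dots> \<le> (\<Sum>(q, e)\<in>{2..N} \<times> {2..N}. X / sqrt t * (1 / sqrt (real q)) ^ e)"
    using assms by (intro sum_mono2) (auto simp: I_def)
  also have "\<dots> = X / sqrt t * (\<Sum>q\<in>{2..N}. \<Sum>e\<in>{2..N}. (1 / sqrt (real q)) ^ e)"
    by (simp add: sum.cartesian_product[symmetric] sum_distrib_left)
  also have "\<dots> \<le> X / sqrt t * (\<Sum>q\<in>{2..N}. 4 * (1 / real q))"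
  proof (intro mult_left_mono sum_mono)
    fix q assume q: "q \<in> {2..N}"
    define r where "r = 1 / sqrt (real q)"
    have r2: "r ^ 2 = 1 / real q" unfolding r_def using q by (simp add: power_divide)
    have "r ^ 2 \<le> 1 / 2" unfolding r2 using q by simp
    also have "\<dots> \<le> (3/4) ^ 2" by (simp add: power2_eq_square)
    finally have r: "0 < r" "r \<le> 3/4" using q power_le_imp_le_base[of r 1 "3/4"] unfolding r_def by (auto simp: numeral_2_eq_2)
    have "(\<Sum>e\<in>{2..N}. r ^ e) = (\<Sum>e\<in>{2..<2 + (N - 1)}. r ^ e)" using q by (intro sum.cong) auto
    also have "\<dots> = (\<Sum>e<N - 1. r ^ (e + 2))"
      using sum.shift_bounds_nat_ivl[of "\<lambda>e. r ^ e" 0 2 "N - 1"]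
      by (simp only: atLeast0LessThan add_0_left add.commute)
    also have "\<dots> = r ^ 2 * (\<Sum>e<N - 1. r ^ e)" by (simp add: sum_distrib_left power2_eq_square mult_ac)
    also have "(\<Sum>e<N - 1. r ^ e) \<le> 4"
    proof -
      have "(\<Sum>e<N - 1. r ^ e) = (1 - r ^ (N - 1)) / (1 - r)" using r by (simp add: sum_gp_strict)
      also have "\<dots> \<le> 1 / (1 - r)" using r by (intro divide_right_mono) auto
      also have "\<dots> \<le> 4" using r by (simp add: field_simps)
      finally show ?thesis .
    qed
    finally have "(\<Sum>e\<in>{2..N}. r ^ e) \<le> r ^ 2 * 4" using r by (simp add: mult_left_mono)
    thus "(\<Sum>e\<in>{2..N}. (1 / sqrt (real q)) ^ e) \<le> 4 * (1 / real q)" unfolding r2 r_def[symmetric] by simp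
  qed (use assms in auto)
  also have "\<dots> = X / sqrt t * (4 * (\<Sum>q\<in>{2..N}. 1 / real q))" by (simp add: sum_distrib_left)
  also have "\<dots> \<le> X / sqrt t * (4 * (1 + ln X))"
    using assms by (intro mult_left_mono sum_inverse_subset_le_ln) (auto simp: N_def le_nat_iff le_floor_iff)
  finally show ?thesis .
qed

text \<open>The sum is extended to all integers \<open>\<epsilon> + p * j\<close> in the class: the
  saving \<open>1 / p\<close> is all that is wanted. Here \<open>j\<close> is at most
  \<open>X + 1\<close>, and \<open>p * j \<le> 2 * q\<close> gives the factor 2.\<close>

lemma sum_inverse_primes_shifted_le:
  fixes X :: real and \<epsilon> :: int and p :: nat
  assumes "\<epsilon> = 1 \<or> \<epsilon> = -1" "p \<ge> 2" "X \<ge> 1"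
  shows "(\<Sum>q | prime q \<and> real q \<le> X \<and> int p dvd int q - \<epsilon>. 1 / real q) \<le> 2 / real p * (1 + ln (X + 1))"
proof -
  let ?B = "{q. prime q \<and> real q \<le> X \<and> int p dvd int q - \<epsilon>}"
  define g where "g = (\<lambda>q::nat. nat ((int q - \<epsilon>) div int p))"
  have g: "int q - \<epsilon> = int p * int (g q)" "g q > 0" "real (g q) \<le> X + 1" "1 / real q \<le> 2 / real p * (1 / real (g q))"
    if q: "q \<in> ?B" for q
  proof -
    have q2: "q \<ge> 2" using q prime_ge_2_nat by auto
    have "(int q - \<epsilon>) div int p \<ge> 0" using q2 assms by (intro pos_imp_zdiv_nonneg_iff[THEN iffD2]) auto
    thus 1: "int q - \<epsilon> = int p * int (g q)" unfolding g_def using q by auto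
    have "int q - \<epsilon> > 0" using q2 assms by auto
    thus 2: "g q > 0" using 1 by (auto intro!: Nat.gr0I)
    have "int (g q) \<le> int p * int (g q)" using assms 2 by simp
    hence "int (g q) \<le> int q + 1" using 1 assms by auto
    moreover have "real q \<le> X" using q by auto
    ultimately show "real (g q) \<le> X + 1" by linarith
    have "int p * int (g q) \<le> 2 * int q" using 1 q2 assms by auto
    hence "int (p * g q) \<le> int (2 * q)" by simp
    hence "p * g q \<le> 2 * q" by (simp only: of_nat_le_iff)
    hence "real (p * g q) \<le> real (2 * q)" by (simp only: of_nat_le_iff)
    hence "real p * real (g q) \<le> 2 * real q" by simp
    thus "1 / real q \<le> 2 / real p * (1 / real (g q))" using assms 2 q2 by (simp add: field_simps)
  qed
  have inj: "inj_on g ?B"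
  proof (rule inj_onI)
    fix u v assume "u \<in> ?B" "v \<in> ?B" "g u = g v"
    hence "int u - \<epsilon> = int v - \<epsilon>" using g(1)[of u] g(1)[of v] by simp
    thus "u = v" by simp
  qed
  have "(\<Sum>q\<in>?B. 1 / real q) \<le> (\<Sum>q\<in>?B. 2 / real p * (1 / real (g q)))" by (intro sum_mono g(4))
  also have "\<dots> = 2 / real p * (\<Sum>j\<in>g ` ?B. 1 / real j)" using inj by (simp add: sum.reindex sum_distrib_left)
  also have "\<dots> \<le> 2 / real p * (1 + ln (X + 1))"
    using assms g by (intro mult_left_mono sum_inverse_subset_le_ln) auto
  finally show ?thesis .
qed

lemma card_pairs_product_le:
  fixes U X :: real
  assumes "X \<ge> 1" "U \<ge> 0"
  shows "real (card {(m1, m2). 0 < m1 \<and> 0 < m2 \<and> real m1 \<le> X \<and> real m1 * real m2 \<le> U}) \<le> U * (1 + ln X)"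
    and "finite {(m1 :: nat, m2 :: nat). 0 < m1 \<and> 0 < m2 \<and> real m1 \<le> X \<and> real m1 * real m2 \<le> U}"
proof -
  define N where "N = nat \<lfloor>X\<rfloor>"
  let ?P = "{(m1, m2). 0 < m1 \<and> 0 < m2 \<and> real m1 \<le> X \<and> real m1 * real m2 \<le> U}"
  have sub: "?P \<subseteq> (SIGMA m1:{1..N}. {1..nat \<lfloor>U / m1\<rfloor>})"
  proof clarify
    fix m1 m2 :: nat assume m: "0 < m1" "0 < m2" "real m1 \<le> X" "real m1 * real m2 \<le> U"
    have "real m2 \<le> U / real m1" using m by (simp add: field_simps)
    thus "m1 \<in> {1..N} \<and> m2 \<in> {1..nat \<lfloor>U / m1\<rfloor>}" using m by (auto simp: N_def le_nat_floor)
  qed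
  have fin: "finite (SIGMA m1:{1..N}. {1..nat \<lfloor>U / m1\<rfloor>})" by auto
  show "finite ?P" using sub fin by (rule finite_subset)
  have "real (card ?P) \<le> real (card (SIGMA m1:{1..N}. {1..nat \<lfloor>U / m1\<rfloor>}))"
    using sub fin by (intro of_nat_mono card_mono)
  also have "\<dots> = (\<Sum>m1\<in>{1..N}. real (nat \<lfloor>U / m1\<rfloor>))" by simp
  also have "\<dots> \<le> (\<Sum>m1\<in>{1..N}. U * (1 / real m1))"
    using assms by (intro sum_mono) (simp add: of_nat_floor)
  also have "\<dots> = U * (\<Sum>m1\<in>{1..N}. 1 / real m1)" by (simp add: sum_distrib_left)
  also have "\<dots> \<le> U * (1 + ln X)"
    using assms by (intro mult_left_mono sum_inverse_subset_le_ln) (auto simp: N_def le_nat_iff le_floor_iff)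
  finally show "real (card ?P) \<le> U * (1 + ln X)" .
qed

text \<open>Differences from one fixed solution \<open>n0\<close> are divisible by \<open>q1\<close>
  and \<open>q2\<close>, so all solutions lie in one class modulo \<open>q1 * q2\<close>, and no
  inverses of \<open>a1\<close> and \<open>a2\<close> have to be computed.\<close>

lemma card_linear_congruences_le:
  fixes a1 b1 a2 b2 :: int and q1 q2 :: nat and x :: real
  assumes "prime q1" "prime q2" "q1 \<noteq> q2" "\<not> int q1 dvd a1" "\<not> int q2 dvd a2" "x \<ge> 0"
  shows "real (card {n. 0 < n \<and> real n \<le> x \<and> int q1 dvd a1 * int n + b1 \<and> int q2 dvd a2 * int n + b2})
         \<le> x / (real q1 * real q2) + 1"
proof -
  let ?T = "{n. 0 < n \<and> real n \<le> x \<and> int q1 dvd a1 * int n + b1 \<and> int q2 dvd a2 * int n + b2}"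
  define K where "K = nat \<lfloor>x\<rfloor>"
  have K: "real K \<le> x" unfolding K_def using assms by simp
  have q0: "q1 > 0" "q2 > 0" using assms prime_gt_0_nat by auto
  show ?thesis
  proof (cases "?T = {}")
    case True
    show ?thesis unfolding True using assms by simp
  next
    case False
    then obtain n0 where n0: "n0 \<in> ?T" by blast
    have cong: "[n = n0] (mod q1 * q2)" if n: "n \<in> ?T" for n
    proof -
      have aux: "int q dvd int n - int n0" if "prime q" "\<not> int q dvd a" "int q dvd a * int n + b" "int q dvd a * int n0 + b" for q a b
      proof -
        have "int q dvd (a * int n + b) - (a * int n0 + b)" using that by (intro dvd_diff)
        hence "int q dvd a * (int n - int n0)" by (simp add: algebra_simps)
        thus ?thesis using that by (simp add: prime_dvd_mult_iff)
      qed
      have "coprime (int q1) (int q2)" using assms by (simp add: primes_coprime)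
      moreover have "int q1 dvd int n - int n0" "int q2 dvd int n - int n0"
        using aux[of q1 a1 b1] aux[of q2 a2 b2] n n0 assms by auto
      ultimately have "int q1 * int q2 dvd int n - int n0" by (intro divides_mult)
      hence "[int n = int n0] (mod int (q1 * q2))" by (simp add: cong_iff_dvd_diff)
      thus ?thesis by (simp only: cong_int_iff)
    qed
    have "?T \<subseteq> {k \<in> {1..<1 + K}. [k = n0] (mod q1 * q2)}"
      using cong unfolding K_def by (auto simp: le_nat_floor less_Suc_eq_le)
    hence "real (card ?T) \<le> real (card {k \<in> {1..<1 + K}. [k = n0] (mod q1 * q2)})"
      by (intro of_nat_mono card_mono) auto
    also have "\<dots> \<le> real K / real (q1 * q2) + 1"
      using card_residue_interval[of "q1 * q2" 1 K n0] q0 by (simp add: abs_le_iff)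
    also have "\<dots> \<le> x / (real q1 * real q2) + 1" using K by (simp add: divide_right_mono)
    finally show ?thesis .
  qed
qed

text \<open>For \<open>q1 * q2 \<le> U\<close> the rounding term 1 in the count of residues is at
  most \<open>U / (q1 * q2)\<close>. The sums over \<open>q1\<close> and \<open>q2\<close> each gain
  \<open>1 / p\<close> at the price of a logarithm; one gain yields \<open>1 / y\<close>, the other
  is summed over \<open>p\<close> and produces the third logarithm. As \<open>q1\<close> and
  \<open>q2\<close> are at least \<open>p - 1 > y - 1\<close>, they cannot divide \<open>a1\<close>
  or \<open>a2\<close>.\<close>

lemma card_common_shift_le:
  fixes a1 b1 a2 b2 \<epsilon> :: int and x X y U :: real
  assumes \<epsilon>: "\<epsilon> = 1 \<or> \<epsilon> = -1" and a: "a1 > 0" "a2 > 0" "real_of_int a1 < y - 1" "real_of_int a2 < y - 1"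
    and "1 \<le> x" "x \<le> U" "1 \<le> X" "y \<ge> 2"
  shows "real (card {n. 0 < n \<and> real n \<le> x \<and> (\<exists>p q1 q2. prime p \<and> real p > y \<and> prime q1 \<and> prime q2 \<and> q1 \<noteq> q2
           \<and> real q1 \<le> X \<and> real q2 \<le> X \<and> int p dvd int q1 - \<epsilon> \<and> int p dvd int q2 - \<epsilon>
           \<and> int q1 dvd a1 * int n + b1 \<and> int q2 dvd a2 * int n + b2 \<and> real q1 * real q2 \<le> U)})
         \<le> 8 * U / y * (1 + ln (X + 1)) ^ 3"
proof -
  let ?H = "1 + ln (X + 1)"
  define B where "B = (\<lambda>p::nat. {q. prime q \<and> real q \<le> X \<and> int p dvd int q - \<epsilon>})"
  define T where "T = (\<lambda>(q1::nat, q2::nat). {n. 0 < n \<and> real n \<le> x \<and> int q1 dvd a1 * int n + b1 \<and> int q2 dvd a2 * int n + b2})"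
  define P where "P = {p. prime p \<and> y < real p \<and> real p \<le> X + 1}"
  define I where "I = (\<lambda>p. {(q1, q2). q1 \<in> B p \<and> q2 \<in> B p \<and> q1 \<noteq> q2 \<and> real q1 * real q2 \<le> U})"
  have finB: "finite (B p)" for p
    unfolding B_def by (rule finite_subset[of _ "{..nat \<lfloor>X\<rfloor>}"]) (auto simp: le_nat_floor)
  have "P \<subseteq> primes_upto (X + 1)" unfolding P_def primes_upto_def by auto
  hence finP: "finite P" using finite_primes_upto finite_subset by blast
  have IB: "I p \<subseteq> B p \<times> B p" for p unfolding I_def by auto
  have finI: "finite (I p)" for p using finite_subset[OF IB] finB by blast
  have finT: "finite (T u)" for u
    unfolding T_def by (rule finite_subset[of _ "{..nat \<lfloor>x\<rfloor>}"]) (auto simp: le_nat_floor split: prod.splits)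
  have big: "real p - 1 \<le> real q" "real p \<le> X + 1" if "prime p" "q \<in> B p" for p q
  proof -
    have q2: "q \<ge> 2" and qX: "real q \<le> X" using that prime_ge_2_nat unfolding B_def by auto
    have "int p \<le> int q - \<epsilon>" using that q2 \<epsilon> unfolding B_def by (intro zdvd_imp_le) auto
    hence "int p - 1 \<le> int q" "int p \<le> int q + 1" using \<epsilon> by auto
    thus "real p - 1 \<le> real q" "real p \<le> X + 1" using qX by linarith+
  qed
  let ?A = "{n. 0 < n \<and> real n \<le> x \<and> (\<exists>p q1 q2. prime p \<and> real p > y \<and> prime q1 \<and> prime q2 \<and> q1 \<noteq> q2
           \<and> real q1 \<le> X \<and> real q2 \<le> X \<and> int p dvd int q1 - \<epsilon> \<and> int p dvd int q2 - \<epsilon>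
           \<and> int q1 dvd a1 * int n + b1 \<and> int q2 dvd a2 * int n + b2 \<and> real q1 * real q2 \<le> U)}"
  have "?A \<subseteq> (\<Union>p\<in>P. \<Union>u\<in>I p. T u)"
  proof
    fix n assume "n \<in> ?A"
    then obtain p q1 q2 where *: "0 < n" "real n \<le> x" "prime p" "real p > y" "prime q1" "prime q2" "q1 \<noteq> q2"
       "real q1 \<le> X" "real q2 \<le> X" "int p dvd int q1 - \<epsilon>" "int p dvd int q2 - \<epsilon>"
       "int q1 dvd a1 * int n + b1" "int q2 dvd a2 * int n + b2" "real q1 * real q2 \<le> U" by blast
    have B: "q1 \<in> B p" "q2 \<in> B p" using * unfolding B_def by auto
    hence "p \<in> P" using * big(2) unfolding P_def by auto
    moreover have "(q1, q2) \<in> I p" using B * unfolding I_def by auto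
    moreover have "n \<in> T (q1, q2)" using * unfolding T_def by auto
    ultimately show "n \<in> (\<Union>p\<in>P. \<Union>u\<in>I p. T u)" by blast
  qed
  hence "card ?A \<le> card (\<Union>p\<in>P. \<Union>u\<in>I p. T u)" using finP finI finT by (intro card_mono) auto
  also have "\<dots> \<le> (\<Sum>p\<in>P. card (\<Union>u\<in>I p. T u))" by (rule card_UN_le[OF finP])
  also have "\<dots> \<le> (\<Sum>p\<in>P. \<Sum>u\<in>I p. card (T u))" by (intro sum_mono card_UN_le finI)
  finally have "real (card ?A) \<le> real (\<Sum>p\<in>P. \<Sum>u\<in>I p. card (T u))" by (rule of_nat_mono)
  also have "\<dots> = (\<Sum>p\<in>P. \<Sum>u\<in>I p. real (card (T u)))" by simp
  also have "\<dots> \<le> (\<Sum>p\<in>P. 8 * U * ?H\<^sup>2 / y * (1 / real p))"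
  proof (rule sum_mono)
    fix p assume p: "p \<in> P"
    have pp: "prime p" "real p > y" "p \<ge> 2" using p prime_ge_2_nat unfolding P_def by auto
    have "(\<Sum>u\<in>I p. real (card (T u))) \<le> (\<Sum>u\<in>I p. 2 * U * (1 / real (fst u) * (1 / real (snd u))))"
    proof (rule sum_mono)
      fix u assume u: "u \<in> I p"
      obtain q1 q2 where uq: "u = (q1, q2)" by (cases u)
      have q: "prime q1" "prime q2" "q1 \<noteq> q2" "q1 \<in> B p" "q2 \<in> B p" "real q1 * real q2 \<le> U"
        using u unfolding uq I_def B_def by auto
      have q0: "real q1 * real q2 > 0" using q prime_gt_0_nat by auto
      have nd: "\<not> int q dvd a" if "q \<in> B p" "a > 0" "real_of_int a < y - 1" for q a
      proof
        assume "int q dvd a"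
        hence "int q \<le> a" using that by (intro zdvd_imp_le)
        thus False using big(1)[OF pp(1) that(1)] pp(2) that(3) by linarith
      qed
      have "real (card (T u)) \<le> x / (real q1 * real q2) + 1"
        unfolding uq T_def prod.case using q a assms(6) nd by (intro card_linear_congruences_le) auto
      also have "\<dots> \<le> U / (real q1 * real q2) + U / (real q1 * real q2)"
        using q q0 assms(7) by (intro add_mono divide_right_mono) (auto simp: field_simps)
      finally show "real (card (T u)) \<le> 2 * U * (1 / real (fst u) * (1 / real (snd u)))" unfolding uq by simp
    qed
    also have "\<dots> \<le> (\<Sum>u\<in>B p \<times> B p. 2 * U * (1 / real (fst u) * (1 / real (snd u))))"
      using assms(6,7) finB IB by (intro sum_mono2) auto
    also have "\<dots> = 2 * U * ((\<Sum>q\<in>B p. 1 / real q) * (\<Sum>q\<in>B p. 1 / real q))"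
    proof -
      have "(\<Sum>q\<in>B p. 1 / real q) * (\<Sum>q\<in>B p. 1 / real q) = (\<Sum>u\<in>B p \<times> B p. 1 / real (fst u) * (1 / real (snd u)))"
        by (subst sum_product, subst sum.cartesian_product) (rule sum.cong[OF refl], simp add: case_prod_beta)
      thus ?thesis by (simp only: sum_distrib_left)
    qed
    also have "\<dots> \<le> 2 * U * ((2 / real p * ?H) * (2 / real p * ?H))"
    proof -
      have b: "(\<Sum>q\<in>B p. 1 / real q) \<le> 2 / real p * ?H"
        using sum_inverse_primes_shifted_le[OF \<epsilon> pp(3) assms(8)] unfolding B_def .
      have "0 \<le> (\<Sum>q\<in>B p. 1 / real q)" by (rule sum_nonneg) simp
      thus ?thesis using b assms(6,7) by (intro mult_left_mono mult_mono) linarith+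
    qed
    also have "\<dots> = 8 * U * ?H\<^sup>2 * (1 / real p) * (1 / real p)"
      by (simp only: power2_eq_square times_divide_eq_left times_divide_eq_right mult_1 mult_1_right mult_ac)
    also have "\<dots> \<le> 8 * U * ?H\<^sup>2 * (1 / y) * (1 / real p)"
      using pp assms by (intro mult_right_mono mult_left_mono divide_left_mono) auto
    finally show "(\<Sum>u\<in>I p. real (card (T u))) \<le> 8 * U * ?H\<^sup>2 / y * (1 / real p)" by simp
  qed
  also have "\<dots> = 8 * U * ?H\<^sup>2 / y * (\<Sum>p\<in>P. 1 / real p)" by (simp add: sum_distrib_left)
  also have "\<dots> \<le> 8 * U * ?H\<^sup>2 / y * ?H"
    using assms by (intro mult_left_mono sum_inverse_subset_le_ln) (auto simp: P_def prime_gt_0_nat)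
  also have "\<dots> = 8 * U / y * ?H ^ 3" by (simp add: power2_eq_square power3_eq_cube)
  finally show ?thesis .
qed

text \<open>Euler's totient is the case \<open>\<epsilon> = 1\<close>, the sum of divisors the case \<open>\<epsilon> = -1\<close>.\<close>

locale shifted_multiplicative =
  fixes f :: "nat \<Rightarrow> nat" and \<epsilon> :: int
  assumes eps: "\<epsilon> = 1 \<or> \<epsilon> = -1"
    and mult: "coprime a b \<Longrightarrow> f (a * b) = f a * f b"
    and at_prime: "prime q \<Longrightarrow> int (f q) = int q - \<epsilon>"
    and pos: "n > 0 \<Longrightarrow> f n > 0"
    and prime_power_le: "prime q \<Longrightarrow> f (q ^ e) \<le> 2 * q ^ e"
begin

section \<open>Prime factors of the values, and the linear equations for
  \<open>(q1, q2)\<close>\<close>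

lemma f_1: "f 1 = 1"
  using mult[of 1 1] pos[of 1] by simp

text \<open>By multiplicativity the prime \<open>p\<close> divides the value at one full prime power
  component of \<open>n\<close>. Strong induction peels off one component at a time.\<close>

lemma prime_dvd_value:
  assumes "prime p" "p dvd f n" "n > 0"
  shows "\<exists>q e m. prime q \<and> e \<ge> 1 \<and> n = q ^ e * m \<and> coprime (q ^ e) m \<and> p dvd f (q ^ e)"
  using assms(2,3)
proof (induction n rule: less_induct)
  case (less n)
  have "n \<noteq> 1" using less.prems f_1 assms(1) by auto
  then obtain q where q: "prime q" "q dvd n" by (rule prime_factor_nat[THEN exE]) blast
  define e where "e = multiplicity q n"
  have e: "e \<ge> 1" unfolding e_def using q less.prems by (simp add: Suc_le_eq prime_multiplicity_gt_zero_iff)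
  obtain m where m: "n = q ^ e * m" "\<not> q dvd m"
    using multiplicity_decompose'[of n q] less.prems q unfolding e_def
    by (metis not_prime_unit neq0_conv)
  have cop: "coprime (q ^ e) m" using m q by (simp add: prime_imp_coprime)
  hence "f n = f (q ^ e) * f m" unfolding m(1) by (rule mult)
  hence "p dvd f (q ^ e) \<or> p dvd f m" using less.prems assms(1) by (simp add: prime_dvd_mult_iff)
  thus ?case
  proof
    assume "p dvd f (q ^ e)"
    thus ?thesis using q e m cop by blast
  next
    assume pm: "p dvd f m"
    have m0: "m > 0" using m(1) less.prems by (auto intro: Nat.gr0I)
    have "q ^ e > 1" using e prime_gt_1_nat[OF q(1)] by (intro one_less_power) auto
    hence "m < n" unfolding m(1) using m0 by simp
    then obtain q' e' m' where 1: "prime q'" "e' \<ge> 1" "m = q' ^ e' * m'" "coprime (q' ^ e') m'" "p dvd f (q' ^ e')"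
      using less.IH[OF _ pm m0] by blast
    have "q' dvd m" using 1 by (simp add: dvd_power)
    hence "q' \<noteq> q" using m by blast
    hence "coprime (q' ^ e') (q ^ e)" using 1(1) q(1) by (simp add: primes_coprime)
    hence "coprime (q' ^ e') (q ^ e * m')" using 1(4) by simp
    moreover have "n = q' ^ e' * (q ^ e * m')" using m(1) 1(3) by (simp add: mult_ac)
    ultimately show ?thesis using 1 by blast
  qed
qed

text \<open>Common form of both exceptional definitions: for \<open>\<epsilon> = -1\<close> the
  factor \<open>\<epsilon>\<close> reverses \<open>k1 - k2\<close>, and primality is stated over the
  integers so that \<open>k * l - 1\<close> involves no truncated subtraction.\<close>

definition exceptional :: "int \<Rightarrow> int \<Rightarrow> int \<Rightarrow> int \<Rightarrow> nat \<Rightarrow> bool" where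
  "exceptional a1 b1 a2 b2 n \<longleftrightarrow>
     (\<exists>m1 m2 k1 k2 l :: nat. m1 > 0 \<and> m2 > 0 \<and> k1 > 0 \<and> k2 > 0 \<and> l > 0 \<and> k1 \<noteq> k2 \<and>
        int m1 * (a2 * (\<epsilon> * (int k1 - int k2))) = int k2 * (a1 * b2 - a2 * b1) \<and>
        int m2 * (a1 * (\<epsilon> * (int k1 - int k2))) = int k1 * (a1 * b2 - a2 * b1) \<and>
        k1 * f m1 = k2 * f m2 \<and>
        prime (int k1 * int l + \<epsilon>) \<and> prime (int k2 * int l + \<epsilon>) \<and>
        a1 * int n = int m1 * (int k1 * int l + \<epsilon>) - b1)"

text \<open>Take \<open>k1 : k2\<close> to be \<open>f m2 : f m1\<close> in lowest terms.
  Coprimality then forces a common \<open>l\<close> with \<open>q1 = k1 * l + \<epsilon>\<close> and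
  \<open>q2 = k2 * l + \<epsilon>\<close>, and the vanishing determinant eliminates \<open>l\<close>
  from \<open>a1 * b2 - a2 * b1\<close>, which leaves the two equations for \<open>m1\<close> and
  \<open>m2\<close>.\<close>

lemma singular_imp_exceptional:
  fixes m1 m2 q1 q2 n :: nat
  assumes m: "m1 > 0" "m2 > 0" and q: "prime q1" "prime q2" "q1 \<noteq> q2"
    and n: "a1 * int n + b1 = int m1 * int q1" "a2 * int n + b2 = int m2 * int q2"
    and f: "int (f m1) * (int q1 - \<epsilon>) = int (f m2) * (int q2 - \<epsilon>)"
    and det: "int (f m1) * a1 * int m2 = int (f m2) * a2 * int m1"
  shows "exceptional a1 b1 a2 b2 n"
proof -
  define g where "g = gcd (f m1) (f m2)"
  define k1 where "k1 = f m2 div g"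
  define k2 where "k2 = f m1 div g"
  have f0: "f m1 > 0" "f m2 > 0" using m pos by auto
  have g0: "g > 0" unfolding g_def using f0 by simp
  have k: "f m2 = g * k1" "f m1 = g * k2" unfolding k1_def k2_def g_def by auto
  have k0: "k1 > 0" "k2 > 0" using k f0 by (auto intro!: Nat.gr0I)
  have cop: "coprime k1 k2" unfolding k1_def k2_def g_def
    using div_gcd_coprime[of "f m2" "f m1"] f0 by (simp add: gcd.commute)
  have f': "int k2 * (int q1 - \<epsilon>) = int k1 * (int q2 - \<epsilon>)"
  proof -
    have "int g * (int k2 * (int q1 - \<epsilon>)) = int g * (int k1 * (int q2 - \<epsilon>))"
      using f unfolding k by (simp add: mult_ac)
    thus ?thesis using g0 by simp
  qed
  have det': "int k2 * a1 * int m2 = int k1 * a2 * int m1"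
  proof -
    have "int g * (int k2 * a1 * int m2) = int g * (int k1 * a2 * int m1)"
      using det unfolding k by (simp add: mult_ac)
    thus ?thesis using g0 by simp
  qed
  have "int k1 dvd int k2 * (int q1 - \<epsilon>)" unfolding f' by simp
  hence "int k1 dvd int q1 - \<epsilon>" using cop by (simp add: coprime_dvd_mult_right_iff)
  then obtain l' where l': "int q1 - \<epsilon> = int k1 * l'" by blast
  have "int q1 - \<epsilon> > 0" using q(1) prime_ge_2_nat[of q1] eps by auto
  hence l0: "l' > 0" unfolding l' using k0 by (simp add: zero_less_mult_iff)
  define l where "l = nat l'"
  have l: "l > 0" "int l = l'" unfolding l_def using l0 by auto
  have q1: "int q1 = int k1 * int l + \<epsilon>" using l' l by simp
  have "int k1 * (int k2 * int l) = int k1 * (int q2 - \<epsilon>)" using f' unfolding l' l(2) by (simp add: mult_ac)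
  hence q2: "int q2 = int k2 * int l + \<epsilon>" using k0 by simp
  have kne: "k1 \<noteq> k2" using q1 q2 q(3) by auto
  \<comment> \<open>Expressed through the values of both linear forms at \<open>n\<close>, the
    determinant becomes linear in \<open>l\<close>, and the coefficient of \<open>l\<close> is the
    difference of the two sides of \<open>det'\<close>.\<close>
  have D: "a1 * b2 - a2 * b1 = \<epsilon> * (a1 * int m2 - a2 * int m1)"
  proof -
    have "a1 * b2 - a2 * b1 = a1 * (a2 * int n + b2) - a2 * (a1 * int n + b1)" by (simp add: algebra_simps)
    also have "\<dots> = a1 * (int m2 * (int k2 * int l + \<epsilon>)) - a2 * (int m1 * (int k1 * int l + \<epsilon>))"
      unfolding n q1 q2 ..
    also have "\<dots> = (int k2 * a1 * int m2 - int k1 * a2 * int m1) * int l + \<epsilon> * (a1 * int m2 - a2 * int m1)"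
      by (simp add: algebra_simps)
    finally show ?thesis unfolding det' by simp
  qed
  have 1: "int m1 * (a2 * (\<epsilon> * (int k1 - int k2))) = int k2 * (a1 * b2 - a2 * b1)"
  proof -
    have "int m1 * (a2 * (\<epsilon> * (int k1 - int k2))) = \<epsilon> * (int k1 * a2 * int m1 - int k2 * a2 * int m1)"
      by (simp add: algebra_simps)
    also have "\<dots> = int k2 * (a1 * b2 - a2 * b1)" unfolding det'[symmetric] D by (simp add: algebra_simps)
    finally show ?thesis .
  qed
  have 2: "int m2 * (a1 * (\<epsilon> * (int k1 - int k2))) = int k1 * (a1 * b2 - a2 * b1)"
  proof -
    have "int m2 * (a1 * (\<epsilon> * (int k1 - int k2))) = \<epsilon> * (int k1 * a1 * int m2 - int k2 * a1 * int m2)"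
      by (simp add: algebra_simps)
    also have "\<dots> = int k1 * (a1 * b2 - a2 * b1)" unfolding det' D by (simp add: algebra_simps)
    finally show ?thesis .
  qed
  have 3: "k1 * f m1 = k2 * f m2" unfolding k by (simp add: mult_ac)
  have "prime (int k1 * int l + \<epsilon>)" "prime (int k2 * int l + \<epsilon>)"
    unfolding q1[symmetric] q2[symmetric] using q by auto
  moreover have "a1 * int n = int m1 * (int k1 * int l + \<epsilon>) - b1" using n(1) unfolding q1 by simp
  ultimately show ?thesis unfolding exceptional_def using m k0 l(1) kne 1 2 3 by blast
qed

text \<open>If \<open>n\<close> and \<open>n'\<close> differed, their differences and those of the
  primes would give a nonzero solution of the homogeneous system with coefficients from
  \<open>(m1, m2)\<close>. This forces the determinant to vanish, which is the singular
  case.\<close>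

lemma cofactors_determine:
  fixes m1 m2 q1 q2 n r1 r2 n' :: nat
  assumes a: "a1 > 0" "a2 > 0" and m: "m1 > 0" "m2 > 0" and q: "prime q1" "prime q2" "q1 \<noteq> q2"
    and n: "a1 * int n + b1 = int m1 * int q1" "a2 * int n + b2 = int m2 * int q2"
    and n': "a1 * int n' + b1 = int m1 * int r1" "a2 * int n' + b2 = int m2 * int r2"
    and f: "int (f m1) * (int q1 - \<epsilon>) = int (f m2) * (int q2 - \<epsilon>)"
    and f': "int (f m1) * (int r1 - \<epsilon>) = int (f m2) * (int r2 - \<epsilon>)"
    and ne: "\<not> exceptional a1 b1 a2 b2 n"
  shows "n = n'"
proof (rule ccontr)
  assume "n \<noteq> n'"
  define d1 where "d1 = int q1 - int r1"
  define d2 where "d2 = int q2 - int r2"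
  define \<delta> where "\<delta> = int n - int n'"
  have \<delta>: "\<delta> \<noteq> 0" unfolding \<delta>_def using \<open>n \<noteq> n'\<close> by simp
  have 1: "a1 * \<delta> = int m1 * d1" "a2 * \<delta> = int m2 * d2"
    unfolding \<delta>_def d1_def d2_def using n n' by (simp_all add: algebra_simps)
  have 2: "int (f m1) * d1 = int (f m2) * d2"
    unfolding d1_def d2_def using f f' by (simp add: algebra_simps)
  have d0: "d1 \<noteq> 0" using 1 a \<delta> by auto
  have "(int (f m1) * a1 * int m2) * (d1 * d2) = (int (f m1) * d1) * (a1 * (int m2 * d2))" by (simp add: mult_ac)
  also have "\<dots> = (int (f m2) * d2) * (a1 * (a2 * \<delta>))" unfolding 2 1 ..
  also have "\<dots> = (int (f m2) * d2) * (a2 * (a1 * \<delta>))" by (simp add: mult_ac)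
  also have "\<dots> = (int (f m2) * a2 * int m1) * (d1 * d2)" unfolding 1 by (simp add: mult_ac)
  finally have "(int (f m1) * a1 * int m2) * (d1 * d2) = (int (f m2) * a2 * int m1) * (d1 * d2)" .
  moreover have "d2 \<noteq> 0" using 1 a \<delta> by auto
  ultimately have "int (f m1) * a1 * int m2 = int (f m2) * a2 * int m1" using d0 by simp
  hence "exceptional a1 b1 a2 b2 n" by (rule singular_imp_exceptional[OF m q n f])
  thus False using ne by blast
qed

end

section \<open>Assembly of the count\<close>

lemma card_linear_preimage_le:
  fixes a b :: int and x X :: real
  assumes "a > 0" "\<And>n. 0 < n \<Longrightarrow> real n \<le> x \<Longrightarrow> a * int n + b > 0 \<Longrightarrow> real (nat (a * int n + b)) \<le> X"
    and fin: "finite {m. 0 < m \<and> real m \<le> X \<and> P m}"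
  shows "card {n. 0 < n \<and> real n \<le> x \<and> a * int n + b > 0 \<and> P (nat (a * int n + b))}
         \<le> card {m. 0 < m \<and> real m \<le> X \<and> P m}"
proof (rule card_inj_on_le[OF _ _ fin])
  show "inj_on (\<lambda>n. nat (a * int n + b)) {n. 0 < n \<and> real n \<le> x \<and> a * int n + b > 0 \<and> P (nat (a * int n + b))}"
  proof (rule inj_onI)
    fix u v
    assume "u \<in> {n. 0 < n \<and> real n \<le> x \<and> a * int n + b > 0 \<and> P (nat (a * int n + b))}"
      and "v \<in> {n. 0 < n \<and> real n \<le> x \<and> a * int n + b > 0 \<and> P (nat (a * int n + b))}"
      and eq: "nat (a * int u + b) = nat (a * int v + b)"
    hence "a * int u + b > 0" "a * int v + b > 0" by auto
    hence "a * int u + b = a * int v + b" using eq by (metis nat_eq_iff2 less_imp_le)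
    thus "u = v" using assms(1) by simp
  qed
qed (use assms(2) in auto)

context shifted_multiplicative
begin

text \<open>The terms bound, in this order, smooth values, large proper prime powers, pairs of
  primes with small product, and pairs of cofactors. \<open>y\<close> has to exceed the coefficients
  and the determinant because the primes found are larger than \<open>y - 1\<close>: they must
  divide neither \<open>a1\<close> nor \<open>a2\<close>, nor both linear forms at once.\<close>

lemma card_nonexceptional_le:
  fixes a1 b1 a2 b2 :: int and x X y :: real
  assumes a: "a1 > 0" "a2 > 0" and D: "a1 * b2 - a2 * b1 \<noteq> 0" and x: "1 \<le> x" "x \<le> X"
    and X1: "\<And>n. 0 < n \<Longrightarrow> real n \<le> x \<Longrightarrow> a1 * int n + b1 > 0 \<Longrightarrow> real (nat (a1 * int n + b1)) \<le> X"
    and X2: "\<And>n. 0 < n \<Longrightarrow> real n \<le> x \<Longrightarrow> a2 * int n + b2 > 0 \<Longrightarrow> real (nat (a2 * int n + b2)) \<le> X"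
    and y: "y \<ge> 2" "real_of_int a1 < y - 1" "real_of_int a2 < y - 1" "real_of_int \<bar>a1 * b2 - a2 * b1\<bar> < y - 1"
  defines "smooth \<equiv> (\<lambda>n. \<forall>q p. prime q \<longrightarrow> q dvd n \<longrightarrow> prime p \<longrightarrow> int p dvd int q - \<epsilon> \<longrightarrow> real p \<le> y)"
  shows "real (card {n. 0 < n \<and> real n \<le> x \<and> a1 * int n + b1 > 0 \<and> a2 * int n + b2 > 0 \<and>
            f (nat (a1 * int n + b1)) = f (nat (a2 * int n + b2)) \<and> \<not> exceptional a1 b1 a2 b2 n})
         \<le> real (card {n. n > 0 \<and> real n \<le> X \<and> smooth n})
           + 8 * (X / sqrt (y / 2) * (1 + ln X)) + 8 * X / sqrt y * (1 + ln (X + 1)) ^ 3 + X / sqrt y * (1 + ln X)"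
proof -
  \<comment> \<open>Half of \<open>y\<close>, because a prime \<open>p > y\<close> dividing
    \<open>f (q ^ e) \<le> 2 * q ^ e\<close> only gives \<open>q ^ e > y / 2\<close>.\<close>
  define t where "t = y / 2"
  \<comment> \<open>The balance point: up to logarithms, the primes with product at most
    \<open>U\<close> contribute \<open>U / y\<close> and the pairs of cofactors contribute
    \<open>X ^ 2 / U\<close>.\<close>
  define U where "U = X * sqrt y"
  have X1': "X \<ge> 1" using x by simp
  define Bad where "Bad = {n. 0 < n \<and> real n \<le> x \<and> a1 * int n + b1 > 0 \<and> a2 * int n + b2 > 0 \<and>
            f (nat (a1 * int n + b1)) = f (nat (a2 * int n + b2)) \<and> \<not> exceptional a1 b1 a2 b2 n}"
  define S0 where "S0 = {n. 0 < n \<and> real n \<le> x \<and> a1 * int n + b1 > 0 \<and> smooth (nat (a1 * int n + b1))}"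
  define S1 where "S1 = {n. 0 < n \<and> real n \<le> x \<and> a1 * int n + b1 > 0 \<and> large_proper_power t (nat (a1 * int n + b1))}"
  define S2 where "S2 = {n. 0 < n \<and> real n \<le> x \<and> a2 * int n + b2 > 0 \<and> large_proper_power t (nat (a2 * int n + b2))}"
  define S3 where "S3 = {n. 0 < n \<and> real n \<le> x \<and> (\<exists>p q1 q2. prime p \<and> real p > y \<and> prime q1 \<and> prime q2 \<and> q1 \<noteq> q2
           \<and> real q1 \<le> X \<and> real q2 \<le> X \<and> int p dvd int q1 - \<epsilon> \<and> int p dvd int q2 - \<epsilon>
           \<and> int q1 dvd a1 * int n + b1 \<and> int q2 dvd a2 * int n + b2 \<and> real q1 * real q2 \<le> U)}"
  define Pairs where "Pairs = {(m1 :: nat, m2 :: nat). 0 < m1 \<and> 0 < m2 \<and> real m1 \<le> X \<and> real m1 * real m2 \<le> X / sqrt y}"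
  define R where "R = (\<lambda>n (m1, m2). \<exists>q1 q2. prime q1 \<and> prime q2 \<and> q1 \<noteq> q2 \<and> m1 > 0 \<and> m2 > 0 \<and>
      a1 * int n + b1 = int m1 * int q1 \<and> a2 * int n + b2 = int m2 * int q2 \<and>
      int (f m1) * (int q1 - \<epsilon>) = int (f m2) * (int q2 - \<epsilon>))"
  define S4 where "S4 = {n \<in> Bad. \<exists>u\<in>Pairs. R n u}"
  have fin: "finite {n. 0 < n \<and> real n \<le> x \<and> Q n}" for Q
    by (rule finite_subset[of _ "{..nat \<lfloor>x\<rfloor>}"]) (auto simp: le_nat_floor)
  have finX: "finite {m. 0 < m \<and> real m \<le> X \<and> Q m}" for Q
    by (rule finite_subset[of _ "{..nat \<lfloor>X\<rfloor>}"]) (auto simp: le_nat_floor)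
  have finPairs: "finite Pairs" unfolding Pairs_def by (rule card_pairs_product_le(2)[OF X1']) (use X1' y in auto)
  have sq: "sqrt y > 0" "sqrt y * sqrt y = y" using y by auto

  have sub: "Bad \<subseteq> S0 \<union> (S1 \<union> (S2 \<union> (S3 \<union> S4)))"
  proof
    fix n assume n: "n \<in> Bad"
    define N1 where "N1 = nat (a1 * int n + b1)"
    define N2 where "N2 = nat (a2 * int n + b2)"
    have N: "N1 > 0" "N2 > 0" "int N1 = a1 * int n + b1" "int N2 = a2 * int n + b2" "f N1 = f N2"
      "0 < n" "real n \<le> x" "a1 * int n + b1 > 0" "a2 * int n + b2 > 0"
      using n unfolding N1_def N2_def Bad_def by auto
    have NX: "real N1 \<le> X" "real N2 \<le> X" using X1 X2 N unfolding N1_def N2_def by auto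
    show "n \<in> S0 \<union> (S1 \<union> (S2 \<union> (S3 \<union> S4)))"
    proof (rule ccontr)
      assume *: "n \<notin> S0 \<union> (S1 \<union> (S2 \<union> (S3 \<union> S4)))"
      have nS0: "\<not> smooth N1" using * N unfolding S0_def N1_def by auto
      have nS1: "\<not> large_proper_power t N1" using * N unfolding S1_def N1_def by auto
      have nS2: "\<not> large_proper_power t N2" using * N unfolding S2_def N2_def by auto
      obtain q1 p where q1: "prime q1" "q1 dvd N1" and p: "prime p" "int p dvd int q1 - \<epsilon>" "real p > y"
        using nS0 unfolding smooth_def by (auto simp: not_le)
      have big: "real q > y - 1" if "prime q" "int p dvd int q - \<epsilon>" for q
      proof -
        have "q \<ge> 2" using that prime_ge_2_nat by blast
        hence "int p \<le> int q - \<epsilon>" using that eps by (intro zdvd_imp_le) auto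
        hence "int p - 1 \<le> int q" using eps by auto
        thus ?thesis using p(3) by linarith
      qed
      obtain m1 where m1: "N1 = q1 * m1" using q1(2) by blast
      have cop1: "coprime q1 m1"
      proof (rule prime_imp_coprime[OF q1(1)], rule)
        assume "q1 dvd m1"
        hence "q1 ^ 2 dvd N1" unfolding m1 by (simp add: power2_eq_square)
        moreover have "real (q1 ^ 2) > t"
        proof -
          have "q1 \<le> q1 ^ 2" using q1(1) prime_gt_0_nat by (intro self_le_power) (auto simp: Suc_le_eq)
          hence "real q1 \<le> real (q1 ^ 2)" by (simp only: of_nat_le_iff)
          moreover have "y - 1 \<ge> t" unfolding t_def using y by simp
          ultimately show ?thesis using big[OF q1(1) p(2)] by linarith
        qed
        ultimately have "large_proper_power t N1" unfolding large_proper_power_def using q1(1) by blast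
        thus False using nS1 by blast
      qed
      have fN1: "f N1 = f q1 * f m1" unfolding m1 by (rule mult[OF cop1])
      have "int p dvd int (f q1)" using p(2) at_prime[OF q1(1)] by simp
      hence "p dvd f N1" unfolding fN1 by simp
      hence "p dvd f N2" using N(5) by simp
      then obtain q2 e m2 where q2: "prime q2" "e \<ge> 1" "N2 = q2 ^ e * m2" "coprime (q2 ^ e) m2" "p dvd f (q2 ^ e)"
        using prime_dvd_value[OF p(1) _ N(2)] by blast
      have "e = 1"
      proof (rule ccontr)
        assume "e \<noteq> 1"
        hence e2: "e \<ge> 2" using q2(2) by simp
        have "f (q2 ^ e) > 0" using q2(1) prime_gt_0_nat by (intro pos) auto
        hence "p \<le> f (q2 ^ e)" using q2(5) by (rule dvd_imp_le[rotated])
        also have "\<dots> \<le> 2 * q2 ^ e" by (rule prime_power_le[OF q2(1)])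
        finally have "real p \<le> real (2 * q2 ^ e)" by (simp only: of_nat_le_iff)
        hence "real (q2 ^ e) > t" using p(3) unfolding t_def by simp
        hence "large_proper_power t N2" unfolding large_proper_power_def using q2 e2 by (metis dvd_triv_left)
        thus False using nS2 by blast
      qed
      note q2 = q2[unfolded this power_one_right]
      have fN2: "f N2 = f q2 * f m2" unfolding q2(3) by (rule mult[OF q2(4)])
      have p2: "int p dvd int q2 - \<epsilon>" using q2(5) at_prime[OF q2(1)] by (metis int_dvd_int_iff)
      have m0: "m1 > 0" "m2 > 0" using N(1,2) unfolding m1 q2(3) by (auto intro!: Nat.gr0I)
      have q12: "q1 \<noteq> q2"
      proof
        assume eq: "q1 = q2"
        have "int q1 dvd a1 * (a2 * int n + b2) - a2 * (a1 * int n + b1)"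
          unfolding N(3,4)[symmetric] using q1(2) q2(3) eq by (intro dvd_diff dvd_mult) auto
        also have "a1 * (a2 * int n + b2) - a2 * (a1 * int n + b1) = a1 * b2 - a2 * b1" by (simp add: algebra_simps)
        finally have "int q1 \<le> \<bar>a1 * b2 - a2 * b1\<bar>" using D by (intro zdvd_imp_le) auto
        thus False using big[OF q1(1) p(2)] y(4) by linarith
      qed
      have qX: "real q1 \<le> X" "real q2 \<le> X"
      proof -
        have "q1 \<le> N1" "q2 \<le> N2" unfolding m1 q2(3) using m0 by auto
        thus "real q1 \<le> X" "real q2 \<le> X" using NX by linarith+
      qed
      have "\<not> real q1 * real q2 \<le> U"
      proof
        assume "real q1 * real q2 \<le> U"
        moreover have "int q1 dvd a1 * int n + b1" "int q2 dvd a2 * int n + b2"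
          unfolding N(3,4)[symmetric] m1 q2(3) by auto
        ultimately have "n \<in> S3" unfolding S3_def using N p p2 q1 q2 q12 qX by blast
        thus False using * by blast
      qed
      hence qU: "real q1 * real q2 > U" by simp
      have m1X: "real m1 \<le> X"
      proof -
        have "m1 \<le> N1" unfolding m1 using prime_gt_0_nat[OF q1(1)] by simp
        thus ?thesis using NX by linarith
      qed
      have "U * (real m1 * real m2) \<le> (real q1 * real q2) * (real m1 * real m2)"
        using qU by (intro mult_right_mono) auto
      also have "\<dots> = real N1 * real N2" unfolding m1 q2(3) by simp
      also have "\<dots> \<le> X * X" using NX X1' by (intro mult_mono) auto
      finally have "X * (sqrt y * (real m1 * real m2)) \<le> X * X" unfolding U_def by (simp add: mult_ac)
      hence "sqrt y * (real m1 * real m2) \<le> X" using X1' by simp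
      hence "real m1 * real m2 \<le> X / sqrt y" using sq by (simp add: field_simps)
      hence "(m1, m2) \<in> Pairs" unfolding Pairs_def using m0 m1X by auto
      moreover have "R n (m1, m2)"
      proof -
        have "int (f m1) * (int q1 - \<epsilon>) = int (f N1)" unfolding fN1 at_prime[OF q1(1), symmetric] by simp
        moreover have "int (f m2) * (int q2 - \<epsilon>) = int (f N2)" unfolding fN2 at_prime[OF q2(1), symmetric] by simp
        moreover have "a1 * int n + b1 = int m1 * int q1" "a2 * int n + b2 = int m2 * int q2"
          unfolding N(3,4)[symmetric] m1 q2(3) by auto
        ultimately show ?thesis unfolding R_def using q1 q2 q12 m0 N(5) by auto
      qed
      ultimately have "n \<in> S4" unfolding S4_def using n by blast
      thus False using * by blast
    qed
  qed
  have c0: "card S0 \<le> card {n. n > 0 \<and> real n \<le> X \<and> smooth n}"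
    unfolding S0_def by (rule card_linear_preimage_le[OF a(1) X1 finX])
  have t0: "t > 0" unfolding t_def using y by simp
  have "card S1 \<le> card {m. 0 < m \<and> real m \<le> X \<and> large_proper_power t m}"
    unfolding S1_def by (rule card_linear_preimage_le[OF a(1) X1 finX])
  hence c1: "real (card S1) \<le> X / sqrt t * (4 * (1 + ln X))"
    using card_large_proper_power_le[OF X1' t0] by linarith
  have "card S2 \<le> card {m. 0 < m \<and> real m \<le> X \<and> large_proper_power t m}"
    unfolding S2_def by (rule card_linear_preimage_le[OF a(2) X2 finX])
  hence c2: "real (card S2) \<le> X / sqrt t * (4 * (1 + ln X))"
    using card_large_proper_power_le[OF X1' t0] by linarith
  have "x \<le> U"
  proof -
    have "1 \<le> sqrt y" using y by simp
    hence "X * 1 \<le> U" unfolding U_def using X1' by (intro mult_left_mono) auto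
    thus ?thesis using x by simp
  qed
  hence "real (card S3) \<le> 8 * U / y * (1 + ln (X + 1)) ^ 3"
    unfolding S3_def using a y x X1' eps by (intro card_common_shift_le) auto
  also have "8 * U / y = 8 * X / sqrt y" unfolding U_def using sq by (simp add: divide_simps)
  finally have c3: "real (card S3) \<le> 8 * X / sqrt y * (1 + ln (X + 1)) ^ 3" .
  have "card S4 \<le> card Pairs"
  proof -
    \<comment> \<open>One pair of cofactors is chosen for each \<open>n\<close>. The choice is
      injective by \<open>cofactors_determine\<close>, since the elements of \<open>S4\<close> are
      not exceptional.\<close>
    have "\<forall>n\<in>S4. \<exists>u\<in>Pairs. R n u" unfolding S4_def by blast
    then obtain h where h: "\<And>n. n \<in> S4 \<Longrightarrow> h n \<in> Pairs \<and> R n (h n)" by metis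
    have "inj_on h S4"
    proof (rule inj_onI)
      fix n n' assume nn: "n \<in> S4" "n' \<in> S4" "h n = h n'"
      obtain m1 m2 where hm: "h n = (m1, m2)" by (cases "h n")
      have "R n (m1, m2)" "R n' (m1, m2)" using h[OF nn(1)] h[OF nn(2)] nn(3) hm by auto
      moreover have "\<not> exceptional a1 b1 a2 b2 n" using nn(1) unfolding S4_def Bad_def by blast
      ultimately show "n = n'" unfolding R_def prod.case
        by (elim exE conjE) (rule cofactors_determine[OF a])
    qed
    thus ?thesis using h finPairs by (intro card_inj_on_le[of h]) auto
  qed
  moreover have "real (card Pairs) \<le> X / sqrt y * (1 + ln X)"
    unfolding Pairs_def by (rule card_pairs_product_le(1)[OF X1']) (use X1' y in auto)
  ultimately have c4: "real (card S4) \<le> X / sqrt y * (1 + ln X)" by linarith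
  have fins: "finite S0" "finite S1" "finite S2" "finite S3" "finite S4"
    unfolding S0_def S1_def S2_def S3_def S4_def Bad_def using fin by auto
  have "card Bad \<le> card (S0 \<union> (S1 \<union> (S2 \<union> (S3 \<union> S4))))" using sub fins by (intro card_mono) auto
  also have "\<dots> \<le> card S0 + (card S1 + (card S2 + (card S3 + card S4)))"
    by (intro order.trans[OF card_Un_le] add_left_mono order.refl)
  finally have "real (card Bad) \<le> real (card S0) + (real (card S1) + (real (card S2) + (real (card S3) + real (card S4))))"
    by linarith
  moreover have "real (card S0) \<le> real (card {n. n > 0 \<and> real n \<le> X \<and> smooth n})" using c0 by simp
  moreover have "8 * (X / sqrt t * (1 + ln X)) = X / sqrt t * (4 * (1 + ln X)) + X / sqrt t * (4 * (1 + ln X))"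
    by (simp only: mult_ac) simp
  ultimately show ?thesis unfolding Bad_def[symmetric] t_def[symmetric]
    using c1 c2 c3 c4 by linarith
qed

lemma card_nonexceptional_bigo:
  fixes a1 b1 a2 b2 :: int
  assumes a: "a1 > 0" "a2 > 0" and D: "a1 * b2 - a2 * b1 \<noteq> 0"
  shows "\<exists>C. eventually (\<lambda>x. real (card {n. 0 < n \<and> real n \<le> x \<and> a1 * int n + b1 > 0 \<and> a2 * int n + b2 > 0 \<and>
            f (nat (a1 * int n + b1)) = f (nat (a2 * int n + b2)) \<and> \<not> exceptional a1 b1 a2 b2 n})
         \<le> C * x * exp (- (1 / sqrt 2) * sqrt (ln x * ln (ln (ln x))))) at_top"
proof -
  define A where "A = real_of_int (a1 + \<bar>b1\<bar> + a2 + \<bar>b2\<bar>)"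
  define c where "c = max (real_of_int a1) (max (real_of_int a2) (real_of_int \<bar>a1 * b2 - a2 * b1\<bar>))"
  have A1: "A \<ge> 1" unfolding A_def using a by simp
  have ln: "filterlim (ln :: real \<Rightarrow> real) at_top at_top" by real_asymp
  have "filterlim (\<lambda>L. exp (cutoff L)) at_top at_top" unfolding cutoff_def by real_asymp
  hence "eventually (\<lambda>L. exp (cutoff L) > c + 2) at_top" by (simp add: filterlim_at_top_dense)
  hence 1: "eventually (\<lambda>x. exp (cutoff (ln x)) > c + 2) at_top" by (rule eventually_compose_filterlim[OF _ ln])
  have 2: "eventually (\<lambda>x. 1 + ln (A * x + 1) \<le> 2 * ln x) at_top" using A1 by real_asymp
  have 3: "eventually (\<lambda>x::real. ln x \<ge> 1) at_top" by real_asymp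
  have 4: "eventually (\<lambda>x::real. x \<ge> 1) at_top" by real_asymp
  show ?thesis
  \<comment> \<open>The constant adds up 1 for smooth values, 32 for prime powers, 64 for pairs of
    primes and 2 for cofactors, in units of \<open>A * x * s\<close>.\<close>
  proof (rule exI[of _ "99 * A"])
    show "eventually (\<lambda>x. real (card {n. 0 < n \<and> real n \<le> x \<and> a1 * int n + b1 > 0 \<and> a2 * int n + b2 > 0 \<and>
            f (nat (a1 * int n + b1)) = f (nat (a2 * int n + b2)) \<and> \<not> exceptional a1 b1 a2 b2 n})
         \<le> 99 * A * x * exp (- (1 / sqrt 2) * sqrt (ln x * ln (ln (ln x))))) at_top"
      using card_shifted_smooth_le[OF eps A1] 1 2 3 4
    proof eventually_elim
      case (elim x)
      define L where "L = ln x"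
      define y where "y = exp (cutoff L)"
      define s where "s = exp (- (1 / sqrt 2) * sqrt (L * ln (ln L)))"
      have L: "L \<ge> 1" "x \<ge> 1" using elim unfolding L_def by auto
      have c0: "c > 0" unfolding c_def using a by simp
      have yc: "y > c + 2" using elim(2) unfolding y_def L_def .
      have y2: "y \<ge> 2" using yc c0 by simp
      have XA: "x \<le> A * x" using A1 L by simp
      have bound: "real (nat (a * int n + b)) \<le> A * x" if "0 < n" "real n \<le> x" "a * int n + b > 0" "real_of_int (a + \<bar>b\<bar>) \<le> A" "a > 0" for n a b
      proof -
        have "real (nat (a * int n + b)) = real_of_int a * real n + real_of_int b" using that(3) by simp
        also have "\<dots> \<le> real_of_int a * x + real_of_int \<bar>b\<bar> * x"
        proof (intro add_mono mult_left_mono)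
          have "real_of_int b \<le> real_of_int \<bar>b\<bar> * 1" by simp
          also have "\<dots> \<le> real_of_int \<bar>b\<bar> * x" using L by (intro mult_left_mono) auto
          finally show "real_of_int b \<le> real_of_int \<bar>b\<bar> * x" .
        qed (use that in auto)
        also have "\<dots> = real_of_int (a + \<bar>b\<bar>) * x" by (simp add: algebra_simps)
        also have "\<dots> \<le> A * x" using that L by (intro mult_right_mono) auto
        finally show ?thesis .
      qed
      have sy: "1 / sqrt y = s / L ^ 3"
      proof -
        have "sqrt y = exp (cutoff L / 2)"
          unfolding y_def by (rule real_sqrt_unique) (auto simp: power2_eq_square simp flip: exp_add)
        moreover have "cutoff L / 2 = (1 / sqrt 2) * sqrt (L * ln (ln L)) + 3 * ln L"
        proof -
          have r: "1 / sqrt 2 = sqrt 2 / (2::real)" by (simp add: divide_simps)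
          have "(u * v + 6 * w) / 2 = u / 2 * v + 3 * w" for u v w :: real by simp
          thus ?thesis unfolding cutoff_def r .
        qed
        moreover have "exp (3 * ln L) = L ^ 3" using L exp_of_nat_mult[of 3 "ln L"] by simp
        ultimately have "sqrt y = exp ((1 / sqrt 2) * sqrt (L * ln (ln L))) * L ^ 3" by (simp add: exp_add)
        thus ?thesis unfolding s_def by (simp add: exp_minus field_simps)
      qed
      have lnX: "1 + ln (A * x) \<le> 2 * L" "1 + ln (A * x + 1) \<le> 2 * L" "1 + ln (A * x) \<ge> 0" "1 + ln (A * x + 1) \<ge> 0"
      proof -
        have Ax: "A * x \<ge> 1" using XA L by linarith
        show 1: "1 + ln (A * x + 1) \<le> 2 * L" using elim(3) unfolding L_def .
        have "ln (A * x) \<le> ln (A * x + 1)" using Ax by (subst ln_le_cancel_iff) auto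
        thus "1 + ln (A * x) \<le> 2 * L" using 1 by linarith
        show "1 + ln (A * x) \<ge> 0" using Ax ln_ge_zero[of "A * x"] by linarith
        show "1 + ln (A * x + 1) \<ge> 0" using Ax ln_ge_zero[of "A * x + 1"] by linarith
      qed
      have s0: "s > 0" unfolding s_def by simp
      have L3: "L \<le> L ^ 3" using L by (intro self_le_power) auto
      have Z: "A * x / sqrt y * (1 + ln (A * x)) \<le> 2 * (A * x * s)"
      proof -
        have "A * x / sqrt y * (1 + ln (A * x)) = A * x * (s / L ^ 3) * (1 + ln (A * x))"
          unfolding sy[symmetric] by simp
        also have "\<dots> \<le> A * x * (s / L ^ 3) * (2 * L ^ 3)"
          using lnX L3 A1 L s0 by (intro mult_left_mono) auto
        also have "\<dots> = 2 * (A * x * s)" using L by simp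
        finally show ?thesis .
      qed
      have Z3: "8 * (A * x) / sqrt y * (1 + ln (A * x + 1)) ^ 3 \<le> 64 * (A * x * s)"
      proof -
        have "8 * (A * x) / sqrt y * (1 + ln (A * x + 1)) ^ 3 = 8 * (A * x) * (s / L ^ 3) * (1 + ln (A * x + 1)) ^ 3"
          unfolding sy[symmetric] by simp
        also have "\<dots> \<le> 8 * (A * x) * (s / L ^ 3) * (2 * L) ^ 3"
          using lnX A1 L s0 by (intro mult_left_mono power_mono) auto
        also have "\<dots> = 64 * (A * x * s)" using L by (simp add: power_mult_distrib)
        finally show ?thesis .
      qed
      have Z1: "8 * (A * x / sqrt (y / 2) * (1 + ln (A * x))) \<le> 32 * (A * x * s)"
      proof -
        have "sqrt y \<le> 2 * sqrt (y / 2)"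
        proof -
          have "sqrt y \<le> sqrt (4 * (y / 2))" using y2 by (intro real_sqrt_le_mono) auto
          also have "\<dots> = 2 * sqrt (y / 2)" by (subst real_sqrt_mult) simp
          finally show ?thesis .
        qed
        hence "A * x / sqrt (y / 2) \<le> A * x / (sqrt y / 2)"
          using A1 L y2 by (intro divide_left_mono) auto
        hence "A * x / sqrt (y / 2) * (1 + ln (A * x)) \<le> A * x / (sqrt y / 2) * (1 + ln (A * x))"
          using lnX by (intro mult_right_mono)
        thus ?thesis using Z by simp
      qed
      have "real (card {n. 0 < n \<and> real n \<le> x \<and> a1 * int n + b1 > 0 \<and> a2 * int n + b2 > 0 \<and>
            f (nat (a1 * int n + b1)) = f (nat (a2 * int n + b2)) \<and> \<not> exceptional a1 b1 a2 b2 n})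
        \<le> real (card {n. n > 0 \<and> real n \<le> A * x \<and>
            (\<forall>q p. prime q \<longrightarrow> q dvd n \<longrightarrow> prime p \<longrightarrow> int p dvd int q - \<epsilon> \<longrightarrow> real p \<le> y)})
           + 8 * (A * x / sqrt (y / 2) * (1 + ln (A * x))) + 8 * (A * x) / sqrt y * (1 + ln (A * x + 1)) ^ 3
           + A * x / sqrt y * (1 + ln (A * x))"
      proof (rule card_nonexceptional_le[OF a D L(2) XA _ _ y2])
        show "real_of_int a1 < y - 1" "real_of_int a2 < y - 1" "real_of_int \<bar>a1 * b2 - a2 * b1\<bar> < y - 1"
          using yc unfolding c_def by linarith+
      qed (use bound[of _ a1 b1] bound[of _ a2 b2] a in \<open>auto simp: A_def\<close>)
      also have "\<dots> \<le> A * (x * s) + 32 * (A * x * s) + 64 * (A * x * s) + 2 * (A * x * s)"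
        using elim(1)[folded L_def, folded y_def s_def] Z Z1 Z3 by linarith
      also have "\<dots> = 99 * A * x * s" by simp
      finally show ?case unfolding s_def L_def .
    qed
  qed
qed

end

section \<open>The totient and the divisor sum as instances, and the conclusion\<close>

lemma totient_shifted: "shifted_multiplicative totient 1"
proof
  fix q e :: nat assume "prime q"
  show "totient (q ^ e) \<le> 2 * q ^ e" using totient_le[of "q ^ e"] by linarith
next
  fix q :: nat assume "prime q"
  thus "int (totient q) = int q - 1" using prime_ge_1_nat[of q] by (simp add: totient_prime of_nat_diff)
qed (auto simp: totient_mult_coprime)

lemma divsum_mult_coprime:
  assumes "coprime a b"
  shows "divsum (a * b) = divsum a * divsum b"
proof (cases "a = 0 \<or> b = 0")
  case True
  thus ?thesis using assms by (auto simp: divsum_def)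
next
  case False
  have fin: "finite {d. d dvd a}" "finite {d. d dvd b}" using False by auto
  have inj: "inj_on (\<lambda>(d, e). d * e) ({d. d dvd a} \<times> {d. d dvd b})"
  proof (rule inj_onI, clarify)
    fix d e d' e' assume *: "d dvd a" "e dvd b" "d' dvd a" "e' dvd b" "d * e = d' * e'"
    \<comment> \<open>Cross coprimality turns \<open>d * e = d' * e'\<close> into mutual
      divisibility of \<open>d\<close> and \<open>d'\<close>.\<close>
    have "coprime d e'" "coprime d' e" using * assms by (meson coprime_divisors)+
    hence "d dvd d'" "d' dvd d" using *(5) by (metis coprime_dvd_mult_left_iff dvd_triv_left)+
    hence "d = d'" by (rule dvd_antisym)
    moreover have "d \<noteq> 0" using * False by auto
    ultimately show "d = d' \<and> e = e'" using *(5) by simp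
  qed
  have "{d. d dvd a * b} = (\<lambda>(d, e). d * e) ` ({d. d dvd a} \<times> {d. d dvd b})"
  proof (intro equalityI subsetI)
    fix u assume "u \<in> {d. d dvd a * b}"
    then obtain d e where "u = d * e" "d dvd a" "e dvd b" by (auto elim: dvd_productE)
    thus "u \<in> (\<lambda>(d, e). d * e) ` ({d. d dvd a} \<times> {d. d dvd b})" by force
  qed (auto intro: mult_dvd_mono)
  hence "divsum (a * b) = (\<Sum>(d, e)\<in>{d. d dvd a} \<times> {d. d dvd b}. d * e)"
    unfolding divsum_def using sum.reindex[OF inj, of "\<lambda>d. d"] by (simp add: case_prod_beta)
  also have "\<dots> = divsum a * divsum b"
    unfolding divsum_def by (simp add: sum_product sum.cartesian_product)
  finally show ?thesis .
qed

lemma divsum_prime_power: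
  assumes "prime q"
  shows "divsum (q ^ e) = (\<Sum>i\<le>e. q ^ i)"
proof -
  have "{d. d dvd q ^ e} = (\<lambda>i. q ^ i) ` {..e}"
    using divides_primepow_nat[OF assms] by auto
  moreover have "inj_on (\<lambda>i. q ^ i) {..e}"
    using assms prime_gt_1_nat by (auto intro!: inj_onI)
  ultimately show ?thesis unfolding divsum_def by (simp add: sum.reindex)
qed

lemma divsum_shifted: "shifted_multiplicative divsum (-1)"
proof
  fix q e :: nat assume q: "prime q"
  show "int (divsum q) = int q - (-1)" using divsum_prime_power[OF q, of 1] by simp
  have q2: "q \<ge> 2" using q prime_ge_2_nat by blast
  have "(\<Sum>i\<le>e. q ^ i) \<le> 2 * q ^ e"
  proof (induction e)
    case (Suc e)
    have "2 * q ^ e \<le> q * q ^ e" using q2 by (intro mult_right_mono) auto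
    hence "2 * q ^ e \<le> q ^ Suc e" by simp
    moreover have "(\<Sum>i\<le>Suc e. q ^ i) = (\<Sum>i\<le>e. q ^ i) + q ^ Suc e" by (rule sum.atMost_Suc)
    ultimately show ?case using Suc by linarith
  qed simp
  thus "divsum (q ^ e) \<le> 2 * q ^ e" unfolding divsum_prime_power[OF q] .
next
  fix n :: nat assume "n > 0"
  hence "n \<le> divsum n" unfolding divsum_def by (intro member_le_sum) auto
  thus "divsum n > 0" using \<open>n > 0\<close> by linarith
qed (auto simp: divsum_mult_coprime)

theorem theorem1p2:
  fixes a1 b1 a2 b2 :: int
  assumes "a1 > 0" and "a2 > 0" and "a1 * b2 - a2 * b1 \<noteq> 0"
  shows "\<exists>C x0. \<forall>x :: real. x \<ge> x0 \<longrightarrow>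
           real (Ncount a1 b1 a2 b2 x) \<le> C * x * exp (- (1 / sqrt 2) * sqrt (ln x * ln (ln (ln x)))) \<and>
           real (Mcount a1 b1 a2 b2 x) \<le> C * x * exp (- (1 / sqrt 2) * sqrt (ln x * ln (ln (ln x))))"
proof -
  interpret phi: shifted_multiplicative totient 1 by (rule totient_shifted)
  interpret sigma: shifted_multiplicative divsum "-1" by (rule divsum_shifted)
  have phi_eq: "phi.exceptional a1 b1 a2 b2 n = phi_exceptional a1 b1 a2 b2 n" for n
  proof -
    \<comment> \<open>The two definitions differ only in stating primality over the naturals or over
      the integers.\<close>
    have "prime (int k * int l + 1) \<longleftrightarrow> prime (k * l + 1)" for k l :: nat
      by (metis of_nat_1 of_nat_add of_nat_mult prime_nat_int_transfer)
    thus ?thesis unfolding phi.exceptional_def phi_exceptional_def by (simp add: add.commute)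
  qed
  have sigma_eq: "sigma.exceptional a1 b1 a2 b2 n = sigma_exceptional a1 b1 a2 b2 n" for n
    unfolding sigma.exceptional_def sigma_exceptional_def by simp
  let ?g = "\<lambda>x. x * exp (- (1 / sqrt 2) * sqrt (ln x * ln (ln (ln x))))"
  obtain C1 where C1: "eventually (\<lambda>x. real (Ncount a1 b1 a2 b2 x) \<le> C1 * ?g x) at_top"
    using phi.card_nonexceptional_bigo[OF assms] unfolding Ncount_def phi_eq mult.assoc by blast
  obtain C2 where C2: "eventually (\<lambda>x. real (Mcount a1 b1 a2 b2 x) \<le> C2 * ?g x) at_top"
    using sigma.card_nonexceptional_bigo[OF assms] unfolding Mcount_def sigma_eq mult.assoc by blast
  have "eventually (\<lambda>x. real (Ncount a1 b1 a2 b2 x) \<le> max C1 C2 * ?g x \<and>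
                        real (Mcount a1 b1 a2 b2 x) \<le> max C1 C2 * ?g x) at_top"
    using C1 C2 eventually_ge_at_top[of 0]
  proof eventually_elim
    case (elim x)
    have "C1 * ?g x \<le> max C1 C2 * ?g x" "C2 * ?g x \<le> max C1 C2 * ?g x"
      using elim(3) by (intro mult_right_mono; simp)+
    thus ?case using elim(1,2) by linarith
  qed
  thus ?thesis unfolding eventually_at_top_linorder mult.assoc by blast
qed

end
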